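(* Let $z_1<\dots<z_p$ be real numbers, $p\ge2$, and $\alpha_1,\dots,\alpha_p,\gamma$ complex numbers with positive real parts. Then, with the rows and columns indexed by $\mathcal Z_n^{p-1}$ in the same order, $$\det\Big[\int_{\mathbb U_{\mathbf l}}\Phi(t,z)\,\omega_{\mathbf m}(t,z)\Big]_{\mathbf l,\mathbf m\in\mathcal Z_n^{p-1}} =\prod_{s=0}^{n-1}\Big[\frac{\Gamma((s+1)\gamma)^{p-1}}{\Gamma(\gamma)^{p-1}}\frac{\Gamma(1+\alpha_p+s\gamma)\prod_{j=1}^{p-1}\Gamma(\alpha_j+s\gamma)}{\Gamma(1+\sum_{j=1}^p\alpha_j+(2n-2-s)\gamma)}\Big]^{\binom{p+n-s-3}{p-2}}$$ $$\times\exp\Big(i\pi\binom{p+n-2}{p-1}\sum_{s=1}^p(s-1)\alpha_s\Big)\prod_{1\le a<b\le p}(z_b-z_a)^{(\alpha_a+\alpha_b)\binom{p+n-2}{p-1}+2\gamma\binom{p+n-2}{p}}.$$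
   Context: For $t\in\mathbb R^n$, $$\Phi(t,z)=\prod_{s=1}^p\prod_{i=1}^n(t_i-z_s)^{\alpha_s}\prod_{1\le i<j\le n}(t_j-t_i)^{2\gamma},$$ where every power $x^{\alpha_s}$ and $x^{2\gamma}$ uses the branch with $-\pi/2<\arg x<3\pi/2$. $\mathcal Z_n^p=\{\mathbf l=(l_1,\dots,l_p)\in\mathbb Z^p: l_i\ge0,\ l_1+\dots+l_p=n\}$. Set $\mathbf l^s=l_1+\dots+l_s$ and $\mathbf l^0=0$, and $\Gamma_{\mathbf m,s}=\{\mathbf m^{s-1}+1,\dots,\mathbf m^s\}$. For $\mathbf m\in\mathcal Z_n^p$, $$\omega_{\mathbf m}=\Big(\sum_{\sigma\in S_n}\prod_{s=1}^p\frac{1}{m_s!}\prod_{j\in\Gamma_{\mathbf m,s}}\frac{1}{t_{\sigma_j}-z_s}\Big)dt_1\wedge\dots\wedge dt_n,$$ and $\mathbf m\in\mathcal Z_n^{p-1}$ is identified with $(\mathbf m,0)\in\mathcal Z_n^p$. For $\mathbf l\in\mathcal Z_n^{p-1}$, $$\mathbb U_{\mathbf l}=\{t\in\mathbb R^n: z_s\le t_{\mathbf l^{s-1}+1}\le\dots\le t_{\mathbf l^s}\le z_{s+1}\text{ for }s=1,\dots,p-1\},$$ with the standard orientation of $\mathbb R^n$. *)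

theory Defs
  imports "HOL-Analysis.Analysis"
begin

text \<open>Branch of the logarithm with argument in the open interval (-pi/2, 3pi/2).\<close>
definition br_log :: "complex \<Rightarrow> complex" where
  "br_log x = (if Im (Ln x) \<le> - pi / 2 then Ln x + 2 * pi * \<i> else Ln x)"

text \<open>Power x^a using that branch (value at x = 0 irrelevant; set to 0).\<close>
definition br_pow :: "complex \<Rightarrow> complex \<Rightarrow> complex" where
  "br_pow x a = (if x = 0 then 0 else exp (a * br_log x))"

definition Zset :: "nat \<Rightarrow> nat \<Rightarrow> (nat \<Rightarrow> nat) set" where
  "Zset n k = {l. (\<forall>i. i \<notin> {1..k} \<longrightarrow> l i = 0) \<and> (\<Sum>i=1..k. l i) = n}"

definition psum :: "(nat \<Rightarrow> nat) \<Rightarrow> nat \<Rightarrow> nat" where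
  "psum l s = (\<Sum>i=1..s. l i)"

definition Gam :: "(nat \<Rightarrow> nat) \<Rightarrow> nat \<Rightarrow> nat set" where
  "Gam m s = {psum m (s - 1) + 1 .. psum m s}"

definition Phi :: "nat \<Rightarrow> nat \<Rightarrow> (nat \<Rightarrow> real) \<Rightarrow> (nat \<Rightarrow> complex) \<Rightarrow> complex
    \<Rightarrow> (nat \<Rightarrow> real) \<Rightarrow> complex" where
  "Phi n p z \<alpha> \<gamma> t =
     (\<Prod>s=1..p. \<Prod>i=1..n. br_pow (complex_of_real (t i - z s)) (\<alpha> s)) *
     (\<Prod>i=1..n. \<Prod>j\<in>{i<..n}. br_pow (complex_of_real (t j - t i)) (2 * \<gamma>))"

text \<open>Coefficient of omega_m with respect to dt_1 \<and> ... \<and> dt_n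
  (m in Z_n^{p-1} is identified with (m,0) in Z_n^p).\<close>
definition omega :: "nat \<Rightarrow> nat \<Rightarrow> (nat \<Rightarrow> real) \<Rightarrow> (nat \<Rightarrow> nat) \<Rightarrow> (nat \<Rightarrow> real) \<Rightarrow> complex" where
  "omega n p z m t =
     (\<Sum>\<sigma> | \<sigma> permutes {1..n}.
        \<Prod>s=1..p. (1 / of_nat (fact (m s))) *
          (\<Prod>j\<in>Gam m s. 1 / complex_of_real (t (\<sigma> j) - z s)))"

definition Uset :: "nat \<Rightarrow> nat \<Rightarrow> (nat \<Rightarrow> real) \<Rightarrow> (nat \<Rightarrow> nat) \<Rightarrow> (nat \<Rightarrow> real) set" where
  "Uset n p z l = {t. \<forall>s\<in>{1..p-1}.
      (\<forall>j\<in>Gam l s. z s \<le> t j \<and> t j \<le> z (s + 1)) \<and>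
      (\<forall>j\<in>{psum l (s - 1) + 1 ..< psum l s}. t j \<le> t (j + 1))}"

abbreviation Rn :: "nat \<Rightarrow> (nat \<Rightarrow> real) measure" where
  "Rn n \<equiv> PiM {1..n} (\<lambda>_. lborel)"

text \<open>Determinant of a square matrix indexed by a finite set S (Leibniz formula);
  independent of the chosen ordering of S.\<close>
definition det_on :: "'i set \<Rightarrow> ('i \<Rightarrow> 'i \<Rightarrow> 'a::comm_ring_1) \<Rightarrow> 'a" where
  "det_on S M = (\<Sum>\<pi> | \<pi> permutes S. of_int (sign \<pi>) * (\<Prod>i\<in>S. M i (\<pi> i)))"

end

theory Submission
  imports Defs "HOL-Library.Function_Algebras" "HOL-Real_Asymp.Real_Asymp"
begin

text \<open>The determinant is obtained from a recursion in \<open>\<alpha> p\<close> together with the limit \<open>\<alpha> p \<rightarrow> \<infinity>\<close>.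
  Raising \<open>\<alpha> p\<close> by 1 multiplies the integrand by \<open>\<Prod>i. z p - t i\<close> and so replaces the factors \<open>1 / (x - z s)\<close> by
  \<open>h s x = (z p - x) / (x - z s)\<close>, whereas \<open>h s + 1\<close> is a multiple of \<open>1 / (x - z s)\<close>. When every other \<open>h s\<close> is
  replaced by \<open>h s - h 1\<close>, integration by parts turns the factors \<open>h 1\<close> into \<open>h 1 + 1\<close> one at a time, modulo integrals with
  fewer factors of index 1; hence the two matrices differ by a triangular change of columns with an explicit diagonal.
  As \<open>\<alpha> p \<rightarrow> \<infinity>\<close> the variables in \<open>[z s, z (s + 1)]\<close> concentrate at \<open>z s\<close>, and the rescaled matrix tends to a diagonal
  one made of Selberg integrals of Laguerre type. For \<open>p = 2\<close> this expresses Selberg's integral by such a Laguerre integral;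
  the symmetry of Selberg's integral in its two exponents allows \<open>a\<close> to be exchanged for 1, and for \<open>a = 1\<close>
  translating by the least variable removes that variable.\<close>

section \<open>Determinants indexed by a finite set\<close>

lemma det_on_cong:
  assumes "\<And>i j. i \<in> S \<Longrightarrow> j \<in> S \<Longrightarrow> M i j = N i j"
  shows "det_on S M = det_on S N"
  unfolding det_on_def
proof (intro sum.cong refl)
  fix \<pi> assume "\<pi> \<in> {\<pi>. \<pi> permutes S}"
  then have "(\<Prod>i\<in>S. M i (\<pi> i)) = (\<Prod>i\<in>S. N i (\<pi> i))"
    by (intro prod.cong refl assms) (auto simp: permutes_in_image)
  then show "of_int (sign \<pi>) * (\<Prod>i\<in>S. M i (\<pi> i)) = of_int (sign \<pi>) * (\<Prod>i\<in>S. N i (\<pi> i))" by simp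
qed

lemma det_on_scale_rows: "det_on S (\<lambda>i j. r i * M i j) = (\<Prod>i\<in>S. r i) * det_on S M"
  by (simp add: det_on_def prod.distrib sum_distrib_left mult_ac)

lemma det_on_scale_columns: "det_on S (\<lambda>i j. c j * M i j) = (\<Prod>i\<in>S. c i) * det_on S M"
proof -
  have "(\<Prod>i\<in>S. c (\<pi> i)) = (\<Prod>i\<in>S. c i)" if "\<pi> permutes S" for \<pi>
    using prod.permute[OF that, of c] by (simp add: o_def)
  then show ?thesis
    by (simp add: det_on_def prod.distrib sum_distrib_left mult_ac)
qed

lemma det_on_permute_rows:
  assumes "finite S" "\<tau> permutes S"
  shows "det_on S (\<lambda>i j. M (\<tau> i) j) = of_int (sign \<tau>) * det_on S M"
proof -
  have "det_on S (\<lambda>i j. M (\<tau> i) j)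
      = (\<Sum>\<pi> | \<pi> permutes S. of_int (sign (\<pi> \<circ> \<tau>)) * (\<Prod>i\<in>S. M (\<tau> i) ((\<pi> \<circ> \<tau>) i)))"
    unfolding det_on_def by (rule sum_permutations_compose_right[OF assms(2)])
  also have "\<dots> = (\<Sum>\<pi> | \<pi> permutes S. of_int (sign \<tau>) * (of_int (sign \<pi>) * (\<Prod>i\<in>S. M i (\<pi> i))))"
  proof (intro sum.cong refl)
    fix \<pi> assume "\<pi> \<in> {\<pi>. \<pi> permutes S}"
    then have \<pi>: "\<pi> permutes S" by simp
    have "(\<Prod>i\<in>S. M (\<tau> i) ((\<pi> \<circ> \<tau>) i)) = (\<Prod>i\<in>S. M i (\<pi> i))"
      using prod.permute[OF assms(2), of "\<lambda>i. M i (\<pi> i)"] by (simp add: o_def)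
    moreover have "sign (\<pi> \<circ> \<tau>) = sign \<pi> * sign \<tau>"
      using assms \<pi> by (intro sign_compose permutes_imp_permutation) auto
    ultimately show "of_int (sign (\<pi> \<circ> \<tau>)) * (\<Prod>i\<in>S. M (\<tau> i) ((\<pi> \<circ> \<tau>) i))
        = of_int (sign \<tau>) * (of_int (sign \<pi>) * (\<Prod>i\<in>S. M i (\<pi> i)))" by simp
  qed
  finally show ?thesis by (simp add: det_on_def sum_distrib_left)
qed

lemma det_on_identical_rows:
  assumes S: "finite S" "a \<in> S" "b \<in> S" "a \<noteq> b" and rows: "\<And>j. j \<in> S \<Longrightarrow> M a j = M b j"
  shows "det_on S M = 0"
proof -
  define \<tau> where "\<tau> = Transposition.transpose a b"
  define weight where "weight \<pi> = (\<Prod>i\<in>S. M i (\<pi> i))" for \<pi>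
  have \<tau>: "\<tau> permutes S" "sign \<tau> = -1"
    using S by (simp_all add: \<tau>_def permutes_swap_id sign_swap_id)
  have weight_\<tau>: "weight (\<pi> \<circ> \<tau>) = weight \<pi>" if "\<pi> permutes S" for \<pi>
  proof -
    have "weight \<pi> = (\<Prod>i\<in>S. M (\<tau> i) (\<pi> (\<tau> i)))"
      using prod.permute[OF \<tau>(1), of "\<lambda>i. M i (\<pi> i)"] by (simp add: weight_def o_def)
    also have "\<dots> = (\<Prod>i\<in>S. M i (\<pi> (\<tau> i)))"
      using S rows permutes_in_image[OF that]
      by (intro prod.cong refl) (auto simp: \<tau>_def Transposition.transpose_def)
    finally show ?thesis by (simp add: weight_def)
  qed
  have sign_\<tau>: "sign (\<pi> \<circ> \<tau>) = - sign \<pi>" if "\<pi> permutes S" for \<pi>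
    using sign_compose[of \<pi> \<tau>] that \<tau> permutes_imp_permutation[OF S(1)] by simp
  have involution: "\<pi> \<circ> \<tau> \<circ> \<tau> = \<pi>" for \<pi>
    by (simp add: \<tau>_def fun_eq_iff)
  let ?even = "{\<pi>. \<pi> permutes S \<and> sign \<pi> = 1}" and ?odd = "{\<pi>. \<pi> permutes S \<and> sign \<pi> = -1}"
  have split: "{\<pi>. \<pi> permutes S} = ?even \<union> ?odd" by (auto simp: sign_def)
  have "det_on S M = (\<Sum>\<pi>\<in>?even. of_int (sign \<pi>) * weight \<pi>) + (\<Sum>\<pi>\<in>?odd. of_int (sign \<pi>) * weight \<pi>)"
    unfolding det_on_def weight_def split
    by (rule sum.union_disjoint) (use S(1) in \<open>auto simp: finite_permutations\<close>)
  also have "\<dots> = (\<Sum>\<pi>\<in>?even. weight \<pi>) - (\<Sum>\<pi>\<in>?odd. weight \<pi>)"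
    by (simp add: sum_negf)
  also have "(\<Sum>\<pi>\<in>?even. weight \<pi>) = (\<Sum>\<pi>\<in>?odd. weight \<pi>)"
    by (rule sum.reindex_bij_witness[where i="\<lambda>\<pi>. \<pi> \<circ> \<tau>" and j="\<lambda>\<pi>. \<pi> \<circ> \<tau>"])
       (auto simp: involution weight_\<tau> sign_\<tau> intro: permutes_compose[OF \<tau>(1)])
  finally show ?thesis by simp
qed

lemma bij_betw_restrict_permutations:
  assumes "finite S"
  shows "bij_betw (\<lambda>\<pi>. restrict \<pi> S) {\<pi>. \<pi> permutes S} {f \<in> S \<rightarrow>\<^sub>E S. inj_on f S}"
proof (rule bij_betw_byWitness[where f'="\<lambda>f x. if x \<in> S then f x else x"])
  show "(\<lambda>f x. if x \<in> S then f x else x) ` {f \<in> S \<rightarrow>\<^sub>E S. inj_on f S} \<subseteq> {\<pi>. \<pi> permutes S}"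
  proof clarify
    fix f assume f: "f \<in> S \<rightarrow>\<^sub>E S" "inj_on f S"
    then have "bij_betw f S S" using endo_inj_surj[OF assms, of f] by (auto simp: bij_betw_def)
    then have "bij_betw (\<lambda>x. if x \<in> S then f x else x) S S" by (subst bij_betw_cong[where g=f]) auto
    then show "(\<lambda>x. if x \<in> S then f x else x) permutes S" by (auto intro!: bij_imp_permutes)
  qed
qed (auto simp: fun_eq_iff permutes_not_in permutes_in_image permutes_inj_on inj_on_restrict_eq PiE_def
  extensional_def)

lemma det_on_mult:
  fixes A B :: "'i \<Rightarrow> 'i \<Rightarrow> 'a :: comm_ring_1"
  assumes S: "finite S"
  shows "det_on S (\<lambda>i j. \<Sum>k\<in>S. A i k * B k j) = det_on S A * det_on S B"
proof -
  let ?F = "S \<rightarrow>\<^sub>E S"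
  define summand where "summand f = (\<Prod>i\<in>S. A i (f i)) * det_on S (\<lambda>i j. B (f i) j)" for f
  have "det_on S (\<lambda>i j. \<Sum>k\<in>S. A i k * B k j)
     = (\<Sum>\<pi> | \<pi> permutes S. of_int (sign \<pi>) * (\<Sum>f\<in>?F. \<Prod>i\<in>S. A i (f i) * B (f i) (\<pi> i)))"
    unfolding det_on_def by (simp add: prod_sum_PiE[OF S] S)
  also have "\<dots> = (\<Sum>f\<in>?F. summand f)"
    unfolding summand_def det_on_def sum_distrib_left
    by (subst sum.swap) (simp add: prod.distrib mult_ac)
  also have "\<dots> = (\<Sum>f\<in>{f\<in>?F. inj_on f S}. summand f)"
  proof (intro sum.mono_neutral_right ballI)
    show "finite ?F" using S by (simp add: finite_PiE)
    fix f assume "f \<in> ?F - {f\<in>?F. inj_on f S}"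
    then obtain a b where "a \<in> S" "b \<in> S" "a \<noteq> b" "f a = f b" by (auto simp: inj_on_def)
    then have "det_on S (\<lambda>i j. B (f i) j) = 0"
      by (intro det_on_identical_rows[OF S, of a b]) auto
    then show "summand f = 0" by (simp add: summand_def)
  qed auto
  also have "\<dots> = (\<Sum>\<pi> | \<pi> permutes S. summand (restrict \<pi> S))"
    by (rule sum.reindex_bij_betw[OF bij_betw_restrict_permutations[OF S], symmetric])
  also have "\<dots> = (\<Sum>\<pi> | \<pi> permutes S. (\<Prod>i\<in>S. A i (\<pi> i)) * (of_int (sign \<pi>) * det_on S B))"
  proof (intro sum.cong refl)
    fix \<pi> assume "\<pi> \<in> {\<pi>. \<pi> permutes S}"
    then have "det_on S (\<lambda>i j. B (restrict \<pi> S i) j) = of_int (sign \<pi>) * det_on S B"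
      using det_on_permute_rows[OF S, of \<pi> B]
        det_on_cong[of S "\<lambda>i j. B (restrict \<pi> S i) j" "\<lambda>i j. B (\<pi> i) j"] by simp
    then show "summand (restrict \<pi> S) = (\<Prod>i\<in>S. A i (\<pi> i)) * (of_int (sign \<pi>) * det_on S B)"
      by (simp add: summand_def)
  qed
  also have "\<dots> = det_on S A * det_on S B"
    by (simp add: det_on_def[of S A] sum_distrib_left mult_ac)
  finally show ?thesis .
qed

lemma det_on_triangular:
  fixes rank :: "'i \<Rightarrow> nat"
  assumes S: "finite S"
    and triangular: "\<And>i j. i \<in> S \<Longrightarrow> j \<in> S \<Longrightarrow> i \<noteq> j \<Longrightarrow> rank j \<le> rank i \<Longrightarrow> M i j = 0"
  shows "det_on S M = (\<Prod>i\<in>S. M i i)"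
proof -
  have "(\<Prod>i\<in>S. M i (\<pi> i)) = 0" if \<pi>: "\<pi> permutes S" and "\<pi> \<noteq> id" for \<pi>
  proof (rule ccontr)
    assume "(\<Prod>i\<in>S. M i (\<pi> i)) \<noteq> 0"
    then have nonzero: "M i (\<pi> i) \<noteq> 0" if "i \<in> S" for i
      using prod_zero[OF S, of "\<lambda>i. M i (\<pi> i)"] that by metis
    have increases: "rank i < rank (\<pi> i)" if "i \<in> S" "\<pi> i \<noteq> i" for i
      using triangular[of i "\<pi> i"] nonzero that \<pi> by (force simp: permutes_in_image)
    obtain a where a: "\<pi> a \<noteq> a" using \<open>\<pi> \<noteq> id\<close> by (auto simp: fun_eq_iff)
    then have "a \<in> S" using \<pi> by (meson permutes_not_in)
    then have "(\<Sum>i\<in>S. rank i) < (\<Sum>i\<in>S. rank (\<pi> i))"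
      using S increases[OF _ a] increases by (intro sum_strict_mono_ex1) (auto, metis le_less)
    moreover have "(\<Sum>i\<in>S. rank (\<pi> i)) = (\<Sum>i\<in>S. rank i)"
      using sum.permute[OF \<pi>, of rank] by (simp add: o_def)
    ultimately show False by simp
  qed
  then have "det_on S M = (\<Sum>\<pi>\<in>{id}. of_int (sign \<pi>) * (\<Prod>i\<in>S. M i (\<pi> i)))"
    unfolding det_on_def by (intro sum.mono_neutral_right) (auto simp: S permutes_id finite_permutations)
  then show ?thesis by (simp add: sign_id)
qed

lemma det_on_diagonal: "finite S \<Longrightarrow> det_on S (\<lambda>i j. if j = i then d i else 0) = (\<Prod>i\<in>S. d i)"
  by (subst det_on_triangular[where rank="\<lambda>_. 0"]) auto

interpretation fun_space: vector_space "\<lambda>(c :: 'a :: field) (f :: 'r \<Rightarrow> 'a) x. c * f x"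
  by standard (auto simp: fun_eq_iff algebra_simps)

lemma span_image_imp_sum:
  fixes v :: "'i \<Rightarrow> 'r \<Rightarrow> 'a :: field"
  assumes T: "finite T" and f: "f \<in> fun_space.span (v ` T)"
  obtains c where "\<And>x. f x = (\<Sum>i\<in>T. c i * v i x)"
proof -
  have "\<exists>c. \<forall>x. f x = (\<Sum>i\<in>T. c i * v i x)"
    using f
  proof (induction rule: fun_space.span_induct_alt)
    case base
    show ?case by (intro exI[of _ "\<lambda>_. 0"]) simp
  next
    case (step a g f)
    then obtain k c where k: "k \<in> T" "g = v k" and c: "\<And>x. f x = (\<Sum>i\<in>T. c i * v i x)" by blast
    have "a * g x + f x = (\<Sum>i\<in>T. (c i + (if i = k then a else 0)) * v i x)" for x
      using T k by (simp add: c distrib_right sum.distrib if_distrib[of "\<lambda>y. y * _"] cong: if_cong)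
    then show ?case by (intro exI[of _ "\<lambda>i. c i + (if i = k then a else 0)"]) simp
  qed
  then show ?thesis using that by blast
qed

lemma det_on_triangular_change:
  fixes rank :: "'i \<Rightarrow> nat" and v w :: "'i \<Rightarrow> 'i \<Rightarrow> 'a :: field"
  assumes S: "finite S"
    and lower: "\<And>m. m \<in> S \<Longrightarrow> w m - (\<lambda>l. d m * v m l) \<in> fun_space.span (v ` {k \<in> S. rank k < rank m})"
  shows "det_on S (\<lambda>l m. w m l) = (\<Prod>m\<in>S. d m) * det_on S (\<lambda>l m. v m l)"
proof -
  have "\<exists>c. \<forall>l. w m l - d m * v m l = (\<Sum>k\<in>{k \<in> S. rank k < rank m}. c k * v k l)" if "m \<in> S" for m
    using span_image_imp_sum[OF _ lower[OF that]] S by force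
  then obtain c where c: "\<And>m l. m \<in> S \<Longrightarrow> w m l - d m * v m l = (\<Sum>k\<in>{k \<in> S. rank k < rank m}. c m k * v k l)"
    by metis
  define T where "T k m = (if k = m then d m else if rank k < rank m then c m k else 0)" for k m
  have "w m l = (\<Sum>k\<in>S. v k l * T k m)" if "m \<in> S" for m l
  proof -
    have "(\<Sum>k\<in>S. v k l * T k m) = v m l * d m + (\<Sum>k\<in>S - {m}. v k l * T k m)"
      using S that by (simp add: sum.remove T_def)
    also have "(\<Sum>k\<in>S - {m}. v k l * T k m) = (\<Sum>k\<in>{k \<in> S. rank k < rank m}. c m k * v k l)"
      using S by (intro sum.mono_neutral_cong_right) (auto simp: T_def)
    finally show ?thesis using c[OF that, of l] by (simp add: algebra_simps)
  qed
  then have "det_on S (\<lambda>l m. w m l) = det_on S (\<lambda>l m. \<Sum>k\<in>S. v k l * T k m)"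
    by (intro det_on_cong) auto
  also have "\<dots> = det_on S (\<lambda>l m. v m l) * det_on S T"
    by (rule det_on_mult[OF S])
  also have "det_on S T = (\<Prod>m\<in>S. d m)"
    using S by (subst det_on_triangular[where rank=rank]) (auto simp: T_def)
  finally show ?thesis by simp
qed

lemma tendsto_det_on:
  fixes M :: "'k \<Rightarrow> 'i \<Rightarrow> 'i \<Rightarrow> 'a :: {real_normed_algebra_1, comm_ring_1}"
  assumes "\<And>i j. i \<in> S \<Longrightarrow> j \<in> S \<Longrightarrow> ((\<lambda>K. M K i j) \<longlongrightarrow> N i j) F"
  shows "((\<lambda>K. det_on S (M K)) \<longlongrightarrow> det_on S N) F"
  unfolding det_on_def
  by (intro tendsto_sum tendsto_mult tendsto_const tendsto_prod assms) (auto simp: permutes_in_image)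

section \<open>Ordered pairs\<close>

definition ordered_pairs :: "'i :: linorder set \<Rightarrow> ('i \<times> 'i) set" where
  "ordered_pairs I = {(i, j). i \<in> I \<and> j \<in> I \<and> i < j}"

lemma finite_ordered_pairs [simp]: "finite I \<Longrightarrow> finite (ordered_pairs I)"
  by (rule finite_subset[of _ "I \<times> I"]) (auto simp: ordered_pairs_def)

lemma ordered_pairs_insert:
  assumes "a \<notin> I"
  shows "ordered_pairs (insert a I) = ordered_pairs I \<union> (\<lambda>j. (min a j, max a j)) ` I"
proof (intro equalityI subsetI)
  fix x assume "x \<in> ordered_pairs (insert a I)"
  then consider "x \<in> ordered_pairs I" | j where "j \<in> I" "x = (a, j)" "a < j" | i where "i \<in> I" "x = (i, a)" "i < a"
    by (auto simp: ordered_pairs_def)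
  then show "x \<in> ordered_pairs I \<union> (\<lambda>j. (min a j, max a j)) ` I"
    by cases (auto intro!: image_eqI)
next
  have "j \<noteq> a" if "j \<in> I" for j using assms that by blast
  then show "x \<in> ordered_pairs (insert a I)" if "x \<in> ordered_pairs I \<union> (\<lambda>j. (min a j, max a j)) ` I" for x
    using that by (force simp: ordered_pairs_def min_def max_def)
qed

lemma inj_on_min_max: "inj_on (\<lambda>j. (min a j, max a j)) (I :: 'i :: linorder set)"
  by (auto simp: inj_on_def min_def max_def split: if_splits)

lemma ordered_pairs_disjoint_insert:
  "a \<notin> I \<Longrightarrow> ordered_pairs I \<inter> (\<lambda>j. (min a j, max a j)) ` I = {}"
  by (auto simp: ordered_pairs_def min_def max_def split: if_splits)

lemma prod_ordered_pairs_insert: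
  assumes "finite I" "a \<notin> I" and sym: "\<And>i j. f i j = f j i"
  shows "(\<Prod>(i, j)\<in>ordered_pairs (insert a I). f i j) = (\<Prod>j\<in>I. f a j) * (\<Prod>(i, j)\<in>ordered_pairs I. f i j)"
proof -
  have "f (min a j) (max a j) = f a j" for j
    using sym by (auto simp: min_def max_def)
  then have "(\<Prod>(i, j)\<in>(\<lambda>j. (min a j, max a j)) ` I. f i j) = (\<Prod>j\<in>I. f a j)"
    by (simp add: prod.reindex[OF inj_on_min_max])
  then show ?thesis
    using assms(1) ordered_pairs_disjoint_insert[OF assms(2)]
    by (simp add: ordered_pairs_insert[OF assms(2)] prod.union_disjoint mult.commute)
qed

lemma card_ordered_pairs: "finite I \<Longrightarrow> card (ordered_pairs I) = card I choose 2"
proof (induction I rule: finite_induct)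
  case (insert a I)
  then show ?case
    using ordered_pairs_disjoint_insert[OF insert.hyps(2)]
    by (simp add: ordered_pairs_insert[OF insert.hyps(2)] card_Un_disjoint card_image[OF inj_on_min_max]
      numeral_2_eq_2)
qed (simp add: ordered_pairs_def)

lemma prod_ordered_pairs_upper:
  fixes n :: nat
  shows "(\<Prod>i=1..n. \<Prod>j\<in>{i<..n}. f i j) = (\<Prod>(i, j)\<in>ordered_pairs {1..n}. f i j)"
proof -
  have "ordered_pairs {1..n} = (SIGMA i:{1..n}. {i<..n})" by (auto simp: ordered_pairs_def)
  then show ?thesis by (simp add: prod.Sigma)
qed

lemma prod_ordered_pairs_lower:
  fixes n :: nat
  shows "(\<Prod>j=1..n. \<Prod>i=1..<j. f i j) = (\<Prod>(i, j)\<in>ordered_pairs {1..n}. f i j)"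
proof -
  have "(\<Prod>j=1..n. \<Prod>i=1..<j. f i j) = (\<Prod>(j, i)\<in>(SIGMA j:{1..n}. {1..<j}). f i j)"
    by (rule prod.Sigma) auto
  also have "\<dots> = (\<Prod>(i, j)\<in>ordered_pairs {1..n}. f i j)"
    by (rule prod.reindex_bij_witness[where i=prod.swap and j=prod.swap]) (auto simp: ordered_pairs_def)
  finally show ?thesis .
qed

lemma prod_off_diagonal:
  fixes I :: "'i :: linorder set"
  assumes I: "finite I"
  shows "(\<Prod>s\<in>I. \<Prod>r\<in>I - {s}. f s r) = (\<Prod>(r, s)\<in>ordered_pairs I. f r s * f s r)"
proof -
  let ?swapped = "prod.swap ` ordered_pairs I"
  have "(\<Prod>s\<in>I. \<Prod>r\<in>I - {s}. f s r) = (\<Prod>(s, r)\<in>(SIGMA s:I. I - {s}). f s r)"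
    using I by (intro prod.Sigma) auto
  also have "(SIGMA s:I. I - {s}) = ordered_pairs I \<union> ?swapped"
    by (auto simp: ordered_pairs_def image_iff)
  also have "(\<Prod>(s, r)\<in>ordered_pairs I \<union> ?swapped. f s r)
      = (\<Prod>(r, s)\<in>ordered_pairs I. f r s) * (\<Prod>(s, r)\<in>?swapped. f s r)"
    by (rule prod.union_disjoint) (use I in \<open>simp_all, auto simp: ordered_pairs_def\<close>)
  also have "(\<Prod>(s, r)\<in>?swapped. f s r) = (\<Prod>(r, s)\<in>ordered_pairs I. f s r)"
    by (subst prod.reindex) (auto simp: case_prod_beta)
  finally show ?thesis by (simp add: prod.distrib case_prod_beta)
qed

lemma prod_ordered_pairs_blocks:
  fixes b :: "'i :: linorder \<Rightarrow> 's :: linorder"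
  assumes fin: "finite I" "finite S" and b: "b ` I \<subseteq> S" "mono_on I b"
  defines "block \<equiv> \<lambda>s. {i \<in> I. b i = s}"
  shows "(\<Prod>(i, j)\<in>ordered_pairs I. f i j)
    = (\<Prod>s\<in>S. \<Prod>(i, j)\<in>ordered_pairs (block s). f i j)
      * (\<Prod>(r, s)\<in>ordered_pairs S. \<Prod>i\<in>block r. \<Prod>j\<in>block s. f i j)"
proof -
  let ?same = "{x \<in> ordered_pairs I. b (fst x) = b (snd x)}"
  let ?cross = "{x \<in> ordered_pairs I. b (fst x) \<noteq> b (snd x)}"
  have "(\<Prod>(i, j)\<in>?same. f i j) = (\<Prod>s\<in>S. \<Prod>(i, j)\<in>{x \<in> ?same. b (fst x) = s}. f i j)"
    by (intro prod.group[symmetric]) (use fin b(1) in \<open>simp_all, auto simp: ordered_pairs_def\<close>)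
  also have "\<dots> = (\<Prod>s\<in>S. \<Prod>(i, j)\<in>ordered_pairs (block s). f i j)"
    by (intro prod.cong refl) (auto simp: block_def ordered_pairs_def)
  finally have same: "(\<Prod>(i, j)\<in>?same. f i j) = (\<Prod>s\<in>S. \<Prod>(i, j)\<in>ordered_pairs (block s). f i j)" .
  have increasing: "i < j \<longleftrightarrow> b i < b j" if "i \<in> I" "j \<in> I" "b i \<noteq> b j" for i j
    using that mono_onD[OF b(2), of i j] mono_onD[OF b(2), of j i] by force
  have fibre: "{x \<in> ?cross. (b (fst x), b (snd x)) = (r, s)} = block r \<times> block s" if "r < s" for r s
    using that by (auto simp: block_def ordered_pairs_def increasing)
  have "(\<Prod>(i, j)\<in>?cross. f i j)
      = (\<Prod>y\<in>ordered_pairs S. \<Prod>(i, j)\<in>{x \<in> ?cross. (b (fst x), b (snd x)) = y}. f i j)"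
    by (intro prod.group[symmetric]) (use fin b(1) increasing in \<open>simp_all, auto simp: ordered_pairs_def\<close>)
  also have "\<dots> = (\<Prod>(r, s)\<in>ordered_pairs S. \<Prod>(i, j)\<in>block r \<times> block s. f i j)"
    by (intro prod.cong refl) (use fibre in \<open>auto simp: ordered_pairs_def\<close>)
  also have "\<dots> = (\<Prod>(r, s)\<in>ordered_pairs S. \<Prod>i\<in>block r. \<Prod>j\<in>block s. f i j)"
    by (simp only: prod.cartesian_product)
  finally have cross: "(\<Prod>(i, j)\<in>?cross. f i j)
      = (\<Prod>(r, s)\<in>ordered_pairs S. \<Prod>i\<in>block r. \<Prod>j\<in>block s. f i j)" .
  have "ordered_pairs I = ?same \<union> ?cross" by blast
  then have "(\<Prod>(i, j)\<in>ordered_pairs I. f i j) = (\<Prod>(i, j)\<in>?same. f i j) * (\<Prod>(i, j)\<in>?cross. f i j)"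
    using fin(1) by (subst prod.union_disjoint[symmetric]) auto
  then show ?thesis by (simp only: same cross)
qed

section \<open>Compositions\<close>

lemma Zset_le: "m \<in> Zset n q \<Longrightarrow> s \<in> {1..q} \<Longrightarrow> m s \<le> n"
  unfolding Zset_def using member_le_sum[of s "{1..q}" m] by auto

lemma Zset_outside: "m \<in> Zset n q \<Longrightarrow> s \<notin> {1..q} \<Longrightarrow> m s = 0"
  by (simp add: Zset_def)

lemma Zset_subset:
  assumes "q \<le> r"
  shows "Zset n q \<subseteq> Zset n r"
proof
  fix m assume m: "m \<in> Zset n q"
  have "(\<Sum>i=1..r. m i) = (\<Sum>i=1..q. m i)"
    using assms Zset_outside[OF m] by (intro sum.mono_neutral_right) auto
  then show "m \<in> Zset n r" using m assms by (auto simp: Zset_def)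
qed

lemma finite_Zset [simp]: "finite (Zset n q)"
proof -
  have "Zset n q \<subseteq> {f. \<forall>x. (x \<in> {1..q} \<longrightarrow> f x \<in> {..n}) \<and> (x \<notin> {1..q} \<longrightarrow> f x = 0)}"
    using Zset_le by (auto simp: Zset_def)
  then show ?thesis
    using finite_set_of_finite_funs[of "{1..q}" "{..n}" "0::nat"]
    by (meson finite_subset finite_atLeastAtMost finite_atMost)
qed

lemma bij_betw_Zset_exceeding:
  assumes s: "s \<in> {1..q}" and i: "i < n"
  shows "bij_betw (\<lambda>m. m(s := m s + Suc i)) (Zset (n - 1 - i) q) {m \<in> Zset n q. i < m s}"
proof (rule bij_betw_byWitness[where f'="\<lambda>m. m(s := m s - Suc i)"])
  have sum_upd: "(\<Sum>j=1..q. (m(s := x)) j) + m s = (\<Sum>j=1..q. m j) + x" for m :: "nat \<Rightarrow> nat" and x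
    using s by (simp add: sum.remove[of _ s])
  show "(\<lambda>m. m(s := m s + Suc i)) ` Zset (n - 1 - i) q \<subseteq> {m \<in> Zset n q. i < m s}"
  proof safe
    fix m assume m: "m \<in> Zset (n - 1 - i) q"
    then have "(\<Sum>j=1..q. (m(s := m s + Suc i)) j) = n" using sum_upd[of m "m s + Suc i"] i by (simp add: Zset_def)
    then show "m(s := m s + Suc i) \<in> Zset n q" using m s by (auto simp: Zset_def)
  qed simp
  show "(\<lambda>m. m(s := m s - Suc i)) ` {m \<in> Zset n q. i < m s} \<subseteq> Zset (n - 1 - i) q"
  proof safe
    fix m assume m: "m \<in> Zset n q" "i < m s"
    then have "(\<Sum>j=1..q. (m(s := m s - Suc i)) j) = n - 1 - i"
      using sum_upd[of m "m s - Suc i"] i by (simp add: Zset_def)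
    then show "m(s := m s - Suc i) \<in> Zset (n - 1 - i) q" using m s by (auto simp: Zset_def)
  qed
qed (auto simp: fun_eq_iff)

lemma sum_Zset_lessThan:
  assumes s: "s \<in> {1..q}"
  shows "(\<Sum>m\<in>Zset n q. \<Sum>i<m s. F i m) = (\<Sum>i<n. \<Sum>m\<in>Zset (n - 1 - i) q. F i (m(s := m s + Suc i)))"
proof -
  have "(\<Sum>m\<in>Zset n q. \<Sum>i<m s. F i m) = (\<Sum>m\<in>Zset n q. \<Sum>i | i \<in> {..<n} \<and> i < m s. F i m)"
    using Zset_le[OF _ s, where n=n] by (intro sum.cong refl) (auto simp: order.strict_trans2)
  also have "\<dots> = (\<Sum>i<n. \<Sum>m | m \<in> Zset n q \<and> i < m s. F i m)" by (rule sum.swap_restrict) auto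
  also have "\<dots> = (\<Sum>i<n. \<Sum>m\<in>Zset (n - 1 - i) q. F i (m(s := m s + Suc i)))"
    by (intro sum.cong refl sum.reindex_bij_betw[OF bij_betw_Zset_exceeding[OF s], symmetric]) simp
  finally show ?thesis .
qed

lemma prod_Zset_lessThan:
  fixes r :: "nat \<Rightarrow> 'a :: comm_monoid_mult"
  assumes s: "s \<in> {1..q}"
  shows "(\<Prod>m\<in>Zset n q. \<Prod>i<m s. r i) = (\<Prod>i<n. r i ^ card (Zset (n - 1 - i) q))"
proof -
  have "(\<Prod>m\<in>Zset n q. \<Prod>i<m s. r i) = (\<Prod>m\<in>Zset n q. \<Prod>i | i \<in> {..<n} \<and> i < m s. r i)"
    using Zset_le[OF _ s, where n=n] by (intro prod.cong refl) (auto simp: order.strict_trans2)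
  also have "\<dots> = (\<Prod>i<n. \<Prod>m | m \<in> Zset n q \<and> i < m s. r i)" by (rule prod.swap_restrict) auto
  also have "\<dots> = (\<Prod>i<n. r i ^ card (Zset (n - 1 - i) q))"
    using bij_betw_same_card[OF bij_betw_Zset_exceeding[OF s]] by (intro prod.cong refl) simp
  finally show ?thesis .
qed

lemma Zset_0: "Zset 0 q = {\<lambda>_. 0}"
proof -
  have "m = (\<lambda>_. 0)" if "m \<in> Zset 0 q" for m
    using Zset_le[OF that] Zset_outside[OF that] by fastforce
  then show ?thesis by (auto simp: Zset_def)
qed

lemma Zset_Suc_0: "Zset (Suc n) 0 = {}"
  by (auto simp: Zset_def)

lemma card_Zset_Suc_Suc: "card (Zset (Suc n) (Suc q)) = card (Zset (Suc n) q) + card (Zset n (Suc q))"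
proof -
  let ?positive = "{m \<in> Zset (Suc n) (Suc q). 0 < m (Suc q)}"
  have "Zset (Suc n) (Suc q) = Zset (Suc n) q \<union> ?positive"
    by (auto simp: Zset_def not_less_eq_eq le_Suc_eq)
  moreover have "Zset (Suc n) q \<inter> ?positive = {}"
    by (auto simp: Zset_def)
  ultimately have "card (Zset (Suc n) (Suc q)) = card (Zset (Suc n) q) + card ?positive"
    by (metis (no_types, lifting) card_Un_disjoint finite_Un finite_Zset)
  also have "card ?positive = card (Zset n (Suc q))"
    using bij_betw_same_card[OF bij_betw_Zset_exceeding[of "Suc q" "Suc q" 0 "Suc n"]] by simp
  finally show ?thesis .
qed

lemma card_Zset: "card (Zset n (Suc q)) = (n + q) choose q"
proof (induction q arbitrary: n)
  case 0
  show ?case by (induction n) (auto simp: card_Zset_Suc_Suc Zset_0 Zset_Suc_0)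
next
  case (Suc q)
  show ?case by (induction n) (auto simp: card_Zset_Suc_Suc[of _ "Suc q"] Zset_0 Suc)
qed

lemma sum_choose_lessThan: "a \<le> b \<Longrightarrow> (\<Sum>j<n. (j + a) choose b) = (n + a) choose Suc b"
  by (induction n) auto

lemma sum_choose_lessThan_rev: "a \<le> b \<Longrightarrow> (\<Sum>i<n. (n - 1 - i + a) choose b) = (n + a) choose Suc b"
  using sum.nat_diff_reindex[of "\<lambda>j. (j + a) choose b" n] by (simp add: sum_choose_lessThan)

lemma sum_Zset_coord:
  assumes s: "s \<in> {1..Suc q}"
  shows "(\<Sum>m\<in>Zset n (Suc q). m s) = (n + q) choose Suc q"
proof -
  have "(\<Sum>m\<in>Zset n (Suc q). m s) = (\<Sum>m\<in>Zset n (Suc q). \<Sum>i<m s. 1)" by simp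
  also have "\<dots> = (\<Sum>i<n. (n - 1 - i + q) choose q)"
    unfolding sum_Zset_lessThan[OF s] by (simp add: card_Zset)
  finally show ?thesis by (simp only: sum_choose_lessThan_rev order_refl)
qed

lemma sum_Zset_coord_mult:
  assumes s: "s \<in> {1..Suc q}" "r \<in> {1..Suc q}" "r \<noteq> s"
  shows "(\<Sum>m\<in>Zset n (Suc q). m r * m s) = (n + q) choose Suc (Suc q)"
proof -
  have "(\<Sum>m\<in>Zset n (Suc q). m r * m s) = (\<Sum>m\<in>Zset n (Suc q). \<Sum>i<m r. m s)" by simp
  also have "\<dots> = (\<Sum>i<n. (n - 1 - i + q) choose Suc q)"
    unfolding sum_Zset_lessThan[OF s(2)] using s(3) by (simp add: sum_Zset_coord[OF s(1)])
  finally show ?thesis by (simp only: sum_choose_lessThan_rev le_SucI order_refl)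
qed

lemma sum_Zset_coord_choose_2:
  assumes s: "s \<in> {1..Suc q}"
  shows "(\<Sum>m\<in>Zset n (Suc q). m s choose 2) = (n + q) choose Suc (Suc q)"
proof -
  have "(k choose 2) = (\<Sum>i<k. k - Suc i)" for k
    using sum_choose_lessThan_rev[of 0 1 k] by (simp add: numeral_2_eq_2)
  then have "(\<Sum>m\<in>Zset n (Suc q). m s choose 2) = (\<Sum>m\<in>Zset n (Suc q). \<Sum>i<m s. m s - Suc i)" by simp
  also have "\<dots> = (\<Sum>i<n. (n - 1 - i + q) choose Suc q)"
    unfolding sum_Zset_lessThan[OF s] by (simp add: sum_Zset_coord[OF s])
  finally show ?thesis by (simp only: sum_choose_lessThan_rev le_SucI order_refl)
qed

lemma prod_Zset_coord_power:
  fixes f :: "nat \<Rightarrow> 'a :: comm_semiring_1"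
  shows "(\<Prod>m\<in>Zset n q. \<Prod>s=1..q. f s ^ m s) = (\<Prod>s=1..q. f s) ^ ((n + q - 1) choose q)"
proof (cases q)
  case (Suc q')
  have "(\<Prod>m\<in>Zset n q. \<Prod>s=1..q. f s ^ m s) = (\<Prod>s=1..q. f s ^ (\<Sum>m\<in>Zset n q. m s))"
    by (subst prod.swap) (simp only: power_sum)
  also have "\<dots> = (\<Prod>s=1..q. f s ^ ((n + q - 1) choose q))"
    using sum_Zset_coord[of _ q' n] by (intro prod.cong refl) (simp add: Suc)
  finally show ?thesis by (simp add: prod_power_distrib)
qed (simp add: Zset_def)

lemma prod_Zset_coord_choose_2_power:
  fixes f :: "nat \<Rightarrow> 'a :: comm_semiring_1"
  shows "(\<Prod>m\<in>Zset n q. \<Prod>s=1..q. f s ^ (m s choose 2)) = (\<Prod>s=1..q. f s) ^ ((n + q - 1) choose Suc q)"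
proof (cases q)
  case (Suc q')
  have "(\<Prod>m\<in>Zset n q. \<Prod>s=1..q. f s ^ (m s choose 2)) = (\<Prod>s=1..q. f s ^ (\<Sum>m\<in>Zset n q. m s choose 2))"
    by (subst prod.swap) (simp only: power_sum)
  also have "\<dots> = (\<Prod>s=1..q. f s ^ ((n + q - 1) choose Suc q))"
    using sum_Zset_coord_choose_2[of _ q' n] by (intro prod.cong refl) (simp add: Suc)
  finally show ?thesis by (simp add: prod_power_distrib)
qed (simp add: Zset_def)

lemma prod_Zset_coord_mult_power:
  fixes F :: "nat \<Rightarrow> nat \<Rightarrow> 'a :: comm_semiring_1"
  shows "(\<Prod>m\<in>Zset n q. \<Prod>(r, s)\<in>ordered_pairs {1..q}. F r s ^ (m r * m s))
    = (\<Prod>(r, s)\<in>ordered_pairs {1..q}. F r s) ^ ((n + q - 1) choose Suc q)"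
proof (cases q)
  case (Suc q')
  have "(\<Prod>m\<in>Zset n q. \<Prod>(r, s)\<in>ordered_pairs {1..q}. F r s ^ (m r * m s))
      = (\<Prod>(r, s)\<in>ordered_pairs {1..q}. F r s ^ (\<Sum>m\<in>Zset n q. m r * m s))"
    unfolding case_prod_beta by (subst prod.swap) (simp only: power_sum)
  also have "\<dots> = (\<Prod>(r, s)\<in>ordered_pairs {1..q}. F r s ^ ((n + q - 1) choose Suc q))"
    using sum_Zset_coord_mult[of _ q' _ n] by (intro prod.cong refl) (auto simp: Suc ordered_pairs_def)
  finally show ?thesis by (simp add: prod_power_distrib case_prod_beta)
qed (simp add: ordered_pairs_def)

lemma sum_card_Zset: "(\<Sum>i<n. card (Zset (n - 1 - i) (Suc q))) = (n + q) choose Suc q"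
  unfolding card_Zset by (rule sum_choose_lessThan_rev) simp

lemma sum_card_Zset_weighted:
  "(\<Sum>i<n. card (Zset (n - 1 - i) (Suc q)) * (n - 1 - i)) = Suc q * ((n + q) choose Suc (Suc q))"
proof -
  have absorb: "((j + q) choose q) * j = Suc q * ((j + q) choose Suc q)" for j
    using binomial_absorb_comp[of "j + q" q] binomial_absorption[of q "j + q"]
    by (metis add_diff_cancel_right' mult.commute)
  have "(\<Sum>i<n. card (Zset (n - 1 - i) (Suc q)) * (n - 1 - i)) = Suc q * (\<Sum>i<n. (n - 1 - i + q) choose Suc q)"
    by (simp only: card_Zset absorb sum_distrib_left)
  then show ?thesis by (simp only: sum_choose_lessThan_rev le_SucI order_refl)
qed

lemma Zset_1: "Zset n 1 = {\<lambda>s. if s = 1 then n else 0}"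
proof -
  have "m = (\<lambda>s. if s = 1 then n else 0)" if "m \<in> Zset n 1" for m
    using that Zset_outside[OF that] by (auto simp: Zset_def fun_eq_iff)
  then show ?thesis by (auto simp: Zset_def)
qed

lemma count_Abs_multiset_Zset:
  assumes "m \<in> Zset n q" shows "count (Abs_multiset m) = m"
proof -
  have "{x. 0 < m x} \<subseteq> {1..q}" using Zset_outside[OF assms] by (force simp del: atLeastAtMost_iff)
  then show ?thesis by (intro count_Abs_multiset) (auto intro: finite_subset)
qed

lemma Zset_eq_image_count: "Zset n q = count ` {M. size M = n \<and> set_mset M \<subseteq> {1..q}}"
proof (intro equalityI subsetI)
  have size_eq: "size M = (\<Sum>i=1..q. count M i)" if "set_mset M \<subseteq> {1..q}" for M
    unfolding size_multiset_overloaded_eq using that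
    by (intro sum.mono_neutral_left) (auto simp: count_eq_zero_iff)
  fix m assume m: "m \<in> Zset n q"
  then have count: "count (Abs_multiset m) = m" by (rule count_Abs_multiset_Zset)
  have "s \<in> {1..q}" if "m s > 0" for s
    using Zset_outside[OF m, of s] that by (metis less_irrefl)
  then have set: "set_mset (Abs_multiset m) \<subseteq> {1..q}" by (simp add: set_mset_def count subset_iff)
  then have "size (Abs_multiset m) = n" using m by (simp add: size_eq count Zset_def)
  with set count show "m \<in> count ` {M. size M = n \<and> set_mset M \<subseteq> {1..q}}"
    by (intro image_eqI[of _ _ "Abs_multiset m"]) auto
next
  fix m assume "m \<in> count ` {M. size M = n \<and> set_mset M \<subseteq> {1..q}}"
  then obtain M where M: "m = count M" "size M = n" "set_mset M \<subseteq> {1..q}" by auto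
  have "(\<Sum>i=1..q. count M i) = size M"
    unfolding size_multiset_overloaded_eq using M(3)
    by (intro sum.mono_neutral_right) (auto simp: count_eq_zero_iff)
  then show "m \<in> Zset n q" using M by (auto simp: Zset_def count_eq_zero_iff)
qed

section \<open>The blocks of a composition\<close>

definition site :: "(nat \<Rightarrow> nat) \<Rightarrow> nat \<Rightarrow> nat" where
  "site l i = (LEAST s. i \<le> psum l s)"

lemma psum_Suc: "psum l (Suc s) = psum l s + l (Suc s)"
  by (simp add: psum_def)

lemma psum_0 [simp]: "psum l 0 = 0"
  by (simp add: psum_def)

lemma psum_mono: "a \<le> b \<Longrightarrow> psum l a \<le> psum l b"
  by (rule lift_Suc_mono_le[of "psum l"]) (simp add: psum_Suc)

lemma psum_Zset: "l \<in> Zset n q \<Longrightarrow> psum l q = n"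
  by (simp add: Zset_def psum_def)

lemma Gam_eq: "s \<ge> 1 \<Longrightarrow> Gam l s = {psum l (s - 1) + 1..psum l (s - 1) + l s}"
  using psum_Suc[of l "s - 1"] by (simp add: Gam_def)

lemma site_eq_iff:
  assumes "i \<ge> 1" "i \<le> psum l q"
  shows "site l i = s \<longleftrightarrow> s \<ge> 1 \<and> i \<in> Gam l s"
proof -
  have upper: "i \<le> psum l (site l i)" unfolding site_def using assms(2) by (rule LeastI)
  have lower: "psum l s < i" if "s < site l i" for s
    using that not_less_Least[of s "\<lambda>s. i \<le> psum l s"] unfolding site_def by simp
  have positive: "site l i \<ge> 1" using upper assms(1) by (cases "site l i") auto
  have "i \<in> Gam l (site l i)"
    using upper lower[of "site l i - 1"] positive by (auto simp: Gam_def)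
  moreover have "site l i = s" if "s \<ge> 1" "i \<in> Gam l s"
    using that psum_mono[of "site l i" "s - 1" l] upper lower[of s] by (force simp: Gam_def)
  ultimately show ?thesis using positive by auto
qed

context
  fixes l n q assumes l: "l \<in> Zset n q"
begin

lemma site_in_range:
  assumes i: "i \<in> {1..n}"
  shows "site l i \<in> {1..q}"
proof -
  have "site l i \<ge> 1" using site_eq_iff[of i l q "site l i"] i psum_Zset[OF l] by auto
  moreover have "site l i \<le> q" unfolding site_def using i psum_Zset[OF l] by (intro Least_le) auto
  ultimately show ?thesis by auto
qed

lemma Gam_eq_site:
  assumes s: "s \<in> {1..q}"
  shows "Gam l s = {i \<in> {1..n}. site l i = s}"
proof -
  have "Gam l s \<subseteq> {1..n}" using psum_mono[of s q l] s psum_Zset[OF l] by (auto simp: Gam_def)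
  then show ?thesis using site_eq_iff[of _ l q s] s psum_Zset[OF l] by auto
qed

lemma card_site_eq: "s \<in> {1..q} \<Longrightarrow> card {i \<in> {1..n}. site l i = s} = l s"
  unfolding Gam_eq_site[symmetric] by (simp add: Gam_eq)

lemma site_mono_on: "mono_on {1..n} (site l)"
proof (rule mono_onI)
  fix i j assume "j \<in> {1..n}" "i \<le> j"
  then show "site l i \<le> site l j"
    unfolding site_def using psum_Zset[OF l]
    by (intro Least_le) (auto intro: order_trans LeastI[of "\<lambda>s. j \<le> psum l s" q])
qed

lemma image_mset_site: "image_mset (site l) (mset_set {1..n}) = Abs_multiset l"
proof (rule multiset_eqI)
  fix s
  have "count (image_mset (site l) (mset_set {1..n})) s = card {i \<in> {1..n}. site l i = s}"
    by (simp add: count_image_mset vimage_def Int_def conj_commute)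
  also have "\<dots> = l s"
  proof (cases "s \<in> {1..q}")
    case True
    then show ?thesis by (rule card_site_eq)
  next
    case False
    then show ?thesis using site_in_range Zset_outside[OF l False] by auto
  qed
  finally show "count (image_mset (site l) (mset_set {1..n})) s = count (Abs_multiset l) s"
    unfolding count_Abs_multiset_Zset[OF l] .
qed

lemma prod_Gam_site:
  "(\<Prod>s=1..q. \<Prod>j\<in>Gam l s. F s j) = (\<Prod>j=1..n. F (site l j) j)"
proof -
  have "(\<Prod>j=1..n. F (site l j) j) = (\<Prod>s=1..q. \<Prod>j\<in>{j \<in> {1..n}. site l j = s}. F (site l j) j)"
    using site_in_range by (intro prod.group[symmetric]) auto
  also have "\<dots> = (\<Prod>s=1..q. \<Prod>j\<in>Gam l s. F s j)"
    by (intro prod.cong refl) (auto simp: Gam_eq_site)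
  finally show ?thesis by simp
qed

lemma prod_site:
  fixes g :: "nat \<Rightarrow> 'a :: comm_monoid_mult"
  shows "(\<Prod>i=1..n. g (site l i)) = (\<Prod>s=1..q. g s ^ l s)"
  unfolding prod_Gam_site[of "\<lambda>s _. g s", symmetric] by (intro prod.cong refl) (simp add: Gam_eq)

lemma prod_site_blocks:
  "(\<Prod>(i, j)\<in>ordered_pairs {1..n}. f i j)
    = (\<Prod>s=1..q. \<Prod>(i, j)\<in>ordered_pairs (Gam l s). f i j)
      * (\<Prod>(r, s)\<in>ordered_pairs {1..q}. \<Prod>i\<in>Gam l r. \<Prod>j\<in>Gam l s. f i j)"
proof -
  have "(\<Prod>(i, j)\<in>ordered_pairs {1..n}. f i j)
      = (\<Prod>s=1..q. \<Prod>(i, j)\<in>ordered_pairs {i \<in> {1..n}. site l i = s}. f i j)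
        * (\<Prod>(r, s)\<in>ordered_pairs {1..q}. \<Prod>i\<in>{i \<in> {1..n}. site l i = r}. \<Prod>j\<in>{i \<in> {1..n}. site l i = s}. f i j)"
    using site_in_range site_mono_on by (intro prod_ordered_pairs_blocks) auto
  also have "\<dots> = (\<Prod>s=1..q. \<Prod>(i, j)\<in>ordered_pairs (Gam l s). f i j)
      * (\<Prod>(r, s)\<in>ordered_pairs {1..q}. \<Prod>i\<in>Gam l r. \<Prod>j\<in>Gam l s. f i j)"
    by (intro arg_cong2[of _ _ _ _ "(*)"] prod.cong refl) (auto simp: Gam_eq_site ordered_pairs_def)
  finally show ?thesis .
qed

end

lemma prod_mset_Zset:
  fixes c :: "nat \<Rightarrow> 'a :: comm_monoid_mult"
  assumes m: "m \<in> Zset n q"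
  shows "(\<Prod>s\<in>#Abs_multiset m. c s) = (\<Prod>s=1..q. c s ^ m s)"
  unfolding prod_site[OF m, symmetric] image_mset_site[OF m, symmetric]
  by (simp add: prod_unfold_prod_mset image_mset.compositionality o_def)

lemma size_Abs_multiset_Zset: "m \<in> Zset n q \<Longrightarrow> size (Abs_multiset m) = n"
  using image_mset_site[of m n q] by (metis card_atLeastAtMost diff_Suc_1 size_image_mset size_mset_set)

lemma set_Abs_multiset_Zset: "m \<in> Zset n q \<Longrightarrow> set_mset (Abs_multiset m) \<subseteq> {1..q}"
  using site_in_range[of m n q] by (auto simp flip: image_mset_site)

section \<open>Symmetrised products\<close>

lemma sum_off_diagonal_swap:
  assumes "finite I"
  shows "(\<Sum>i\<in>I. \<Sum>k\<in>I - {i}. f i k) = (\<Sum>i\<in>I. \<Sum>k\<in>I - {i}. f k i)"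
  using sum.swap_restrict[OF assms assms, of f "(\<noteq>)"]
  by (simp add: set_diff_eq eq_commute conj_commute)

text \<open>\<open>sym_prod M t I\<close> is the permanent of the matrix whose entries are the values of the functions in \<open>M\<close> at the points
  \<open>t i\<close>, so it is expanded along the row of any \<open>f \<in># M\<close> and along the column of any \<open>k \<in> I\<close>.\<close>

definition sym_prod :: "('x \<Rightarrow> 'a :: comm_semiring_1) multiset \<Rightarrow> ('i \<Rightarrow> 'x) \<Rightarrow> 'i set \<Rightarrow> 'a" where
  "sym_prod M t = fold_mset (\<lambda>f G I. \<Sum>i\<in>I. f (t i) * G (I - {i})) (\<lambda>I. 1) M"

lemma sym_prod_empty [simp]: "sym_prod {#} t I = 1"
  by (simp add: sym_prod_def)

lemma sym_prod_add_mset: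
  fixes M :: "('x \<Rightarrow> 'a :: comm_semiring_1) multiset" and t :: "'i \<Rightarrow> 'x"
  shows "sym_prod (add_mset f M) t I = (\<Sum>i\<in>I. f (t i) * sym_prod M t (I - {i}))"
proof -
  define expand_row where "expand_row f G I = (\<Sum>i\<in>I. f (t i) * G (I - {i}))"
    for f :: "'x \<Rightarrow> 'a" and G and I :: "'i set"
  have "expand_row f (expand_row g G) I = expand_row g (expand_row f G) I" for f g G I
  proof (cases "finite I")
    case True
    have "I - {i} - {k} = I - {k} - {i}" for i k by auto
    then show ?thesis
      using sum_off_diagonal_swap[OF True, of "\<lambda>i k. f (t i) * (g (t k) * G (I - {i} - {k}))"]
      by (simp add: expand_row_def sum_distrib_left mult.left_commute)
  qed (simp add: expand_row_def)
  then interpret comp_fun_commute expand_row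
    by unfold_locales (simp add: fun_eq_iff)
  have "sym_prod M t = fold_mset expand_row (\<lambda>I. 1) M" for M
    by (simp add: sym_prod_def expand_row_def[abs_def])
  then show ?thesis by (simp add: expand_row_def)
qed

lemma sym_prod_add_mset_2:
  "sym_prod (add_mset f (add_mset g M)) t I = (\<Sum>i\<in>I. \<Sum>k\<in>I - {i}. f (t i) * g (t k) * sym_prod M t (I - {i} - {k}))"
  by (simp add: sym_prod_add_mset sum_distrib_left mult.assoc)

lemma sum_sum_mset_swap: "(\<Sum>i\<in>A. \<Sum>x\<in>#M. F i x) = (\<Sum>x\<in>#M. \<Sum>i\<in>A. F i x)"
  by (induction M) (auto simp: sum.distrib)

lemma sym_prod_expand_column:
  assumes "finite I" "card I = size M" "k \<in> I"
  shows "sym_prod M t I = (\<Sum>f\<in>#M. f (t k) * sym_prod (M - {#f#}) t (I - {k}))"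
  using assms
proof (induction M arbitrary: I)
  case (add f M)
  have "sym_prod (add_mset f M) t I
      = f (t k) * sym_prod M t (I - {k}) + (\<Sum>i\<in>I - {k}. f (t i) * sym_prod M t (I - {i}))"
    using add.prems by (simp add: sym_prod_add_mset sum.remove)
  also have "(\<Sum>i\<in>I - {k}. f (t i) * sym_prod M t (I - {i}))
      = (\<Sum>i\<in>I - {k}. \<Sum>g\<in>#M. g (t k) * (f (t i) * sym_prod (M - {#g#}) t (I - {k} - {i})))"
  proof (rule sum.cong[OF refl])
    fix i assume "i \<in> I - {k}"
    then have "sym_prod M t (I - {i}) = (\<Sum>g\<in>#M. g (t k) * sym_prod (M - {#g#}) t (I - {i} - {k}))"
      using add.prems by (intro add.IH) auto
    moreover have "I - {i} - {k} = I - {k} - {i}" by auto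
    ultimately show "f (t i) * sym_prod M t (I - {i})
        = (\<Sum>g\<in>#M. g (t k) * (f (t i) * sym_prod (M - {#g#}) t (I - {k} - {i})))"
      by (simp add: sum_mset_distrib_left mult.left_commute)
  qed
  also have "\<dots> = (\<Sum>g\<in>#M. g (t k) * sym_prod (add_mset f (M - {#g#})) t (I - {k}))"
    by (simp add: sum_sum_mset_swap sym_prod_add_mset sum_distrib_left)
  also have "\<dots> = (\<Sum>g\<in>#M. g (t k) * sym_prod (add_mset f M - {#g#}) t (I - {k}))"
    by (intro arg_cong[of _ _ sum_mset] image_mset_cong) (simp add: add_mset_diff_bothsides)
  finally show ?case by simp
qed auto

lemma sym_prod_mult:
  assumes "finite I" "card I = size M"
  shows "sym_prod (image_mset (\<lambda>f x. c x * f x) M) t I = (\<Prod>i\<in>I. c (t i)) * sym_prod M t I"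
  using assms
proof (induction M arbitrary: I)
  case (add f M)
  have "c (t i) * f (t i) * sym_prod (image_mset (\<lambda>f x. c x * f x) M) t (I - {i})
      = (\<Prod>i\<in>I. c (t i)) * (f (t i) * sym_prod M t (I - {i}))" if "i \<in> I" for i
    using add that by (simp add: prod.remove[of I i] mult_ac)
  then show ?case by (simp add: sym_prod_add_mset sum_distrib_left)
qed simp

lemma sym_prod_scale:
  "sym_prod (image_mset (\<lambda>s x. c s * f s x) M) t I = (\<Prod>s\<in>#M. c s) * sym_prod (image_mset f M) t I"
  by (induction M arbitrary: I) (simp_all add: sym_prod_add_mset sum_distrib_left mult_ac)

lemma sum_inj_eq_sym_prod:
  assumes "finite J" "finite I"
  shows "(\<Sum>\<sigma>\<in>{\<sigma> \<in> J \<rightarrow>\<^sub>E I. inj_on \<sigma> J}. \<Prod>j\<in>J. h j (t (\<sigma> j))) = sym_prod (image_mset h (mset_set J)) t I"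
  using assms
proof (induction J arbitrary: I rule: finite_induct)
  case empty
  have "{\<sigma> \<in> {} \<rightarrow>\<^sub>E I. inj_on \<sigma> {}} = {\<lambda>_. undefined}" by auto
  then show ?case by simp
next
  case (insert j J)
  let ?inj = "\<lambda>J I. {\<sigma> \<in> J \<rightarrow>\<^sub>E I. inj_on \<sigma> J}"
  have "{(i, \<sigma>). i \<in> I \<and> \<sigma> \<in> J \<rightarrow>\<^sub>E (I - {i}) \<and> inj_on \<sigma> J} = (SIGMA i:I. ?inj J (I - {i}))" by auto
  then have inj: "inj_on (\<lambda>(i, \<sigma>). \<sigma>(j := i)) (SIGMA i:I. ?inj J (I - {i}))"
    and image: "?inj (insert j J) I = (\<lambda>(i, \<sigma>). \<sigma>(j := i)) ` (SIGMA i:I. ?inj J (I - {i}))"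
    using extensional_funcset_extend_domain_inj_onI[OF insert.hyps(2), of I]
      extensional_funcset_extend_domain_inj_on_eq[OF insert.hyps(2), of I] by simp_all
  have prod_upd: "(\<Prod>k\<in>insert j J. h k (t ((\<sigma>(j := i)) k))) = h j (t i) * (\<Prod>k\<in>J. h k (t (\<sigma> k)))" for \<sigma> i
    using insert.hyps by (auto intro!: arg_cong2[of _ _ _ _ "(*)"] prod.cong)
  have "(\<Sum>\<sigma>\<in>?inj (insert j J) I. \<Prod>k\<in>insert j J. h k (t (\<sigma> k)))
      = (\<Sum>(i, \<sigma>)\<in>(SIGMA i:I. ?inj J (I - {i})). h j (t i) * (\<Prod>k\<in>J. h k (t (\<sigma> k))))"
    unfolding image by (subst sum.reindex[OF inj]) (simp only: o_def prod_upd case_prod_unfold)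
  also have "\<dots> = (\<Sum>i\<in>I. h j (t i) * (\<Sum>\<sigma>\<in>?inj J (I - {i}). \<Prod>k\<in>J. h k (t (\<sigma> k))))"
    unfolding sum_distrib_left using insert.prems
    by (intro sum.Sigma[symmetric] ballI finite_Collect_conjI disjI1) (simp_all add: finite_PiE insert.hyps(1))
  also have "\<dots> = sym_prod (image_mset h (mset_set (insert j J))) t I"
    using insert.hyps insert.prems by (simp add: insert.IH sym_prod_add_mset)
  finally show ?case .
qed

lemma sum_permutations_eq_sym_prod:
  assumes "finite I"
  shows "(\<Sum>\<sigma> | \<sigma> permutes I. \<Prod>j\<in>I. h j (t (\<sigma> j))) = sym_prod (image_mset h (mset_set I)) t I"
proof -
  have "(\<Sum>\<sigma> | \<sigma> permutes I. \<Prod>j\<in>I. h j (t (\<sigma> j))) = (\<Sum>\<sigma> | \<sigma> permutes I. \<Prod>j\<in>I. h j (t (restrict \<sigma> I j)))"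
    by simp
  also have "\<dots> = (\<Sum>\<sigma>\<in>{\<sigma> \<in> I \<rightarrow>\<^sub>E I. inj_on \<sigma> I}. \<Prod>j\<in>I. h j (t (\<sigma> j)))"
    by (rule sum.reindex_bij_betw[OF bij_betw_restrict_permutations[OF assms]])
  finally show ?thesis by (simp only: sum_inj_eq_sym_prod[OF assms assms])
qed

lemma sum_mset_eq_sum_count:
  fixes F :: "'b \<Rightarrow> 'a :: semiring_1"
  assumes "finite V"
  shows "set_mset M \<subseteq> V \<Longrightarrow> (\<Sum>x\<in>#M. F x) = (\<Sum>x\<in>V. of_nat (count M x) * F x)"
proof (induction M)
  case (add x M)
  have "of_nat (count (add_mset x M) y) * F y = (if x = y then F y else 0) + of_nat (count M y) * F y" for y
    by (simp add: algebra_simps)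
  then show ?case using add assms by (simp add: sum.distrib del: count_add_mset)
qed simp

definition rearrangements :: "'b multiset \<Rightarrow> 'i set \<Rightarrow> ('i \<Rightarrow> 'b) set" where
  "rearrangements M I = {\<tau> \<in> extensional I. image_mset \<tau> (mset_set I) = M}"

lemma rearrangements_mem: "finite I \<Longrightarrow> \<tau> \<in> rearrangements M I \<Longrightarrow> i \<in> I \<Longrightarrow> \<tau> i \<in># M"
  by (auto simp: rearrangements_def)

lemma finite_rearrangements: "finite I \<Longrightarrow> finite (rearrangements M I)"
  by (rule finite_subset[OF _ finite_PiE[of I "\<lambda>_. set_mset M"]]) (auto simp: rearrangements_def PiE_def)

lemma sum_rearrangements_insert:
  fixes w :: "'b \<Rightarrow> 'i \<Rightarrow> 'a :: comm_semiring_1"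
  assumes I: "finite I" "k \<notin> I"
  shows "(\<Sum>\<tau>\<in>rearrangements M (insert k I). \<Prod>i\<in>insert k I. w (\<tau> i) i)
    = (\<Sum>s\<in>set_mset M. w s k * (\<Sum>\<tau>\<in>rearrangements (M - {#s#}) I. \<Prod>i\<in>I. w (\<tau> i) i))"
proof -
  have image_upd: "image_mset (\<tau>(k := s)) (mset_set I) = image_mset \<tau> (mset_set I)" for \<tau> s
    using I by (intro image_mset_cong) auto
  have "(\<Sum>s\<in>set_mset M. w s k * (\<Sum>\<tau>\<in>rearrangements (M - {#s#}) I. \<Prod>i\<in>I. w (\<tau> i) i))
      = (\<Sum>(s, \<tau>)\<in>(SIGMA s:set_mset M. rearrangements (M - {#s#}) I). w s k * (\<Prod>i\<in>I. w (\<tau> i) i))"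
    unfolding sum_distrib_left by (rule sum.Sigma) (use I in \<open>simp_all add: finite_rearrangements\<close>)
  also have "\<dots> = (\<Sum>\<tau>\<in>rearrangements M (insert k I). \<Prod>i\<in>insert k I. w (\<tau> i) i)"
  proof (rule sum.reindex_bij_witness[where i="\<lambda>\<tau>. (\<tau> k, restrict \<tau> I)" and j="\<lambda>(s, \<tau>). \<tau>(k := s)"])
    fix x assume "x \<in> (SIGMA s:set_mset M. rearrangements (M - {#s#}) I)"
    then obtain s \<tau> where x: "x = (s, \<tau>)" "s \<in># M" "\<tau> \<in> rearrangements (M - {#s#}) I" by auto
    show "(case x of (s, \<tau>) \<Rightarrow> \<tau>(k := s)) \<in> rearrangements M (insert k I)"
      using x I by (auto simp: rearrangements_def image_upd extensional_def)
    show "((case x of (s, \<tau>) \<Rightarrow> \<tau>(k := s)) k, restrict (case x of (s, \<tau>) \<Rightarrow> \<tau>(k := s)) I) = x"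
      using x I by (auto simp: rearrangements_def extensional_def fun_eq_iff)
    show "(\<Prod>i\<in>insert k I. w ((case x of (s, \<tau>) \<Rightarrow> \<tau>(k := s)) i) i) = (case x of (s, \<tau>) \<Rightarrow> w s k * (\<Prod>i\<in>I. w (\<tau> i) i))"
      using x I by (auto intro!: arg_cong2[of _ _ _ _ "(*)"] prod.cong)
  next
    fix \<tau> assume \<tau>: "\<tau> \<in> rearrangements M (insert k I)"
    have "image_mset (restrict \<tau> I) (mset_set I) = image_mset \<tau> (mset_set I)"
      using I by (intro image_mset_cong) auto
    then show "(\<tau> k, restrict \<tau> I) \<in> (SIGMA s:set_mset M. rearrangements (M - {#s#}) I)"
      using \<tau> I by (auto simp: rearrangements_def)
    show "(case (\<tau> k, restrict \<tau> I) of (s, \<tau>) \<Rightarrow> \<tau>(k := s)) = \<tau>"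
      using \<tau> by (auto simp: rearrangements_def extensional_def fun_eq_iff)
  qed
  finally show ?thesis ..
qed

lemma prod_fact_count_remove:
  assumes "finite V" "set_mset M \<subseteq> V" "s \<in># M"
  shows "of_nat (count M s) * (\<Prod>v\<in>V. fact (count (M - {#s#}) v))
      = (\<Prod>v\<in>V. fact (count M v) :: 'a :: {comm_semiring_1, semiring_char_0})"
proof -
  have s: "s \<in> V" using assms by auto
  have "count (M - {#s#}) v = (if v = s then count M s - 1 else count M v)" for v by auto
  then have "(\<Prod>v\<in>V. fact (count (M - {#s#}) v)) = (fact (count M s - 1) * (\<Prod>v\<in>V - {s}. fact (count M v)) :: 'a)"
    using assms(1) s by (subst prod.remove[of _ s]) (auto simp del: count_diff)
  moreover have "(\<Prod>v\<in>V. fact (count M v)) = (fact (count M s) * (\<Prod>v\<in>V - {s}. fact (count M v)) :: 'a)"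
    using assms(1) s by (intro prod.remove)
  ultimately show ?thesis using assms(3) by (simp add: fact_reduce[of "count M s"] mult.assoc)
qed

lemma sym_prod_eq_sum_rearrangements:
  fixes f :: "'b \<Rightarrow> 'x \<Rightarrow> 'a :: {comm_semiring_1, semiring_char_0}"
  assumes "finite V" "finite I"
  shows "set_mset M \<subseteq> V \<Longrightarrow> size M = card I \<Longrightarrow> sym_prod (image_mset f M) t I
    = (\<Prod>v\<in>V. fact (count M v)) * (\<Sum>\<tau>\<in>rearrangements M I. \<Prod>i\<in>I. f (\<tau> i) (t i))"
  using assms(2)
proof (induction I arbitrary: M rule: finite_induct)
  case empty
  then show ?case by (simp add: rearrangements_def)
next
  case (insert k I)
  define factorials :: "_ \<Rightarrow> 'a" where "factorials M = (\<Prod>v\<in>V. fact (count M v))" for M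
  define total where "total M J = (\<Sum>\<tau>\<in>rearrangements M J. \<Prod>i\<in>J. f (\<tau> i) (t i))" for M J
  have factorials_remove: "of_nat (count M s) * factorials (M - {#s#}) = factorials M" if "s \<in># M" for s
    unfolding factorials_def using prod_fact_count_remove[OF assms(1) insert.prems(1) that] .
  have "sym_prod (image_mset f M) t (insert k I) = (\<Sum>s\<in>#M. f s (t k) * sym_prod (image_mset f (M - {#s#})) t I)"
  proof -
    have "sym_prod (image_mset f M) t (insert k I)
        = (\<Sum>s\<in>#M. f s (t k) * sym_prod (image_mset f M - {#f s#}) t I)"
      using insert.hyps insert.prems
      by (subst sym_prod_expand_column[of _ _ k]) (auto simp: o_def image_mset.compositionality)
    then show ?thesis by (simp add: image_mset_Diff cong: image_mset_cong)
  qed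
  also have "\<dots> = (\<Sum>s\<in>#M. f s (t k) * (factorials (M - {#s#}) * total (M - {#s#}) I))"
  proof (intro arg_cong[of _ _ sum_mset] image_mset_cong arg_cong2[of _ _ _ _ "(*)"] refl)
    fix s assume "s \<in># M"
    then show "sym_prod (image_mset f (M - {#s#})) t I = factorials (M - {#s#}) * total (M - {#s#}) I"
      unfolding factorials_def total_def using insert.prems insert.hyps
      by (intro insert.IH) (auto simp: size_Diff_singleton dest: in_diffD)
  qed
  also have "\<dots> = (\<Sum>s\<in>set_mset M. of_nat (count M s)
      * (f s (t k) * (factorials (M - {#s#}) * total (M - {#s#}) I)))"
    by (rule sum_mset_eq_sum_count) auto
  also have "\<dots> = (\<Sum>s\<in>set_mset M. factorials M * (f s (t k) * total (M - {#s#}) I))"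
    by (intro sum.cong refl) (simp flip: factorials_remove add: mult_ac)
  also have "\<dots> = factorials M * total M (insert k I)"
    unfolding total_def using sum_rearrangements_insert[OF insert.hyps(1,2), of "\<lambda>s i. f s (t i)" M]
    by (simp add: sum_distrib_left)
  finally show ?case by (simp only: factorials_def total_def)
qed

section \<open>The contiguity relation for a symmetric multilinear functional\<close>

lemma sum_fun_apply: "(\<Sum>i\<in>I. f i) x = (\<Sum>i\<in>I. f i x)"
  by (induction I rule: infinite_finite_induct) auto

text \<open>In the application \<open>V M\<close> is the integral of a symmetrised product against the weight, \<open>ibp\<close> is integration by parts,
  and \<open>pair b N\<close> is what the interaction between a variable in \<open>b\<close> and the differentiated variable contributes to it.\<close>

locale symmetric_functional =
  fixes V :: "'b :: ab_group_add multiset \<Rightarrow> (nat \<Rightarrow> nat) \<Rightarrow> 'a :: field"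
    and pair :: "'b \<Rightarrow> 'b multiset \<Rightarrow> (nat \<Rightarrow> nat) \<Rightarrow> 'a"
    and L :: "'b set" and one :: 'b and h :: "nat \<Rightarrow> 'b"
    and n q :: nat and \<alpha> :: "nat \<Rightarrow> 'a" and \<gamma> a :: 'a
  assumes q_pos: "q \<ge> 1"
    and one_mem: "one \<in> L" and h_mem: "\<And>s. s \<in> {1..q} \<Longrightarrow> h s \<in> L" and diff_mem: "\<And>x y. x \<in> L \<Longrightarrow> y \<in> L \<Longrightarrow> x - y \<in> L"
    and V_diff: "\<And>x y N. x \<in> L \<Longrightarrow> y \<in> L \<Longrightarrow> set_mset N \<subseteq> L \<Longrightarrow> size N + 1 = n \<Longrightarrow>
        V (add_mset (x - y) N) = V (add_mset x N) - V (add_mset y N)"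
    and pair_diff: "\<And>x y N. x \<in> L \<Longrightarrow> y \<in> L \<Longrightarrow> set_mset N \<subseteq> L \<Longrightarrow> size N + 2 = n \<Longrightarrow>
        pair (x - y) N = pair x N - pair y N"
    and pair_one: "\<And>N. set_mset N \<subseteq> L \<Longrightarrow> size N + 2 = n \<Longrightarrow> pair one N = V (add_mset one (add_mset one N))"
    and pair_h: "\<And>s N. s \<in> {1..q} \<Longrightarrow> set_mset N \<subseteq> L \<Longrightarrow> size N + 2 = n \<Longrightarrow>
        pair (h s) N = - V (add_mset (h s) (add_mset (h s) N))"
    and ibp: "\<And>N l. set_mset N \<subseteq> L \<Longrightarrow> size N + 1 = n \<Longrightarrow>
        a * V (add_mset one N) l - (\<Sum>s=1..q. \<alpha> s * V (add_mset (h s) N) l) + \<gamma> * (\<Sum>b\<in>#N. pair b (N - {#b#}) l) = 0"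
    and nonresonant: "\<And>j :: nat. a + (\<Sum>s=1..q. \<alpha> s) + of_nat j * \<gamma> \<noteq> 0"
begin

definition g :: "nat \<Rightarrow> 'b" where "g s = h s + one"

definition u :: "nat \<Rightarrow> 'b" where "u s = h s - h 1"

lemma add_mem: "x \<in> L \<Longrightarrow> y \<in> L \<Longrightarrow> x + y \<in> L"
  using diff_mem[of y y] diff_mem[of "y - y" y] diff_mem[of x "- y"] by simp

lemma h_1_mem: "h 1 \<in> L"
  using h_mem q_pos by simp

lemma g_mem: "s \<in> {1..q} \<Longrightarrow> g s \<in> L"
  unfolding g_def by (intro add_mem h_mem one_mem)

lemma u_mem: "s \<in> {1..q} \<Longrightarrow> u s \<in> L"
  unfolding u_def by (intro diff_mem h_mem h_1_mem)

lemma V_add: "x \<in> L \<Longrightarrow> y \<in> L \<Longrightarrow> set_mset N \<subseteq> L \<Longrightarrow> size N + 1 = n \<Longrightarrow>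
    V (add_mset (x + y) N) = V (add_mset x N) + V (add_mset y N)"
  using V_diff[of "x + y" y N] add_mem[of x y] by (simp add: algebra_simps)

lemma pair_add: "x \<in> L \<Longrightarrow> y \<in> L \<Longrightarrow> set_mset N \<subseteq> L \<Longrightarrow> size N + 2 = n \<Longrightarrow>
    pair (x + y) N = pair x N + pair y N"
  using pair_diff[of "x + y" y N] add_mem[of x y] by (simp add: algebra_simps)

lemma V_add_second:
  assumes "x \<in> L" "y \<in> L" "z \<in> L" "set_mset N \<subseteq> L" "size N + 2 = n"
  shows "V (add_mset z (add_mset (x + y) N)) = V (add_mset z (add_mset x N)) + V (add_mset z (add_mset y N))"
  using V_add[of x y "add_mset z N"] assms by (simp only: add_mset_commute[of z]) simp

lemma V_square_add:
  assumes "x \<in> L" "y \<in> L" "set_mset N \<subseteq> L" "size N + 2 = n"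
  shows "V (add_mset (x + y) (add_mset (x + y) N))
    = V (add_mset x (add_mset x N)) + 2 * V (add_mset x (add_mset y N)) + V (add_mset y (add_mset y N))"
proof -
  have "V (add_mset (x + y) (add_mset (x + y) N))
      = V (add_mset x (add_mset (x + y) N)) + V (add_mset y (add_mset (x + y) N))"
    using assms add_mem[of x y] by (intro V_add) simp_all
  then show ?thesis
    using assms by (simp only: V_add_second add_mset_commute[of y x] mult_2 add.assoc)
qed

lemma V_u:
  assumes "s \<in> {1..q}" "set_mset N \<subseteq> L" "size N + 1 = n"
  shows "V (add_mset (u s) N) = V (add_mset (h s) N) - V (add_mset (h 1) N)"
    and "V (add_mset (u s) N) = V (add_mset (g s) N) - V (add_mset (g 1) N)"
proof -
  show "V (add_mset (u s) N) = V (add_mset (h s) N) - V (add_mset (h 1) N)"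
    unfolding u_def using assms h_mem h_1_mem by (intro V_diff) auto
  have "u s = g s - g 1" by (simp add: u_def g_def)
  then show "V (add_mset (u s) N) = V (add_mset (g s) N) - V (add_mset (g 1) N)"
    using assms g_mem q_pos by (simp add: V_diff)
qed

lemma V_u_1: "set_mset N \<subseteq> L \<Longrightarrow> size N + 1 = n \<Longrightarrow> V (add_mset (u 1) N) = 0"
  using V_u(1)[of 1 N] q_pos by simp

lemma pair_g_1:
  assumes N: "set_mset N \<subseteq> L" "size N + 2 = n"
  shows "pair (g 1) N = V (add_mset (g 1) (add_mset (g 1) N)) - 2 * V (add_mset (h 1) (add_mset (g 1) N))"
proof -
  note letters = h_1_mem one_mem N
  have "pair (g 1) N = V (add_mset one (add_mset one N)) - V (add_mset (h 1) (add_mset (h 1) N))"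
    unfolding g_def pair_add[OF letters] using q_pos N by (simp add: pair_one pair_h)
  moreover have "V (add_mset (g 1) (add_mset (g 1) N)) = V (add_mset (h 1) (add_mset (h 1) N))
      + 2 * V (add_mset (h 1) (add_mset one N)) + V (add_mset one (add_mset one N))"
    unfolding g_def by (rule V_square_add[OF letters])
  moreover have "V (add_mset (h 1) (add_mset (g 1) N))
      = V (add_mset (h 1) (add_mset (h 1) N)) + V (add_mset (h 1) (add_mset one N))"
    unfolding g_def by (rule V_add_second[OF h_1_mem one_mem h_1_mem N])
  ultimately show ?thesis by (simp only:) (simp add: algebra_simps)
qed

lemma pair_u:
  assumes s: "s \<in> {1..q}" and N: "set_mset N \<subseteq> L" "size N + 2 = n"
  shows "pair (u s) N = - V (add_mset (u s) (add_mset (u s) N)) - 2 * V (add_mset (h 1) (add_mset (u s) N))"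
proof -
  have "V (add_mset (h s) (add_mset (h s) N)) = V (add_mset (u s) (add_mset (u s) N))
      + 2 * V (add_mset (u s) (add_mset (h 1) N)) + V (add_mset (h 1) (add_mset (h 1) N))"
    using V_square_add[of "u s" "h 1" N] u_mem[OF s] h_1_mem N by (simp add: u_def)
  moreover have "pair (u s) N = pair (h s) N - pair (h 1) N"
    unfolding u_def using s N h_mem h_1_mem by (intro pair_diff) auto
  ultimately show ?thesis
    using s N q_pos by (simp add: pair_h add_mset_commute)
qed

abbreviation A :: 'a where "A \<equiv> a + (\<Sum>s=1..q. \<alpha> s)"

definition mixed :: "nat \<Rightarrow> nat \<Rightarrow> nat multiset \<Rightarrow> (nat \<Rightarrow> nat) \<Rightarrow> 'a" where
  "mixed i k B = V (replicate_mset i (h 1) + replicate_mset k (g 1) + image_mset u B)"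

lemma sum_pair_mixed:
  assumes size: "i + k + size B + 1 = n" and B: "set_mset B \<subseteq> {1..q}"
  defines "N \<equiv> replicate_mset i (h 1) + replicate_mset k (g 1) + image_mset u B"
  shows "(\<Sum>b\<in>#N. pair b (N - {#b#}) l)
    = of_nat k * mixed i (Suc k) B l - of_nat (i + 2 * k + 2 * size B) * mixed (Suc i) k B l
      - (\<Sum>s\<in>#B. mixed i k (add_mset s B) l)"
proof -
  have N: "set_mset N \<subseteq> L"
    unfolding N_def using h_1_mem g_mem[of 1] u_mem B q_pos by (auto split: if_splits)
  have rest: "set_mset (N - {#b#}) \<subseteq> L" "size (N - {#b#}) + 2 = n" if b: "b \<in># N" for b
  proof -
    obtain N' where "N = add_mset b N'" using multi_member_split[OF b] by blast
    moreover have "size N + 1 = n" using size by (simp add: N_def)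
    ultimately show "set_mset (N - {#b#}) \<subseteq> L" "size (N - {#b#}) + 2 = n" using N by simp_all
  qed
  have pair_h_term: "pair (h 1) (N - {#h 1#}) l = - mixed (Suc i) k B l" if "i > 0"
    using rest[of "h 1"] that q_pos by (cases i) (simp_all add: pair_h N_def mixed_def)
  have pair_g_term: "pair (g 1) (N - {#g 1#}) l = mixed i (Suc k) B l - 2 * mixed (Suc i) k B l" if "k > 0"
    using rest[of "g 1"] pair_g_1[of "N - {#g 1#}"] that
    by (cases k) (simp_all add: N_def mixed_def add_mset_commute)
  have pair_u_term: "pair (u s) (N - {#u s#}) l = - mixed i k (add_mset s B) l - 2 * mixed (Suc i) k B l"
    if s: "s \<in># B" for s
  proof -
    obtain B' where B': "B = add_mset s B'" using s by (metis multi_member_split)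
    show ?thesis using rest[of "u s"] B by (simp add: pair_u N_def mixed_def B' add_mset_commute)
  qed
  have "(\<Sum>b\<in>#replicate_mset i (h 1). pair b (N - {#b#}) l) = of_nat i * (- mixed (Suc i) k B l)"
    using pair_h_term by (cases "i = 0") auto
  moreover have "(\<Sum>b\<in>#replicate_mset k (g 1). pair b (N - {#b#}) l)
      = of_nat k * (mixed i (Suc k) B l - 2 * mixed (Suc i) k B l)"
    using pair_g_term by (cases "k = 0") auto
  moreover have "(\<Sum>b\<in>#image_mset u B. pair b (N - {#b#}) l)
      = (\<Sum>s\<in>#B. - mixed i k (add_mset s B) l - 2 * mixed (Suc i) k B l)"
    unfolding image_mset.compositionality o_def
    using pair_u_term by (intro arg_cong[of _ _ sum_mset] image_mset_cong)
  moreover have "(\<Sum>s\<in>#B. - f s - c) = - (\<Sum>s\<in>#B. f s) - of_nat (size B) * c" for f and c :: 'a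
    by (induction B) (auto simp: algebra_simps)
  moreover have "(\<Sum>b\<in>#N. pair b (N - {#b#}) l) = (\<Sum>b\<in>#replicate_mset i (h 1). pair b (N - {#b#}) l)
      + (\<Sum>b\<in>#replicate_mset k (g 1). pair b (N - {#b#}) l) + (\<Sum>b\<in>#image_mset u B. pair b (N - {#b#}) l)"
    by (subst N_def) (simp only: image_mset_union sum_mset.union)
  ultimately show ?thesis by (simp only:) (simp add: algebra_simps)
qed

lemma sum_mixed_add_mset:
  assumes size: "i + k + size B + 1 = n" and B: "set_mset B \<subseteq> {2..q}"
  shows "(\<Sum>s=1..q. \<alpha> s * mixed i k (add_mset s B) l) + \<gamma> * (\<Sum>s\<in>#B. mixed i k (add_mset s B) l)
    = (\<Sum>s=2..q. (\<alpha> s + of_nat (count B s) * \<gamma>) * mixed i k (add_mset s B) l)"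
proof -
  let ?N = "replicate_mset i (h 1) + replicate_mset k (g 1) + image_mset u B"
  have "set_mset ?N \<subseteq> L" "size ?N + 1 = n"
    using size B h_1_mem g_mem[of 1] u_mem q_pos by (auto split: if_splits)
  then have "mixed i k (add_mset 1 B) l = 0"
    using V_u_1[of ?N] by (simp add: mixed_def)
  moreover have "{1..q} = insert 1 {2..q}" using q_pos by auto
  ultimately have "(\<Sum>s=1..q. \<alpha> s * mixed i k (add_mset s B) l) = (\<Sum>s=2..q. \<alpha> s * mixed i k (add_mset s B) l)"
    by simp
  then show ?thesis
    by (simp add: sum_mset_eq_sum_count[OF _ B] sum_distrib_left distrib_right sum.distrib mult_ac)
qed

lemma mixed_Suc:
  assumes size: "i + k + size B + 1 = n" and B: "set_mset B \<subseteq> {2..q}"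
  shows "(A + of_nat (2 * n - 2 - i) * \<gamma>) * mixed (Suc i) k B l
     = (a + of_nat k * \<gamma>) * mixed i (Suc k) B l
       - (\<Sum>s=2..q. (\<alpha> s + of_nat (count B s) * \<gamma>) * mixed i k (add_mset s B) l)"
proof -
  define N where "N = replicate_mset i (h 1) + replicate_mset k (g 1) + image_mset u B"
  have N: "set_mset N \<subseteq> L" "size N + 1 = n"
    unfolding N_def using h_1_mem g_mem[of 1] u_mem B q_pos size by (auto split: if_splits)
  have mixed: "V (add_mset (h 1) N) l = mixed (Suc i) k B l" "V (add_mset (g 1) N) l = mixed i (Suc k) B l"
    "V (add_mset (u s) N) l = mixed i k (add_mset s B) l" for s
    by (simp_all add: N_def mixed_def)
  have "V (add_mset (g 1) N) = V (add_mset (h 1) N) + V (add_mset one N)"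
    unfolding g_def using N h_1_mem one_mem by (intro V_add) auto
  then have one: "V (add_mset one N) l = mixed i (Suc k) B l - mixed (Suc i) k B l"
    by (simp add: mixed[symmetric])
  have h: "V (add_mset (h s) N) l = mixed i k (add_mset s B) l + mixed (Suc i) k B l" if "s \<in> {1..q}" for s
    using V_u(1)[OF that N] by (simp add: mixed[symmetric])
  have "(\<Sum>s=1..q. \<alpha> s * V (add_mset (h s) N) l)
      = (\<Sum>s=1..q. \<alpha> s * mixed i k (add_mset s B) l) + (\<Sum>s=1..q. \<alpha> s) * mixed (Suc i) k B l"
    unfolding sum_distrib_right sum.distrib[symmetric] by (intro sum.cong refl) (simp only: h distrib_left)
  moreover have "set_mset B \<subseteq> {1..q}" using B by auto
  note sum_pair_mixed[OF size this, of l, folded N_def]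
  moreover have "2 * n - 2 - i = i + 2 * k + 2 * size B" using size by simp
  ultimately show ?thesis
    using ibp[OF N, of l] unfolding one sum_mixed_add_mset[OF size B, symmetric]
    by (simp only:) (simp add: algebra_simps)
qed

definition word_values :: "(nat \<Rightarrow> 'b) \<Rightarrow> (nat \<Rightarrow> nat) \<Rightarrow> (nat \<Rightarrow> nat) \<Rightarrow> 'a" where
  "word_values P m = V (image_mset P (Abs_multiset m))"

abbreviation low_span :: "nat \<Rightarrow> ((nat \<Rightarrow> nat) \<Rightarrow> 'a) set" where
  "low_span \<kappa> \<equiv> fun_space.span (word_values (u(1 := g 1)) ` {m \<in> Zset n q. m 1 < \<kappa>})"

lemma low_span_mono: "\<kappa> \<le> \<kappa>' \<Longrightarrow> low_span \<kappa> \<subseteq> low_span \<kappa>'"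
  by (intro fun_space.span_mono image_mono) auto

lemma mixed_0_in_low_span:
  assumes "k + size B = n" "set_mset B \<subseteq> {2..q}" "k < \<kappa>"
  shows "mixed 0 k B \<in> low_span \<kappa>"
proof -
  let ?M = "replicate_mset k 1 + B"
  have "count ?M \<in> Zset n q"
    unfolding Zset_eq_image_count using assms q_pos by (intro imageI) (auto split: if_splits)
  moreover have "count ?M 1 = k" using assms(2) by (auto simp: count_eq_zero_iff)
  moreover have "image_mset (u(1 := g 1)) B = image_mset u B" using assms(2) by (intro image_mset_cong) auto
  then have "word_values (u(1 := g 1)) (count ?M) = mixed 0 k B"
    by (simp add: word_values_def mixed_def count_inverse)
  ultimately show ?thesis
    using assms(3) by (intro fun_space.span_base image_eqI[of _ _ "count ?M"]) auto
qed

definition leading_ratio :: "nat \<Rightarrow> nat \<Rightarrow> 'a" where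
  "leading_ratio i k = (\<Prod>r<i. a + of_nat (k + r) * \<gamma>) / (\<Prod>r<i. A + of_nat (2 * n - 2 - r) * \<gamma>)"

lemma leading_ratio_Suc:
  "leading_ratio (Suc i) k = (a + of_nat k * \<gamma>) / (A + of_nat (2 * n - 2 - i) * \<gamma>) * leading_ratio i (Suc k)"
  unfolding leading_ratio_def by (subst prod.lessThan_Suc_shift) simp

lemma mixed_in_low_span:
  assumes leading: "mixed i k B - (\<lambda>l. leading_ratio i k * mixed 0 (i + k) B l) \<in> low_span (i + k)"
    and B: "i + k + size B = n" "set_mset B \<subseteq> {2..q}" and less: "i + k < \<kappa>"
  shows "mixed i k B \<in> low_span \<kappa>"
proof -
  have "mixed i k B - (\<lambda>l. leading_ratio i k * mixed 0 (i + k) B l) \<in> low_span \<kappa>"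
    using leading low_span_mono[of "i + k" \<kappa>] less by auto
  moreover have "(\<lambda>l. leading_ratio i k * mixed 0 (i + k) B l) \<in> low_span \<kappa>"
    using B less by (intro fun_space.span_scale mixed_0_in_low_span) auto
  ultimately have "mixed i k B - (\<lambda>l. leading_ratio i k * mixed 0 (i + k) B l)
      + (\<lambda>l. leading_ratio i k * mixed 0 (i + k) B l) \<in> low_span \<kappa>" by (rule fun_space.span_add)
  then show ?thesis by (simp only: diff_add_cancel)
qed

lemma mixed_minus_leading_in_low_span:
  assumes "i + k + size B = n" "set_mset B \<subseteq> {2..q}"
  shows "mixed i k B - (\<lambda>l. leading_ratio i k * mixed 0 (i + k) B l) \<in> low_span (i + k)"
  using assms
proof (induction i arbitrary: k B)
  case 0
  then show ?case by (simp add: leading_ratio_def fun_space.span_zero flip: zero_fun_def)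
next
  case (Suc i)
  let ?\<kappa> = "Suc i + k"
  define d where "d = A + of_nat (2 * n - 2 - i) * \<gamma>"
  define c where "c = a + of_nat k * \<gamma>"
  define remainder where "remainder = mixed i (Suc k) B - (\<lambda>l. leading_ratio i (Suc k) * mixed 0 ?\<kappa> B l)"
  define lower_terms where
    "lower_terms = (\<lambda>l. \<Sum>s=2..q. (\<alpha> s + of_nat (count B s) * \<gamma>) * mixed i k (add_mset s B) l)"
  have "remainder \<in> low_span ?\<kappa>"
    using Suc.IH[of "Suc k" B] Suc.prems unfolding remainder_def by (simp only: add_Suc_shift)
  moreover have "lower_terms \<in> low_span ?\<kappa>"
  proof -
    have "mixed i k (add_mset s B) \<in> low_span ?\<kappa>" if "s \<in> {2..q}" for s
      using Suc.prems that by (intro mixed_in_low_span Suc.IH) auto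
    moreover have "lower_terms = (\<Sum>s=2..q. (\<lambda>l. (\<alpha> s + of_nat (count B s) * \<gamma>) * mixed i k (add_mset s B) l))"
      by (simp add: lower_terms_def fun_eq_iff sum_fun_apply)
    ultimately show ?thesis by (auto intro!: fun_space.span_sum fun_space.span_scale)
  qed
  ultimately have "(\<lambda>l. c / d * remainder l) - (\<lambda>l. 1 / d * lower_terms l) \<in> low_span ?\<kappa>"
    by (intro fun_space.span_diff fun_space.span_scale)
  moreover have "mixed (Suc i) k B - (\<lambda>l. leading_ratio (Suc i) k * mixed 0 ?\<kappa> B l)
      = (\<lambda>l. c / d * remainder l) - (\<lambda>l. 1 / d * lower_terms l)"
  proof
    fix l
    have "d * mixed (Suc i) k B l = c * mixed i (Suc k) B l - lower_terms l"
      unfolding d_def c_def lower_terms_def using Suc.prems by (intro mixed_Suc) auto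
    moreover have "d \<noteq> 0" using nonresonant by (simp add: d_def)
    ultimately have "mixed (Suc i) k B l = c / d * mixed i (Suc k) B l - 1 / d * lower_terms l"
      by (simp add: field_simps)
    moreover have "leading_ratio (Suc i) k = c / d * leading_ratio i (Suc k)"
      unfolding c_def d_def by (rule leading_ratio_Suc)
    ultimately show "(mixed (Suc i) k B - (\<lambda>l. leading_ratio (Suc i) k * mixed 0 ?\<kappa> B l)) l
        = ((\<lambda>l. c / d * remainder l) - (\<lambda>l. 1 / d * lower_terms l)) l"
      by (simp add: remainder_def right_diff_distrib)
  qed
  ultimately show ?case by (simp only:)
qed

lemma words_minus_in_span:
  assumes V_u_P: "\<And>N s. s \<in> {1..q} \<Longrightarrow> set_mset N \<subseteq> L \<Longrightarrow> size N + 1 = n \<Longrightarrow>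
      V (add_mset (u s) N) = V (add_mset (P s) N) - V (add_mset (P 1) N)"
    and P_mem: "\<And>s. s \<in> {1..q} \<Longrightarrow> P s \<in> L"
    and "size M + size B = n" "set_mset M \<subseteq> {1..q}" "set_mset B \<subseteq> {1..q}"
  shows "V (image_mset P M + image_mset u B) - V (image_mset P (M + B))
    \<in> fun_space.span (word_values P ` {m \<in> Zset n q. count M 1 < m 1})"
  using assms(3-5)
proof (induction B arbitrary: M)
  case empty
  show ?case by (simp add: fun_space.span_zero flip: zero_fun_def)
next
  case (add s B)
  let ?span = "\<lambda>k. fun_space.span (word_values P ` {m \<in> Zset n q. k < m 1})"
  let ?d = "\<lambda>r. V (image_mset P (add_mset r M) + image_mset u B) - V (image_mset P (add_mset r M + B))"
  let ?N = "image_mset P M + image_mset u B"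
  have one: "1 \<in> {1..q}" using q_pos by simp
  have N: "set_mset ?N \<subseteq> L" "size ?N + 1 = n" "s \<in> {1..q}"
    using add.prems P_mem u_mem by auto
  have d_in_span: "?d r \<in> ?span (count M 1)" if "r \<in> {1..q}" for r
  proof -
    have "?d r \<in> ?span (count (add_mset r M) 1)" using add.prems that by (intro add.IH) auto
    moreover have "?span (count (add_mset r M) 1) \<subseteq> ?span (count M 1)"
      by (intro fun_space.span_mono image_mono) auto
    ultimately show ?thesis by blast
  qed
  have "word_values P (count (add_mset 1 M + B)) \<in> ?span (count M 1)"
  proof (intro fun_space.span_base imageI CollectI conjI)
    show "count (add_mset 1 M + B) \<in> Zset n q"
      unfolding Zset_eq_image_count using add.prems one by (intro imageI CollectI) auto
  qed simp
  then have "V (image_mset P (add_mset 1 M + B)) \<in> ?span (count M 1)"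
    by (simp only: word_values_def count_inverse)
  then have "?d s - ?d 1 - V (image_mset P (add_mset 1 M + B)) \<in> ?span (count M 1)"
    by (rule fun_space.span_diff[OF fun_space.span_diff[OF d_in_span[OF N(3)] d_in_span[OF one]]])
  moreover have "V (image_mset P M + image_mset u (add_mset s B)) - V (image_mset P (M + add_mset s B))
      = ?d s - ?d 1 - V (image_mset P (add_mset 1 M + B))"
    using V_u_P[OF N(3,1,2)] by simp
  ultimately show ?case by (simp only:)
qed

lemma det_on_words:
  assumes V_u_P: "\<And>N s. s \<in> {1..q} \<Longrightarrow> set_mset N \<subseteq> L \<Longrightarrow> size N + 1 = n \<Longrightarrow>
      V (add_mset (u s) N) = V (add_mset (P s) N) - V (add_mset (P 1) N)"
    and P_mem: "\<And>s. s \<in> {1..q} \<Longrightarrow> P s \<in> L"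
  shows "det_on (Zset n q) (\<lambda>l m. word_values (u(1 := P 1)) m l) = det_on (Zset n q) (\<lambda>l m. word_values P m l)"
proof -
  have "det_on (Zset n q) (\<lambda>l m. word_values (u(1 := P 1)) m l)
      = (\<Prod>m\<in>Zset n q. 1) * det_on (Zset n q) (\<lambda>l m. word_values P m l)"
  proof (rule det_on_triangular_change[where rank="\<lambda>m. n - m 1"])
    fix m assume m: "m \<in> Zset n q"
    then obtain M where M: "m = count M" "size M = n" "set_mset M \<subseteq> {1..q}"
      by (auto simp: Zset_eq_image_count)
    let ?first = "filter_mset (\<lambda>s. s = 1) M" and ?rest = "filter_mset (\<lambda>s. s \<noteq> 1) M"
    have split: "M = ?first + ?rest" by (rule multiset_partition)
    have "image_mset (u(1 := P 1)) M = image_mset (\<lambda>_. P 1) ?first + image_mset u ?rest"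
      unfolding fun_upd_def by (rule image_mset_If)
    moreover have "image_mset (\<lambda>_. P 1) ?first = image_mset P ?first"
      by (intro image_mset_cong) auto
    ultimately have "image_mset (u(1 := P 1)) M = image_mset P ?first + image_mset u ?rest" by simp
    then have words: "word_values (u(1 := P 1)) m = V (image_mset P ?first + image_mset u ?rest)"
      "word_values P m = V (image_mset P (?first + ?rest))"
      using split by (simp_all add: word_values_def M(1) count_inverse)
    have "size ?first + size ?rest = n" using M(2) split by (metis size_union)
    then have "word_values (u(1 := P 1)) m - word_values P m
        \<in> fun_space.span (word_values P ` {k \<in> Zset n q. count ?first 1 < k 1})"
      unfolding words using M(3) by (intro words_minus_in_span V_u_P P_mem) auto
    moreover have "{k \<in> Zset n q. count ?first 1 < k 1} = {k \<in> Zset n q. n - k 1 < n - m 1}"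
      using Zset_le[of _ n q 1] q_pos by (force simp: M(1) M(2)[symmetric])
    ultimately show "word_values (u(1 := P 1)) m - (\<lambda>l. 1 * word_values P m l)
        \<in> fun_space.span (word_values P ` {k \<in> Zset n q. n - k 1 < n - m 1})" by simp
  qed simp
  then show ?thesis by simp
qed

theorem det_on_h_eq_det_on_g:
  "det_on (Zset n q) (\<lambda>l m. V (image_mset h (Abs_multiset m)) l)
   = (\<Prod>m\<in>Zset n q. \<Prod>r<m 1. (a + of_nat r * \<gamma>) / (A + of_nat (2 * n - 2 - r) * \<gamma>))
     * det_on (Zset n q) (\<lambda>l m. V (image_mset g (Abs_multiset m)) l)"
proof -
  have "det_on (Zset n q) (\<lambda>l m. word_values (u(1 := h 1)) m l)
      = (\<Prod>m\<in>Zset n q. \<Prod>r<m 1. (a + of_nat r * \<gamma>) / (A + of_nat (2 * n - 2 - r) * \<gamma>))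
        * det_on (Zset n q) (\<lambda>l m. word_values (u(1 := g 1)) m l)"
  proof (rule det_on_triangular_change[where rank="\<lambda>m. m 1"])
    fix m assume m: "m \<in> Zset n q"
    then obtain M where M: "m = count M" "size M = n" "set_mset M \<subseteq> {1..q}"
      by (auto simp: Zset_eq_image_count)
    let ?rest = "filter_mset (\<lambda>s. s \<noteq> 1) M"
    have split: "M = replicate_mset (m 1) 1 + ?rest"
      using multiset_partition[of M "\<lambda>s. s = 1"] by (simp add: M(1) filter_eq_replicate_mset)
    have "image_mset (u(1 := c)) M = replicate_mset (m 1) c + image_mset u ?rest" for c
      using image_mset_If[of "\<lambda>s. s = 1" "\<lambda>_. c" u M] by (simp add: fun_upd_def filter_eq_replicate_mset M(1))
    then have "word_values (u(1 := h 1)) m = mixed (m 1) 0 ?rest"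
      "word_values (u(1 := g 1)) m = mixed 0 (m 1 + 0) ?rest"
      by (simp_all add: word_values_def mixed_def M(1) count_inverse)
    moreover have "m 1 + 0 + size ?rest = n" using M(2) split by (metis add_0_right size_replicate_mset size_union)
    moreover have "set_mset ?rest \<subseteq> {2..q}" using M(3) by auto
    ultimately show "word_values (u(1 := h 1)) m
        - (\<lambda>l. (\<Prod>r<m 1. (a + of_nat r * \<gamma>) / (A + of_nat (2 * n - 2 - r) * \<gamma>)) * word_values (u(1 := g 1)) m l)
        \<in> fun_space.span (word_values (u(1 := g 1)) ` {k \<in> Zset n q. k 1 < m 1})"
      using mixed_minus_leading_in_low_span[of "m 1" 0 ?rest] by (simp add: leading_ratio_def prod_dividef)
  qed simp
  moreover have "det_on (Zset n q) (\<lambda>l m. word_values (u(1 := h 1)) m l)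
      = det_on (Zset n q) (\<lambda>l m. word_values h m l)"
    by (rule det_on_words[OF V_u(1) h_mem])
  moreover have "det_on (Zset n q) (\<lambda>l m. word_values (u(1 := g 1)) m l)
      = det_on (Zset n q) (\<lambda>l m. word_values g m l)"
    by (rule det_on_words[OF V_u(2) g_mem])
  ultimately show ?thesis by (simp only: word_values_def)
qed

end

section \<open>Complex powers of absolute values\<close>

definition abs_powr :: "real \<Rightarrow> complex \<Rightarrow> complex" where
  "abs_powr x a = complex_of_real \<bar>x\<bar> powr a"

lemma abs_powr_0 [simp]: "abs_powr 0 a = 0"
  by (simp add: abs_powr_def)

lemma abs_powr_eq_0_iff [simp]: "abs_powr x a = 0 \<longleftrightarrow> x = 0"
  by (simp add: abs_powr_def)

lemma abs_powr_1 [simp]: "abs_powr 1 a = 1"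
  by (simp add: abs_powr_def)

lemma norm_abs_powr: "norm (abs_powr x a) = \<bar>x\<bar> powr Re a"
  by (simp add: abs_powr_def norm_powr_real_powr)

lemma abs_powr_minus [simp]: "abs_powr (- x) a = abs_powr x a"
  by (simp add: abs_powr_def)

lemma abs_powr_minus_commute: "abs_powr (x - y) a = abs_powr (y - x) a"
  by (simp add: abs_powr_def abs_minus_commute)

lemma abs_powr_mult: "abs_powr (x * y) a = abs_powr x a * abs_powr y a"
  by (simp add: abs_powr_def abs_mult powr_times_real)

lemma abs_powr_add: "abs_powr x (a + b) = abs_powr x a * abs_powr x b"
  by (simp add: abs_powr_def powr_add)

lemma abs_powr_exponent_0 [simp]: "x \<noteq> 0 \<Longrightarrow> abs_powr x 0 = 1"
  by (simp add: abs_powr_def)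

lemma abs_powr_sum: "x \<noteq> 0 \<Longrightarrow> abs_powr x (\<Sum>i\<in>S. f i) = (\<Prod>i\<in>S. abs_powr x (f i))"
  by (simp add: abs_powr_def powr_sum)

lemma abs_powr_power: "x \<noteq> 0 \<Longrightarrow> abs_powr x a ^ k = abs_powr x (of_nat k * a)"
  by (simp add: abs_powr_def powr_power)

lemma abs_powr_add_of_nat: "abs_powr x (a + of_nat k) = abs_powr x a * of_real (\<bar>x\<bar> ^ k)"
  by (simp add: abs_powr_def powr_add powr_nat)

lemma abs_powr_add_1: "abs_powr x (a + 1) = abs_powr x a * of_real \<bar>x\<bar>"
  using abs_powr_add_of_nat[of x a 1] by simp

lemma abs_powr_eq_exp: "x \<noteq> 0 \<Longrightarrow> abs_powr x a = exp (a * of_real (ln \<bar>x\<bar>))"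
  by (simp add: abs_powr_def powr_def Ln_of_real)

lemma measurable_abs_powr [measurable]: "(\<lambda>x. abs_powr x a) \<in> borel_measurable borel"
proof -
  have "(\<lambda>x. if x = 0 then 0 else exp (a * of_real (ln \<bar>x\<bar>))) \<in> borel_measurable borel" by measurable
  also have "(\<lambda>x. if x = 0 then 0 else exp (a * of_real (ln \<bar>x\<bar>))) = (\<lambda>x. abs_powr x a)"
    by (auto simp: abs_powr_eq_exp)
  finally show ?thesis .
qed

lemma isCont_abs_powr: "x \<noteq> 0 \<Longrightarrow> isCont (\<lambda>x. abs_powr x a) x"
  unfolding abs_powr_def by (intro continuous_intros) (auto simp: complex_nonpos_Reals_iff)

lemma tendsto_abs_powr: "(f \<longlongrightarrow> x) F \<Longrightarrow> x \<noteq> 0 \<Longrightarrow> ((\<lambda>k. abs_powr (f k) a) \<longlongrightarrow> abs_powr x a) F"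
  by (rule isCont_tendsto_compose[OF isCont_abs_powr])

lemma continuous_on_abs_powr:
  assumes "Re a > 0"
  shows "continuous_on S (\<lambda>x. abs_powr x a)"
proof (rule continuous_at_imp_continuous_on, rule ballI)
  fix x
  show "isCont (\<lambda>x. abs_powr x a) x"
  proof (cases "x = 0")
    case True
    have "((\<lambda>x::real. \<bar>x\<bar> powr Re a) \<longlongrightarrow> 0 powr Re a) (at 0)"
      using assms by (intro tendsto_powr2) (auto intro!: tendsto_eq_intros)
    then have "((\<lambda>x. norm (abs_powr x a)) \<longlongrightarrow> 0) (at 0)" by (simp add: norm_abs_powr)
    then have "((\<lambda>x. abs_powr x a) \<longlongrightarrow> 0) (at 0)" by (rule tendsto_norm_zero_cancel)
    then show ?thesis using True by (simp add: isCont_def)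
  qed (rule isCont_abs_powr)
qed

lemma ln_abs_has_real_derivative:
  assumes "x \<noteq> c"
  shows "((\<lambda>x. ln \<bar>x - c\<bar>) has_real_derivative 1 / (x - c)) (at x)"
proof (cases "x > c")
  case True
  have "((\<lambda>x. ln (x - c)) has_real_derivative 1 / (x - c)) (at x)"
    using True by (auto intro!: derivative_eq_intros)
  moreover have "\<forall>\<^sub>F y in nhds x. ln (y - c) = ln \<bar>y - c\<bar>"
    using eventually_nhds_in_open[of "{c<..}" x] True by (auto elim!: eventually_mono)
  ultimately show ?thesis by (simp add: DERIV_cong_ev)
next
  case False
  have "((\<lambda>x. ln (c - x)) has_real_derivative 1 / (x - c)) (at x)"
    using False assms by (auto intro!: derivative_eq_intros simp: field_simps)
  moreover have "\<forall>\<^sub>F y in nhds x. ln (c - y) = ln \<bar>y - c\<bar>"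
    using eventually_nhds_in_open[of "{..<c}" x] False assms by (auto elim!: eventually_mono)
  ultimately show ?thesis by (simp add: DERIV_cong_ev)
qed

lemma abs_powr_has_vector_derivative:
  assumes "x \<noteq> c"
  shows "((\<lambda>x. abs_powr (x - c) a) has_vector_derivative a / of_real (x - c) * abs_powr (x - c) a) (at x)"
proof -
  have log: "((\<lambda>x. a * of_real (ln \<bar>x - c\<bar>)) has_vector_derivative a * of_real (1 / (x - c))) (at x)"
    using ln_abs_has_real_derivative[OF assms]
    by (intro has_vector_derivative_mult_right has_vector_derivative_of_real)
       (simp add: has_real_derivative_iff_has_vector_derivative)
  have "((\<lambda>x. exp (a * of_real (ln \<bar>x - c\<bar>))) has_vector_derivative a * of_real (1 / (x - c))
      * exp (a * of_real (ln \<bar>x - c\<bar>))) (at x)"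
    using field_vector_diff_chain_at[OF log DERIV_exp] by (simp add: o_def)
  then have "((\<lambda>x. abs_powr (x - c) a) has_vector_derivative a * of_real (1 / (x - c))
      * exp (a * of_real (ln \<bar>x - c\<bar>))) (at x)"
    by (rule has_vector_derivative_transform_within_open[of _ _ _ "- {c}"])
      (use assms in \<open>auto simp: abs_powr_eq_exp\<close>)
  then show ?thesis
    using assms by (simp add: abs_powr_eq_exp)
qed

lemma prod_has_vector_derivative_log:
  fixes f :: "'k \<Rightarrow> real \<Rightarrow> 'a :: real_normed_field"
  assumes "finite S" "\<And>k. k \<in> S \<Longrightarrow> (f k has_vector_derivative g k * f k x) (at x)"
  shows "((\<lambda>x. \<Prod>k\<in>S. f k x) has_vector_derivative ((\<Prod>k\<in>S. f k x) * (\<Sum>k\<in>S. g k))) (at x)"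
  using assms
proof (induction S rule: finite_induct)
  case (insert k S)
  have "((\<lambda>x. f k x * (\<Prod>k\<in>S. f k x)) has_vector_derivative f k x * ((\<Prod>k\<in>S. f k x) * (\<Sum>k\<in>S. g k))
      + g k * f k x * (\<Prod>k\<in>S. f k x)) (at x)"
    using insert by (intro has_vector_derivative_mult) auto
  then show ?case using insert.hyps by (simp add: algebra_simps)
qed simp

lemma lebesgue_integral_derivative_eq_0:
  fixes F f :: "real \<Rightarrow> 'a :: euclidean_space"
  assumes F: "continuous_on {a..b} F" "\<And>x. x \<in> {a<..<b} \<Longrightarrow> (F has_vector_derivative f x) (at x)" "F a = F b"
  shows "(LINT x:{a..b}|lborel. f x) = 0"
proof (cases "set_integrable lborel {a..b} f")
  case False
  then show ?thesis by (simp add: set_lebesgue_integral_def set_integrable_def not_integrable_integral_eq)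
next
  case integrable: True
  show ?thesis
  proof (cases "a \<le> b")
    case True
    have "(f has_integral (F b - F a)) {a..b}"
      using F True by (intro fundamental_theorem_of_calculus_interior) auto
    then show ?thesis
      using set_borel_integral_eq_integral(2)[OF integrable] F(3) by (simp add: integral_unique)
  qed (simp add: set_lebesgue_integral_def)
qed

lemma integral_prod_abs_powr_log_derivative:
  fixes c :: "'k \<Rightarrow> real" and \<beta> :: "'k \<Rightarrow> complex"
  assumes fin: "finite A" "finite B" "A \<noteq> {}" "B \<noteq> {}" and \<beta>: "\<And>k. k \<in> A \<union> B \<Longrightarrow> Re (\<beta> k) > 0"
  shows "(LINT y:{y. (\<forall>k\<in>A. c k \<le> y) \<and> (\<forall>k\<in>B. y \<le> c k)}|lborel.
      (\<Prod>k\<in>A\<union>B. abs_powr (y - c k) (\<beta> k)) * (\<Sum>k\<in>A\<union>B. \<beta> k / of_real (y - c k))) = 0"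
proof -
  define lo where "lo = Max (c ` A)"
  define hi where "hi = Min (c ` B)"
  define F where "F y = (\<Prod>k\<in>A\<union>B. abs_powr (y - c k) (\<beta> k))" for y
  have "lo \<le> y \<longleftrightarrow> (\<forall>k\<in>A. c k \<le> y)" for y unfolding lo_def using fin by (subst Max_le_iff) auto
  moreover have "y \<le> hi \<longleftrightarrow> (\<forall>k\<in>B. y \<le> c k)" for y unfolding hi_def using fin by (subst Min_ge_iff) auto
  ultimately have interval: "{y. (\<forall>k\<in>A. c k \<le> y) \<and> (\<forall>k\<in>B. y \<le> c k)} = {lo..hi}"
    unfolding set_eq_iff mem_Collect_eq atLeastAtMost_iff by metis
  have vanishes: "F (c k) = 0" if "k \<in> A \<union> B" for k
    unfolding F_def using that fin by (intro prod_zero) auto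
  have "lo \<in> c ` A" "hi \<in> c ` B" unfolding lo_def hi_def using fin by (auto intro!: Max_in Min_in)
  then have "F lo = F hi" using vanishes by force
  moreover have "continuous_on {lo..hi} F"
    unfolding F_def using \<beta>
    by (intro continuous_on_prod continuous_on_compose2[OF continuous_on_abs_powr[of _ UNIV]]
      continuous_intros) auto
  moreover have "(F has_vector_derivative F y * (\<Sum>k\<in>A\<union>B. \<beta> k / of_real (y - c k))) (at y)"
    if y: "y \<in> {lo<..<hi}" for y
  proof -
    have "c k \<le> lo \<or> hi \<le> c k" if "k \<in> A \<union> B" for k using that fin by (auto simp: lo_def hi_def)
    then have "y \<noteq> c k" if "k \<in> A \<union> B" for k using y that by force
    then show ?thesis unfolding F_def
      using fin by (intro prod_has_vector_derivative_log abs_powr_has_vector_derivative) auto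
  qed
  ultimately show ?thesis
    unfolding interval F_def[symmetric] by (intro lebesgue_integral_derivative_eq_0)
qed

section \<open>Integrals in one variable\<close>

lemma nn_integral_abs_powr_0:
  assumes "a > 0" "R \<ge> 0"
  shows "(\<integral>\<^sup>+t. ennreal (indicator {-R..R} t * \<bar>t\<bar> powr (a - 1)) \<partial>lborel) \<le> ennreal (2 * (R powr a / a))"
proof -
  let ?half = "\<lambda>t. indicator {0..R} t * t powr (a - 1)"
  have "((\<lambda>t. if t \<in> {0..R} then t powr (a - 1) else 0) has_integral (R powr a / a)) UNIV"
    unfolding has_integral_restrict_UNIV using has_integral_powr_from_0[of "a - 1" R] assms by simp
  then have "(?half has_integral (R powr a / a)) UNIV"
    by (rule has_integral_eq[rotated]) (auto simp: indicator_def)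
  then have right: "(\<integral>\<^sup>+t. ennreal (?half t) \<partial>lborel) = ennreal (R powr a / a)"
    by (intro nn_integral_has_integral_lborel) auto
  then have left: "(\<integral>\<^sup>+t. ennreal (?half (- t)) \<partial>lborel) = ennreal (R powr a / a)"
    using nn_integral_real_affine[of "\<lambda>t. ennreal (?half t)" "-1" 0] by simp
  have "(\<integral>\<^sup>+t. ennreal (indicator {-R..R} t * \<bar>t\<bar> powr (a - 1)) \<partial>lborel)
      \<le> (\<integral>\<^sup>+t. ennreal (?half t) + ennreal (?half (- t)) \<partial>lborel)"
    by (rule nn_integral_mono) (auto simp: indicator_def abs_real_def)
  also have "\<dots> = ennreal (R powr a / a) + ennreal (R powr a / a)"
    by (subst nn_integral_add) (auto simp: left right)
  also have "\<dots> = ennreal (2 * (R powr a / a))" using assms by (simp flip: ennreal_plus)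
  finally show ?thesis .
qed

lemma nn_integral_abs_powr:
  assumes "a > 0" "R \<ge> 0" "{A..B} \<subseteq> {c - R..c + R}"
  shows "(\<integral>\<^sup>+t. ennreal (indicator {A..B} t * \<bar>t - c\<bar> powr (a - 1)) \<partial>lborel) \<le> ennreal (2 * (R powr a / a))"
proof -
  let ?centred = "\<lambda>t. indicator {-R..R} t * \<bar>t\<bar> powr (a - 1)"
  have "(\<integral>\<^sup>+t. ennreal (indicator {A..B} t * \<bar>t - c\<bar> powr (a - 1)) \<partial>lborel)
      \<le> (\<integral>\<^sup>+t. ennreal (?centred (t - c)) \<partial>lborel)"
    using assms(3) by (intro nn_integral_mono) (force simp: indicator_def)
  also have "\<dots> = (\<integral>\<^sup>+t. ennreal (?centred t) \<partial>lborel)"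
    using nn_integral_real_affine[of "\<lambda>t. ennreal (?centred t)" 1 "- c"] by simp
  also have "\<dots> \<le> ennreal (2 * (R powr a / a))" using assms by (intro nn_integral_abs_powr_0)
  finally show ?thesis .
qed

lemma integrable_abs_powr:
  assumes "e > -1"
  shows "integrable lborel (\<lambda>t. indicator {A..B} t * \<bar>t - c\<bar> powr e :: real)"
proof (rule integrableI_bounded)
  let ?R = "\<bar>A\<bar> + \<bar>B\<bar> + \<bar>c\<bar>"
  have "(\<integral>\<^sup>+t. ennreal (norm (indicator {A..B} t * \<bar>t - c\<bar> powr e)) \<partial>lborel)
     = (\<integral>\<^sup>+t. ennreal (indicator {A..B} t * \<bar>t - c\<bar> powr (e + 1 - 1)) \<partial>lborel)" by simp
  also have "\<dots> \<le> ennreal (2 * (?R powr (e + 1) / (e + 1)))"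
    using assms by (intro nn_integral_abs_powr) auto
  also have "\<dots> < \<infinity>" by simp
  finally show "(\<integral>\<^sup>+t. ennreal (norm (indicator {A..B} t * \<bar>t - c\<bar> powr e)) \<partial>lborel) < \<infinity>" .
qed simp

lemma powr_le_powr_sum:
  fixes x :: real
  assumes "0 < d" "d \<le> x" "x \<le> R"
  shows "x powr e \<le> d powr e + R powr e"
proof (cases "e \<ge> 0")
  case True
  then have "x powr e \<le> R powr e" using assms by (intro powr_mono2) auto
  then show ?thesis by (simp add: add_increasing)
next
  case False
  then have "x powr e \<le> d powr e" using assms by (intro powr_mono2') auto
  then show ?thesis by (simp add: add_increasing2)
qed

lemma ex_separation:
  fixes c :: "'k \<Rightarrow> real"
  assumes "finite S" "inj_on c S"
  obtains d where "d > 0" "\<And>r s. r \<in> S \<Longrightarrow> s \<in> S \<Longrightarrow> r \<noteq> s \<Longrightarrow> 2 * d \<le> \<bar>c r - c s\<bar>"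
proof -
  define gaps where "gaps = insert 1 ((\<lambda>(r, s). \<bar>c r - c s\<bar> / 2) ` {(r, s) \<in> S \<times> S. r \<noteq> s})"
  have gaps: "finite gaps" "gaps \<noteq> {}"
    unfolding gaps_def using assms(1) by (auto intro: finite_subset[of _ "S \<times> S"])
  have "Min gaps > 0"
    using gaps assms(2) by (subst Min_gr_iff) (auto simp: gaps_def inj_on_def)
  moreover have "2 * Min gaps \<le> \<bar>c r - c s\<bar>" if "r \<in> S" "s \<in> S" "r \<noteq> s" for r s
  proof -
    have "\<bar>c r - c s\<bar> / 2 \<in> gaps" unfolding gaps_def using that by (intro insertI2 image_eqI[of _ _ "(r, s)"]) auto
    then have "Min gaps \<le> \<bar>c r - c s\<bar> / 2" using gaps by (intro Min_le)
    then show ?thesis by simp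
  qed
  ultimately show ?thesis by (rule that)
qed

lemma prod_abs_powr_le_sum:
  fixes c e :: "'k \<Rightarrow> real"
  assumes S: "finite S" "inj_on c S"
  obtains C where "\<And>t. t \<in> {A..B} \<Longrightarrow> (\<Prod>r\<in>S. \<bar>t - c r\<bar> powr e r) \<le> C * (1 + (\<Sum>r\<in>S. \<bar>t - c r\<bar> powr e r))"
proof -
  obtain d where d: "d > 0" "\<And>r s. r \<in> S \<Longrightarrow> s \<in> S \<Longrightarrow> r \<noteq> s \<Longrightarrow> 2 * d \<le> \<bar>c r - c s\<bar>"
    by (rule ex_separation[OF S]) blast
  define R where "R = \<bar>A\<bar> + \<bar>B\<bar> + (\<Sum>r\<in>S. \<bar>c r\<bar>)"
  define K where "K r = d powr e r + R powr e r" for r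
  define C where "C = (\<Prod>r\<in>S. K r) + (\<Sum>s\<in>S. \<Prod>r\<in>S - {s}. K r)"
  have K: "0 \<le> K r" for r by (simp add: K_def)
  have far: "\<bar>t - c r\<bar> powr e r \<le> K r" if "t \<in> {A..B}" "r \<in> S" "d \<le> \<bar>t - c r\<bar>" for t r
  proof -
    have "\<bar>c r\<bar> \<le> (\<Sum>r\<in>S. \<bar>c r\<bar>)" using that S by (intro member_le_sum) auto
    then have "\<bar>t - c r\<bar> \<le> R" using that by (auto simp: R_def)
    then show ?thesis unfolding K_def using that d by (intro powr_le_powr_sum) auto
  qed
  have "(\<Prod>r\<in>S. \<bar>t - c r\<bar> powr e r) \<le> C * (1 + (\<Sum>r\<in>S. \<bar>t - c r\<bar> powr e r))" if t: "t \<in> {A..B}" for t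
  proof (cases "\<exists>s\<in>S. \<bar>t - c s\<bar> < d")
    case True
    then obtain s where s: "s \<in> S" "\<bar>t - c s\<bar> < d" by blast
    have "d \<le> \<bar>t - c r\<bar>" if "r \<in> S - {s}" for r using s d(2)[of r s] that by auto
    then have "(\<Prod>r\<in>S - {s}. \<bar>t - c r\<bar> powr e r) \<le> (\<Prod>r\<in>S - {s}. K r)"
      using t by (intro prod_mono conjI far) auto
    also have "\<dots> \<le> (\<Sum>s\<in>S. \<Prod>r\<in>S - {s}. K r)" using S(1) s(1) K by (intro member_le_sum) (auto intro: prod_nonneg)
    also have "\<dots> \<le> C" unfolding C_def using K by (simp add: prod_nonneg)
    finally have "(\<Prod>r\<in>S - {s}. \<bar>t - c r\<bar> powr e r) \<le> C" .
    moreover have "\<bar>t - c s\<bar> powr e s \<le> (\<Sum>r\<in>S. \<bar>t - c r\<bar> powr e r)" using S(1) s(1) by (intro member_le_sum) auto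
    ultimately have "(\<Prod>r\<in>S - {s}. \<bar>t - c r\<bar> powr e r) * \<bar>t - c s\<bar> powr e s \<le> C * (1 + (\<Sum>r\<in>S. \<bar>t - c r\<bar> powr e r))"
      using K by (intro mult_mono) (auto simp: C_def intro!: add_nonneg_nonneg prod_nonneg sum_nonneg)
    then show ?thesis using S(1) s(1) by (simp add: prod.remove[of S s] mult.commute)
  next
    case False
    then have "(\<Prod>r\<in>S. \<bar>t - c r\<bar> powr e r) \<le> (\<Prod>r\<in>S. K r) * 1"
      unfolding mult_1_right using t by (intro prod_mono conjI far) auto
    also have "\<dots> \<le> C * (1 + (\<Sum>r\<in>S. \<bar>t - c r\<bar> powr e r))"
      using K by (intro mult_mono) (auto simp: C_def intro!: add_nonneg_nonneg prod_nonneg sum_nonneg)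
    finally show ?thesis .
  qed
  then show ?thesis by (rule that)
qed

lemma integrable_prod_abs_powr:
  fixes c e :: "'k \<Rightarrow> real"
  assumes S: "finite S" "inj_on c S" and e: "\<And>r. r \<in> S \<Longrightarrow> e r > -1"
  shows "integrable lborel (\<lambda>t. indicator {A..B} t * (\<Prod>r\<in>S. \<bar>t - c r\<bar> powr e r))"
proof -
  obtain C where C: "(\<Prod>r\<in>S. \<bar>t - c r\<bar> powr e r) \<le> C * (1 + (\<Sum>r\<in>S. \<bar>t - c r\<bar> powr e r))" if "t \<in> {A..B}" for t
    using prod_abs_powr_le_sum[OF S] by blast
  let ?majorant = "\<lambda>t. C * (indicator {A..B} t + (\<Sum>r\<in>S. indicator {A..B} t * \<bar>t - c r\<bar> powr e r))"
  have "integrable lborel (indicator {A..B} :: real \<Rightarrow> real)"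
    by (rule integrable_real_indicator) (simp_all add: emeasure_lborel_Icc_eq)
  then have "integrable lborel ?majorant"
    using e by (intro integrable_mult_right Bochner_Integration.integrable_add Bochner_Integration.integrable_sum
      integrable_abs_powr) auto
  then show ?thesis
  proof (rule Bochner_Integration.integrable_bound)
    have "norm (indicator {A..B} t * (\<Prod>r\<in>S. \<bar>t - c r\<bar> powr e r)) \<le> norm (?majorant t)" for t
      using C[of t] by (cases "t \<in> {A..B}") (auto simp: prod_nonneg)
    then show "AE t in lborel. norm (indicator {A..B} t * (\<Prod>r\<in>S. \<bar>t - c r\<bar> powr e r)) \<le> norm (?majorant t)" by simp
  qed measurable
qed

definition gamma_majorant :: "real \<Rightarrow> real \<Rightarrow> real \<Rightarrow> real" where
  "gamma_majorant a Q y = indicator {0..} y * (y powr (a - 1) * (1 + y) powr Q * exp (- y))"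

lemma measurable_gamma_majorant [measurable]: "gamma_majorant a Q \<in> borel_measurable borel"
  unfolding gamma_majorant_def[abs_def] by measurable

lemma gamma_majorant_nonneg: "gamma_majorant a Q y \<ge> 0"
  by (simp add: gamma_majorant_def)

lemma gamma_majorant_mult: "y \<ge> 0 \<Longrightarrow> gamma_majorant a P y * (1 + y) powr Q = gamma_majorant a (P + Q) y"
  by (simp add: gamma_majorant_def powr_add mult_ac)

lemma integrable_Gamma_density:
  assumes "a > 0"
  shows "integrable lborel (\<lambda>t. indicator {0..} t * (t powr (a - 1) * exp (- t)) :: real)"
proof -
  have "((\<lambda>t. if t \<in> {0..} then t powr (a - 1) / exp t else 0) has_integral Gamma a) UNIV"
    unfolding has_integral_restrict_UNIV by (rule Gamma_integral_real[OF assms])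
  then have "((\<lambda>t. indicator {0..} t * (t powr (a - 1) * exp (- t))) has_integral Gamma a) UNIV"
    by (rule has_integral_eq[rotated]) (auto simp: indicator_def exp_minus field_simps)
  then have "(\<integral>\<^sup>+t. ennreal (indicator {0..} t * (t powr (a - 1) * exp (- t))) \<partial>lborel) = ennreal (Gamma a)"
    by (intro nn_integral_has_integral_lborel) auto
  then show ?thesis by (intro integrableI_bounded) auto
qed

lemma one_plus_powr_le:
  fixes t :: real
  assumes "t \<ge> 0" "Q \<ge> 0"
  shows "(1 + t) powr Q \<le> 2 powr Q * (1 + t powr Q)"
proof (cases "t \<le> 1")
  case True
  then have "(1 + t) powr Q \<le> 2 powr Q" using assms by (intro powr_mono2) auto
  then show ?thesis by (simp add: distrib_left add_increasing2)
next
  case False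
  then have "(1 + t) powr Q \<le> (2 * t) powr Q" using assms by (intro powr_mono2) auto
  also have "\<dots> \<le> 2 powr Q * (1 + t powr Q)" using False by (simp add: powr_mult)
  finally show ?thesis .
qed

lemma integrable_gamma_majorant:
  assumes "a > 0" "Q \<ge> 0"
  shows "integrable lborel (gamma_majorant a Q)"
proof (rule Bochner_Integration.integrable_bound)
  let ?density = "\<lambda>a t. indicator {0..} t * (t powr (a - 1) * exp (- t)) :: real"
  show "integrable lborel (\<lambda>t. 2 powr Q * (?density a t + ?density (a + Q) t))"
    using assms by (intro integrable_mult_right Bochner_Integration.integrable_add integrable_Gamma_density) auto
  show "AE t in lborel. norm (gamma_majorant a Q t) \<le> norm (2 powr Q * (?density a t + ?density (a + Q) t))"
  proof (intro AE_I2)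
    fix t :: real
    show "norm (gamma_majorant a Q t) \<le> norm (2 powr Q * (?density a t + ?density (a + Q) t))"
    proof (cases "t \<ge> 0")
      case True
      have "t powr (a - 1) * (1 + t) powr Q * exp (- t) \<le> t powr (a - 1) * (2 powr Q * (1 + t powr Q)) * exp (- t)"
        using True assms by (intro mult_right_mono mult_left_mono one_plus_powr_le) auto
      also have "\<dots> = 2 powr Q * (t powr (a - 1) * exp (- t) + t powr (a + Q - 1) * exp (- t))"
        by (simp add: diff_add_eq powr_add powr_diff algebra_simps)
      finally show ?thesis using True by (simp add: gamma_majorant_def)
    qed (simp add: gamma_majorant_def)
  qed
qed simp

section \<open>Integrals in several variables\<close>

abbreviation lborel_on :: "'i set \<Rightarrow> ('i \<Rightarrow> real) measure" where
  "lborel_on I \<equiv> PiM I (\<lambda>_. lborel)"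

interpretation lborel_product: product_sigma_finite "\<lambda>_ :: 'i. lborel :: real measure" by standard

lemma measurable_lborel_component: "i \<in> I \<Longrightarrow> (\<lambda>t. t i) \<in> borel_measurable (lborel_on I)"
  by (metis measurable_component_singleton measurable_lborel1)

lemma measurable_affine_reindex:
  assumes "f \<in> J \<rightarrow> I"
  shows "(\<lambda>y. \<lambda>j\<in>J. d j + c j * y (f j)) \<in> measurable (lborel_on I) (lborel_on J)"
  by (rule measurable_restrict)
     (use assms in \<open>auto intro!: borel_measurable_add borel_measurable_times measurable_lborel_component\<close>)

lemma emeasure_lborel_affine:
  assumes "c \<noteq> 0" "A \<in> sets borel"
  shows "ennreal \<bar>c\<bar> * emeasure lborel ((\<lambda>x. d + c * x) -` A) = emeasure lborel A"
proof -
  have "emeasure lborel A = emeasure (density (distr lborel borel (\<lambda>x. d + c * x)) (\<lambda>_. \<bar>c\<bar>)) A"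
    using lborel_real_affine[OF assms(1), of d] by simp
  also have "\<dots> = ennreal \<bar>c\<bar> * emeasure lborel ((\<lambda>x. d + c * x) -` A)"
    using assms(2) by (simp add: emeasure_density_const emeasure_distr)
  finally show ?thesis by simp
qed

lemma affine_reindex_vimage_PiE:
  assumes f: "bij_betw f J I"
  shows "(\<lambda>y. \<lambda>j\<in>J. d j + c j * y (f j)) -` Pi\<^sub>E J A \<inter> (\<Pi>\<^sub>E i\<in>I. UNIV)
    = (\<Pi>\<^sub>E i\<in>I. (\<lambda>x. d (inv_into J f i) + c (inv_into J f i) * x) -` A (inv_into J f i))"
proof (intro set_eqI iffI)
  fix y assume y: "y \<in> (\<lambda>y. \<lambda>j\<in>J. d j + c j * y (f j)) -` Pi\<^sub>E J A \<inter> (\<Pi>\<^sub>E i\<in>I. UNIV)"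
  then have "d j + c j * y (f j) \<in> A j" if "j \<in> J" for j using that by (auto simp: PiE_iff)
  then show "y \<in> (\<Pi>\<^sub>E i\<in>I. (\<lambda>x. d (inv_into J f i) + c (inv_into J f i) * x) -` A (inv_into J f i))"
    using y bij_betw_inv_into_right[OF f] bij_betwE[OF bij_betw_inv_into[OF f]] by (force simp: PiE_iff)
next
  fix y assume y: "y \<in> (\<Pi>\<^sub>E i\<in>I. (\<lambda>x. d (inv_into J f i) + c (inv_into J f i) * x) -` A (inv_into J f i))"
  have "d j + c j * y (f j) \<in> A j" if "j \<in> J" for j
    using PiE_mem[OF y, of "f j"] bij_betwE[OF f] bij_betw_inv_into_left[OF f that] that by auto
  then show "y \<in> (\<lambda>y. \<lambda>j\<in>J. d j + c j * y (f j)) -` Pi\<^sub>E J A \<inter> (\<Pi>\<^sub>E i\<in>I. UNIV)"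
    using y by (auto simp: PiE_iff)
qed

lemma lborel_on_affine:
  assumes f: "bij_betw f J I" and J: "finite J" and c: "\<And>j. j \<in> J \<Longrightarrow> c j \<noteq> 0"
  shows "density (distr (lborel_on I) (lborel_on J) (\<lambda>y. \<lambda>j\<in>J. d j + c j * y (f j))) (\<lambda>_. \<Prod>j\<in>J. ennreal \<bar>c j\<bar>)
    = lborel_on J" (is "density (distr ?P ?Q ?T) _ = _")
proof (rule lborel_product.PiM_eqI[OF J])
  fix A :: "_ \<Rightarrow> real set" assume A: "\<And>j. j \<in> J \<Longrightarrow> A j \<in> sets lborel"
  let ?B = "\<lambda>i. (\<lambda>x. d (inv_into J f i) + c (inv_into J f i) * x) -` A (inv_into J f i)"
  have T: "?T \<in> measurable ?P ?Q"
    by (rule measurable_affine_reindex) (use bij_betwE[OF f] in blast)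
  have "Pi\<^sub>E J A \<in> sets ?Q" using A J by (intro sets_PiM_I_finite) auto
  then have "emeasure (density (distr ?P ?Q ?T) (\<lambda>_. \<Prod>j\<in>J. ennreal \<bar>c j\<bar>)) (Pi\<^sub>E J A)
      = (\<Prod>j\<in>J. ennreal \<bar>c j\<bar>) * emeasure ?P (Pi\<^sub>E I ?B)"
    using T affine_reindex_vimage_PiE[OF f, of d c A]
    by (simp add: emeasure_density_const emeasure_distr space_PiM)
  also have "emeasure ?P (Pi\<^sub>E I ?B) = (\<Prod>i\<in>I. emeasure lborel (?B i))"
  proof (rule lborel_product.emeasure_PiM)
    fix i assume "i \<in> I"
    then have "A (inv_into J f i) \<in> sets borel" using A bij_betwE[OF bij_betw_inv_into[OF f]] by auto
    from measurable_sets[OF _ this, of "\<lambda>x. d (inv_into J f i) + c (inv_into J f i) * x" borel]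
    show "?B i \<in> sets lborel" by simp
  qed (use J f bij_betw_finite in blast)
  also have "\<dots> = (\<Prod>j\<in>J. emeasure lborel ((\<lambda>x. d j + c j * x) -` A j))"
    using prod.reindex_bij_betw[OF f, of "\<lambda>i. emeasure lborel (?B i)"] bij_betw_inv_into_left[OF f] by simp
  also have "(\<Prod>j\<in>J. ennreal \<bar>c j\<bar>) * \<dots> = (\<Prod>j\<in>J. emeasure lborel (A j))"
    unfolding prod.distrib[symmetric] using A c by (intro prod.cong refl emeasure_lborel_affine) auto
  finally show "emeasure (density (distr ?P ?Q ?T) (\<lambda>_. \<Prod>j\<in>J. ennreal \<bar>c j\<bar>)) (Pi\<^sub>E J A)
      = (\<Prod>j\<in>J. emeasure lborel (A j))" .
qed simp

lemma integral_lborel_on_affine: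
  fixes g :: "('j \<Rightarrow> real) \<Rightarrow> complex"
  assumes f: "bij_betw f J I" and J: "finite J" and c: "\<And>j. j \<in> J \<Longrightarrow> c j \<noteq> 0"
    and g: "g \<in> borel_measurable (lborel_on J)"
  shows "(LINT x|lborel_on J. g x)
    = of_real (\<Prod>j\<in>J. \<bar>c j\<bar>) * (LINT y|lborel_on I. g (\<lambda>j\<in>J. d j + c j * y (f j)))"
proof -
  let ?P = "lborel_on I" and ?Q = "lborel_on J" and ?T = "\<lambda>y. \<lambda>j\<in>J. d j + c j * y (f j)"
  have T: "?T \<in> measurable ?P ?Q"
    by (rule measurable_affine_reindex) (use bij_betwE[OF f] in blast)
  have "(\<Prod>j\<in>J. ennreal \<bar>c j\<bar>) = ennreal (\<Prod>j\<in>J. \<bar>c j\<bar>)" by (rule prod_ennreal) auto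
  then have "(LINT x|?Q. g x) = (LINT x|density (distr ?P ?Q ?T) (\<lambda>_. ennreal (\<Prod>j\<in>J. \<bar>c j\<bar>)). g x)"
    using lborel_on_affine[OF f J, of c d] c by simp
  also have "\<dots> = (LINT x|distr ?P ?Q ?T. (\<Prod>j\<in>J. \<bar>c j\<bar>) *\<^sub>R g x)"
    using g by (subst integral_density) (auto intro!: prod_nonneg)
  also have "\<dots> = of_real (\<Prod>j\<in>J. \<bar>c j\<bar>) * (LINT y|?P. g (?T y))"
    using g T by (simp add: scaleR_conv_of_real integral_distr)
  finally show ?thesis .
qed

lemma integrable_lborel_on_bound:
  fixes f :: "('i \<Rightarrow> real) \<Rightarrow> 'a :: {banach, second_countable_topology}" and C :: real
  assumes "finite I" "f \<in> borel_measurable (lborel_on I)" and \<phi>: "\<And>i. i \<in> I \<Longrightarrow> integrable lborel (\<phi> i)"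
    and bound: "\<And>y. norm (f y) \<le> C * (\<Prod>i\<in>I. \<phi> i (y i))"
  shows "integrable (lborel_on I) f"
proof (rule Bochner_Integration.integrable_bound)
  show "integrable (lborel_on I) (\<lambda>y. C * (\<Prod>i\<in>I. \<phi> i (y i)))"
    using assms(1) \<phi> by (intro integrable_mult_right lborel_product.product_integrable_prod)
  show "AE y in lborel_on I. norm (f y) \<le> norm (C * (\<Prod>i\<in>I. \<phi> i (y i)))"
    by (rule AE_I2) (rule order_trans[OF bound], simp)
qed (rule assms(2))

definition depends_only_on :: "'i set \<Rightarrow> (('i \<Rightarrow> 'a) \<Rightarrow> 'b) \<Rightarrow> bool" where
  "depends_only_on J f \<longleftrightarrow> (\<forall>x y. (\<forall>i\<in>J. x i = y i) \<longrightarrow> f x = f y)"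

lemma depends_only_onD: "depends_only_on J f \<Longrightarrow> (\<And>i. i \<in> J \<Longrightarrow> x i = y i) \<Longrightarrow> f x = f y"
  by (auto simp: depends_only_on_def)

lemma measurable_depends_only_on:
  assumes "f \<in> measurable (PiM J M) N" "J \<subseteq> I" "depends_only_on J f"
  shows "f \<in> measurable (PiM I M) N"
proof -
  have "(\<lambda>x. f (restrict x J)) \<in> measurable (PiM I M) N"
    by (rule measurable_compose[OF measurable_restrict_subset[OF assms(2)] assms(1)])
  moreover have "(\<lambda>x. f (restrict x J)) = f"
    by (rule ext, rule depends_only_onD[OF assms(3)]) simp
  ultimately show ?thesis by simp
qed

lemma integrable_lborel_on_insert:
  fixes f :: "('i \<Rightarrow> real) \<Rightarrow> 'a :: {banach, second_countable_topology}" and G :: "('i \<Rightarrow> real) \<Rightarrow> real"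
  assumes "finite I" "i \<notin> I" and f: "f \<in> borel_measurable (lborel_on (insert i I))"
    and G: "integrable (lborel_on I) G"
    and bound: "\<And>x. (\<integral>\<^sup>+y. ennreal (norm (f (x(i := y)))) \<partial>lborel) \<le> ennreal (G x)"
  shows "integrable (lborel_on (insert i I)) f"
proof (rule integrableI_bounded)
  have "(\<integral>\<^sup>+t. ennreal (norm (f t)) \<partial>lborel_on (insert i I))
      = (\<integral>\<^sup>+x. \<integral>\<^sup>+y. ennreal (norm (f (x(i := y)))) \<partial>lborel \<partial>lborel_on I)"
    using assms(1,2) f by (intro lborel_product.product_nn_integral_insert) auto
  also have "\<dots> \<le> (\<integral>\<^sup>+x. ennreal (norm (G x)) \<partial>lborel_on I)"
    by (intro nn_integral_mono order_trans[OF bound] ennreal_leI) simp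
  also have "\<dots> < \<infinity>" using G by (simp add: integrable_iff_bounded)
  finally show "(\<integral>\<^sup>+t. ennreal (norm (f t)) \<partial>lborel_on (insert i I)) < \<infinity>" .
qed (rule f)

lemma integral_lborel_on_insert_rev:
  fixes f :: "('i \<Rightarrow> real) \<Rightarrow> 'a :: {banach, second_countable_topology}"
  assumes I: "finite I" "i \<notin> I" and f: "integrable (lborel_on (insert i I)) f"
  shows "(LINT x|lborel_on (insert i I). f x) = (LINT y|lborel. LINT x|lborel_on I. f (x(i := y)))"
proof -
  have merge_eq: "merge {i} I (x, y) = y(i := x i)" if "y \<in> space (lborel_on I)" for x y :: "'i \<Rightarrow> real"
    using that I by (auto simp: merge_def fun_eq_iff space_PiM PiE_def extensional_def)
  have update: "(\<lambda>(y, x). x(i := y)) \<in> measurable (lborel \<Otimes>\<^sub>M lborel_on I) (lborel_on (insert i I))"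
    using measurable_compose[OF measurable_pair_swap' measurable_add_dim[of i I "\<lambda>_. lborel"]]
    by (simp add: case_prod_beta)
  have "(\<lambda>(y, x). f (x(i := y))) \<in> borel_measurable (lborel \<Otimes>\<^sub>M lborel_on I)"
    using measurable_compose[OF update borel_measurable_integrable[OF f]] by (simp add: case_prod_beta)
  then have inner: "(\<lambda>y. LINT x|lborel_on I. f (x(i := y))) \<in> borel_measurable lborel"
    by (rule sigma_finite_measure.borel_measurable_lebesgue_integral[OF lborel_product.sigma_finite[OF I(1)]])
  have "(LINT x|lborel_on (insert i I). f x) = (LINT x|lborel_on {i}. LINT y|lborel_on I. f (merge {i} I (x, y)))"
    using lborel_product.product_integral_fold[of "{i}" I f] I f by simp
  also have "\<dots> = (LINT x|lborel_on {i}. LINT y|lborel_on I. f (y(i := x i)))"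
    by (intro Bochner_Integration.integral_cong refl) (simp only: merge_eq)
  also have "\<dots> = (LINT y|lborel. LINT x|lborel_on I. f (x(i := y)))"
    by (rule lborel_product.product_integral_singleton[OF inner])
  finally show ?thesis .
qed

lemma tendsto_integral_mult_bounded:
  fixes F :: "'a \<Rightarrow> 'b :: {real_normed_field, banach, second_countable_topology}"
  assumes F: "integrable M F" and meas: "\<And>k. c k \<in> borel_measurable M"
    and bounded: "\<And>k x. F x \<noteq> 0 \<Longrightarrow> norm (c k x) \<le> C" and lim: "\<And>x. F x \<noteq> 0 \<Longrightarrow> (\<lambda>k. c k x) \<longlonglongrightarrow> c'"
  shows "(\<lambda>k. LINT x|M. c k x * F x) \<longlonglongrightarrow> c' * (LINT x|M. F x)"
proof -
  have "(\<lambda>k. LINT x|M. c k x * F x) \<longlonglongrightarrow> (LINT x|M. c' * F x)"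
  proof (rule integral_dominated_convergence)
    show "integrable M (\<lambda>x. C * norm (F x))" by (intro integrable_mult_right integrable_norm F)
    show "AE x in M. (\<lambda>k. c k x * F x) \<longlonglongrightarrow> c' * F x"
    proof (rule AE_I2)
      show "(\<lambda>k. c k x * F x) \<longlonglongrightarrow> c' * F x" for x
        using lim[of x] by (cases "F x = 0") (auto intro!: tendsto_intros)
    qed
    show "AE x in M. norm (c k x * F x) \<le> C * norm (F x)" for k
    proof (rule AE_I2)
      show "norm (c k x * F x) \<le> C * norm (F x)" for x
        using bounded[of x k] by (cases "F x = 0") (auto simp: norm_mult intro!: mult_right_mono)
    qed
  qed (use F meas in auto)
  then show ?thesis by simp
qed

lemma integrable_prod_blocks:
  fixes f :: "'s \<Rightarrow> ('i \<Rightarrow> real) \<Rightarrow> complex"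
  assumes "finite S" "disjoint_family_on I S" "\<And>s. s \<in> S \<Longrightarrow> finite (I s)"
    and meas: "\<And>s. s \<in> S \<Longrightarrow> f s \<in> borel_measurable (lborel_on (I s))"
    and local: "\<And>s. s \<in> S \<Longrightarrow> depends_only_on (I s) (f s)"
    and int: "\<And>i. i \<in> (\<Union>s\<in>S. I s) \<Longrightarrow> integrable lborel (\<phi> i)"
    and bound: "\<And>s y. s \<in> S \<Longrightarrow> norm (f s y) \<le> (\<Prod>i\<in>I s. \<phi> i (y i))"
  shows "integrable (lborel_on (\<Union>s\<in>S. I s)) (\<lambda>y. \<Prod>s\<in>S. f s y)"
proof (rule integrable_lborel_on_bound)
  have "(\<Prod>i\<in>(\<Union>s\<in>S. I s). \<phi> i (y i)) = (\<Prod>s\<in>S. \<Prod>i\<in>I s. \<phi> i (y i))" for y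
    using assms(1-3) by (intro prod.UNION_disjoint_family) auto
  then show "norm (\<Prod>s\<in>S. f s y) \<le> 1 * (\<Prod>i\<in>(\<Union>s\<in>S. I s). \<phi> i (y i))" for y
    by (simp only: mult_1 prod_norm[symmetric]) (intro prod_mono conjI bound norm_ge_zero)
  have "f s \<in> borel_measurable (lborel_on (\<Union>s\<in>S. I s))" if "s \<in> S" for s
    by (rule measurable_depends_only_on[OF meas[OF that] _ local[OF that]]) (use that in auto)
  then show "(\<lambda>y. \<Prod>s\<in>S. f s y) \<in> borel_measurable (lborel_on (\<Union>s\<in>S. I s))"
    by (rule borel_measurable_prod)
qed (use assms(1,3) int in auto)

lemma integral_prod_blocks:
  fixes f :: "'s \<Rightarrow> ('i \<Rightarrow> real) \<Rightarrow> complex"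
  assumes "finite S" "disjoint_family_on I S" "\<And>s. s \<in> S \<Longrightarrow> finite (I s)"
    and "\<And>s. s \<in> S \<Longrightarrow> f s \<in> borel_measurable (lborel_on (I s))"
    and "\<And>s. s \<in> S \<Longrightarrow> depends_only_on (I s) (f s)"
    and "\<And>i. i \<in> (\<Union>s\<in>S. I s) \<Longrightarrow> integrable lborel (\<phi> i)"
    and "\<And>s y. s \<in> S \<Longrightarrow> norm (f s y) \<le> (\<Prod>i\<in>I s. \<phi> i (y i))"
  shows "(LINT y|lborel_on (\<Union>s\<in>S. I s). (\<Prod>s\<in>S. f s y)) = (\<Prod>s\<in>S. LINT y|lborel_on (I s). f s y)"
  using assms
proof (induction S rule: finite_induct)
  case empty
  show ?case using lborel_product.product_integral_prod[of "{}" "\<lambda>_ _. 1 :: complex"] by simp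
next
  case (insert s S)
  let ?U = "\<Union>s\<in>S. I s"
  have disjoint: "I s \<inter> ?U = {}"
    using insert.hyps insert.prems(1) by (auto simp: disjoint_family_on_def)
  have "integrable (lborel_on (I s \<union> ?U)) (\<lambda>y. \<Prod>s\<in>insert s S. f s y)"
    using integrable_prod_blocks[of "insert s S" I f \<phi>] insert.hyps(1) insert.prems by simp
  then have "(LINT y|lborel_on (I s \<union> ?U). (\<Prod>s\<in>insert s S. f s y))
      = (LINT x|lborel_on (I s). LINT y|lborel_on ?U. (\<Prod>s'\<in>insert s S. f s' (merge (I s) ?U (x, y))))"
    using insert.hyps insert.prems(2)
    by (intro lborel_product.product_integral_fold[OF disjoint]) (auto simp del: prod.insert)
  moreover have "(\<Prod>s'\<in>insert s S. f s' (merge (I s) ?U (x, y))) = f s x * (\<Prod>s'\<in>S. f s' y)" for x y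
  proof -
    have "f s (merge (I s) ?U (x, y)) = f s x"
      by (rule depends_only_onD[of "I s"]) (use insert.prems(4) in \<open>simp_all add: merge_def\<close>)
    moreover have "f s' (merge (I s) ?U (x, y)) = f s' y" if "s' \<in> S" for s'
      by (rule depends_only_onD[of "I s'"]) (use insert.prems(4) disjoint that in \<open>auto simp: merge_def\<close>)
    ultimately show ?thesis using insert.hyps by simp
  qed
  moreover have "(LINT y|lborel_on ?U. (\<Prod>s\<in>S. f s y)) = (\<Prod>s\<in>S. LINT y|lborel_on (I s). f s y)"
    using insert.prems by (intro insert.IH) (auto simp: disjoint_family_on_def)
  ultimately show ?case using insert.hyps by simp
qed

section \<open>Ordered integrands with a Vandermonde factor\<close>

definition vandermonde :: "'i :: linorder set \<Rightarrow> complex \<Rightarrow> ('i \<Rightarrow> real) \<Rightarrow> complex" where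
  "vandermonde I \<gamma> t = (\<Prod>(i, j)\<in>ordered_pairs I. abs_powr (t j - t i) (2 * \<gamma>))"

lemma vandermonde_empty [simp]: "vandermonde {} \<gamma> t = 1"
  by (simp add: vandermonde_def ordered_pairs_def)

lemma vandermonde_insert:
  "finite I \<Longrightarrow> a \<notin> I \<Longrightarrow> vandermonde (insert a I) \<gamma> t = (\<Prod>j\<in>I. abs_powr (t a - t j) (2 * \<gamma>)) * vandermonde I \<gamma> t"
  unfolding vandermonde_def
  using prod_ordered_pairs_insert[of I a "\<lambda>i j. abs_powr (t j - t i) (2 * \<gamma>)"]
  by (simp add: abs_powr_minus_commute[of "t a"] abs_powr_minus_commute)

lemma vandermonde_cong: "(\<And>i. i \<in> I \<Longrightarrow> t i = u i) \<Longrightarrow> vandermonde I \<gamma> t = vandermonde I \<gamma> u"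
  unfolding vandermonde_def by (intro prod.cong) (auto simp: ordered_pairs_def)

lemma vandermonde_reindex:
  assumes "finite J" "inj_on f J"
  shows "vandermonde (f ` J) \<gamma> t = vandermonde J \<gamma> (t \<circ> f)"
  using assms
proof (induction J rule: finite_induct)
  case (insert a J)
  then show ?case by (simp add: vandermonde_insert prod.reindex)
qed simp

lemma vandermonde_affine:
  assumes "finite I"
  shows "vandermonde I \<gamma> (\<lambda>i. d + c * t i) = abs_powr c (2 * \<gamma>) ^ (card I choose 2) * vandermonde I \<gamma> t"
proof -
  have "abs_powr (d + c * t j - (d + c * t i)) (2 * \<gamma>) = abs_powr c (2 * \<gamma>) * abs_powr (t j - t i) (2 * \<gamma>)" for i j
    by (simp add: abs_powr_mult right_diff_distrib flip: abs_powr_mult)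
  then show ?thesis
    using assms by (simp add: vandermonde_def prod.distrib case_prod_beta card_ordered_pairs)
qed

lemma measurable_vandermonde [measurable]:
  assumes "I \<subseteq> J"
  shows "vandermonde I \<gamma> \<in> borel_measurable (lborel_on J)"
  unfolding vandermonde_def case_prod_beta
proof (rule borel_measurable_prod)
  fix x assume "x \<in> ordered_pairs I"
  then have [measurable]: "(\<lambda>t. t (fst x)) \<in> borel_measurable (lborel_on J)"
    "(\<lambda>t. t (snd x)) \<in> borel_measurable (lborel_on J)"
    using assms by (auto simp: ordered_pairs_def intro!: measurable_lborel_component)
  show "(\<lambda>t. abs_powr (t (snd x) - t (fst x)) (2 * \<gamma>)) \<in> borel_measurable (lborel_on J)" by measurable
qed

lemma norm_vandermonde_le:
  assumes "finite I" "B \<ge> 0" "\<And>i j. i \<in> I \<Longrightarrow> j \<in> I \<Longrightarrow> norm (abs_powr (t j - t i) (2 * \<gamma>)) \<le> B"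
  shows "norm (vandermonde I \<gamma> t) \<le> B ^ (card I choose 2)"
proof -
  have "norm (vandermonde I \<gamma> t) \<le> (\<Prod>x\<in>ordered_pairs I. B)"
    unfolding vandermonde_def prod_norm[symmetric] using assms by (intro prod_mono) (auto simp: ordered_pairs_def)
  then show ?thesis using assms(1) by (simp add: card_ordered_pairs)
qed

definition ordered_integrand :: "'i :: linorder set \<Rightarrow> (real \<Rightarrow> complex) \<Rightarrow> complex \<Rightarrow> ('i \<Rightarrow> real) \<Rightarrow> complex" where
  "ordered_integrand I \<phi> \<gamma> y = (if mono_on I y then (\<Prod>i\<in>I. \<phi> (y i)) * vandermonde I \<gamma> y else 0)"

lemma mono_on_cong: "(\<And>i. i \<in> I \<Longrightarrow> x i = y i) \<Longrightarrow> mono_on I x \<longleftrightarrow> mono_on I y"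
  by (auto simp: mono_on_def)

lemma ordered_integrand_cong:
  assumes "\<And>i. i \<in> I \<Longrightarrow> x i = y i" "\<And>i. i \<in> I \<Longrightarrow> \<phi> (y i) = \<psi> (y i)"
  shows "ordered_integrand I \<phi> \<gamma> x = ordered_integrand I \<psi> \<gamma> y"
  unfolding ordered_integrand_def
  using assms mono_on_cong[of I x y] vandermonde_cong[of I x y \<gamma>] by simp

lemma depends_only_on_ordered_integrand: "depends_only_on I (ordered_integrand I \<phi> \<gamma>)"
  unfolding depends_only_on_def by (auto intro: ordered_integrand_cong)

lemma pred_mono_on [measurable]:
  fixes I :: "'i :: linorder set"
  assumes "finite I"
  shows "Measurable.pred (lborel_on I) (mono_on I)"
proof -
  have le: "Measurable.pred (lborel_on I) (\<lambda>y. i \<le> j \<longrightarrow> y i \<le> y j)" if "i \<in> I" "j \<in> I" for i j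
  proof -
    have "Measurable.pred (lborel_on I) (\<lambda>y. y i \<le> y j)"
      unfolding pred_def using that by (intro borel_measurable_le measurable_lborel_component)
    then show ?thesis by (cases "i \<le> j") simp_all
  qed
  have "mono_on I = (\<lambda>y. \<forall>i\<in>I. \<forall>j\<in>I. i \<le> j \<longrightarrow> y i \<le> (y j :: real))"
    by (auto simp: mono_on_def fun_eq_iff)
  then show ?thesis using assms le by (auto intro!: pred_intros_finite)
qed

lemma measurable_ordered_integrand [measurable]:
  assumes "finite I" and [measurable]: "\<phi> \<in> borel_measurable borel"
  shows "ordered_integrand I \<phi> \<gamma> \<in> borel_measurable (lborel_on I)"
proof -
  have "(\<lambda>y. \<Prod>i\<in>I. \<phi> (y i)) \<in> borel_measurable (lborel_on I)"
    by (intro borel_measurable_prod measurable_compose[OF measurable_lborel_component assms(2)])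
  then have "(\<lambda>y. (\<Prod>i\<in>I. \<phi> (y i)) * vandermonde I \<gamma> y) \<in> borel_measurable (lborel_on I)"
    by (intro borel_measurable_times measurable_vandermonde) auto
  then show ?thesis unfolding ordered_integrand_def
    using pred_mono_on[OF assms(1)] by (intro measurable_If) (auto simp: pred_def)
qed

lemma mono_on_reindex:
  fixes f :: "'j :: linorder \<Rightarrow> 'i :: linorder" and y :: "'i \<Rightarrow> 'a :: preorder"
  assumes "strict_mono_on J f"
  shows "mono_on (f ` J) y \<longleftrightarrow> mono_on J (y \<circ> f)"
  using strict_mono_on_leD[OF assms] strict_mono_on_less_eq[OF assms] by (auto simp: mono_on_def)

lemma ordered_integrand_reindex:
  assumes "finite J" "strict_mono_on J f"
  shows "ordered_integrand (f ` J) \<phi> \<gamma> y = ordered_integrand J \<phi> \<gamma> (y \<circ> f)"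
proof -
  have "inj_on f J" using assms(2) by (rule strict_mono_on_imp_inj_on)
  then show ?thesis
    unfolding ordered_integrand_def
    by (simp add: mono_on_reindex[OF assms(2)] vandermonde_reindex[OF assms(1)] prod.reindex)
qed

lemma integral_ordered_integrand_reindex:
  assumes J: "finite J" and f: "strict_mono_on J f" and \<phi>: "\<phi> \<in> borel_measurable borel"
  shows "(LINT y|lborel_on (f ` J). ordered_integrand (f ` J) \<phi> \<gamma> y)
      = (LINT y|lborel_on J. ordered_integrand J \<phi> \<gamma> y)"
proof -
  have "bij_betw f J (f ` J)"
    using strict_mono_on_imp_inj_on[OF f] by (simp add: bij_betw_def)
  then have "(LINT y|lborel_on J. ordered_integrand J \<phi> \<gamma> y)
      = of_real (\<Prod>j\<in>J. \<bar>1\<bar>) * (LINT y|lborel_on (f ` J). ordered_integrand J \<phi> \<gamma> (\<lambda>j\<in>J. 0 + 1 * y (f j)))"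
    using J \<phi> by (intro integral_lborel_on_affine measurable_ordered_integrand) auto
  also have "(\<lambda>y. ordered_integrand J \<phi> \<gamma> (\<lambda>j\<in>J. 0 + 1 * y (f j))) = ordered_integrand (f ` J) \<phi> \<gamma>"
    unfolding ordered_integrand_reindex[OF J f] by (intro ext ordered_integrand_cong) auto
  finally show ?thesis by simp
qed

lemma bij_betw_reverse: "bij_betw (\<lambda>i. n + 1 - i) {1..n} {1..n::nat}"
  by (rule bij_betw_byWitness[where f'="\<lambda>i. n + 1 - i"]) auto

lemma ordered_integrand_reflect:
  "ordered_integrand {1..n::nat} \<phi> \<gamma> (\<lambda>i. c - y (n + 1 - i)) = ordered_integrand {1..n} (\<lambda>x. \<phi> (c - x)) \<gamma> y"
proof -
  have "mono_on {1..n} (\<lambda>i. c - y (n + 1 - i)) \<longleftrightarrow> mono_on {1..n} y"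
  proof
    assume y: "mono_on {1..n} (\<lambda>i. c - y (n + 1 - i))"
    show "mono_on {1..n} y"
    proof (rule mono_onI)
      fix i j assume "i \<in> {1..n}" "j \<in> {1..n}" "i \<le> j"
      then show "y i \<le> y j" using mono_onD[OF y, of "n + 1 - j" "n + 1 - i"] by simp
    qed
  next
    assume "mono_on {1..n} y"
    then show "mono_on {1..n} (\<lambda>i. c - y (n + 1 - i))"
      by (intro mono_onI diff_left_mono) (erule mono_onD, auto)
  qed
  moreover have "vandermonde {1..n} \<gamma> (\<lambda>i. c - y (n + 1 - i)) = vandermonde {1..n} \<gamma> y"
    using vandermonde_affine[of "{1..n}" \<gamma> c "-1" "\<lambda>i. y (n + 1 - i)"]
      vandermonde_reindex[of "{1..n}" "\<lambda>i. n + 1 - i" \<gamma> y] bij_betw_reverse[of n] by (simp add: bij_betw_def o_def)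
  moreover have "(\<Prod>i=1..n. \<phi> (c - y (n + 1 - i))) = (\<Prod>i=1..n. \<phi> (c - y i))"
    by (rule prod.reindex_bij_betw[OF bij_betw_reverse])
  ultimately show ?thesis by (simp add: ordered_integrand_def)
qed

lemma integral_ordered_integrand_reflect:
  assumes "\<phi> \<in> borel_measurable borel"
  shows "(LINT y|lborel_on {1..n}. ordered_integrand {1..n} (\<lambda>x. \<phi> (c - x)) \<gamma> y)
    = (LINT y|lborel_on {1..n::nat}. ordered_integrand {1..n} \<phi> \<gamma> y)"
proof -
  have "(LINT y|lborel_on {1..n}. ordered_integrand {1..n} \<phi> \<gamma> y)
      = of_real (\<Prod>i=1..n. \<bar>-1\<bar>)
        * (LINT y|lborel_on {1..n}. ordered_integrand {1..n} \<phi> \<gamma> (\<lambda>i\<in>{1..n}. c + (-1) * y (n + 1 - i)))"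
    using assms by (intro integral_lborel_on_affine[OF bij_betw_reverse] measurable_ordered_integrand) auto
  also have "(\<lambda>y. ordered_integrand {1..n} \<phi> \<gamma> (\<lambda>i\<in>{1..n}. c + (-1) * y (n + 1 - i)))
      = (\<lambda>y. ordered_integrand {1..n} (\<lambda>x. \<phi> (c - x)) \<gamma> y)"
    unfolding ordered_integrand_reflect[symmetric] by (intro ext ordered_integrand_cong) auto
  finally show ?thesis by simp
qed

lemma mono_on_translate: "mono_on I (\<lambda>i. u + w i :: 'a :: ordered_ab_semigroup_add_imp_le) \<longleftrightarrow> mono_on I w"
  by (simp add: mono_on_def)

lemma ordered_integrand_translate:
  "finite I \<Longrightarrow> ordered_integrand I \<phi> \<gamma> (\<lambda>i. u + w i) = ordered_integrand I (\<lambda>x. \<phi> (u + x)) \<gamma> w"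
  using vandermonde_affine[of I \<gamma> u 1 w] mono_on_translate[of I u w] by (simp add: ordered_integrand_def)

lemma integral_ordered_integrand_translate:
  assumes "finite I" "\<phi> \<in> borel_measurable borel"
  shows "(LINT y|lborel_on I. ordered_integrand I \<phi> \<gamma> y)
      = (LINT y|lborel_on I. ordered_integrand I (\<lambda>x. \<phi> (u + x)) \<gamma> y)"
proof -
  have "(LINT y|lborel_on I. ordered_integrand I \<phi> \<gamma> y)
      = of_real (\<Prod>i\<in>I. \<bar>1\<bar>) * (LINT y|lborel_on I. ordered_integrand I \<phi> \<gamma> (\<lambda>i\<in>I. u + 1 * y i))"
    using assms by (intro integral_lborel_on_affine measurable_ordered_integrand) (auto simp: bij_betw_def)
  also have "(\<lambda>y. ordered_integrand I \<phi> \<gamma> (\<lambda>i\<in>I. u + 1 * y i)) = (\<lambda>y. ordered_integrand I (\<lambda>x. \<phi> (u + x)) \<gamma> y)"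
    unfolding ordered_integrand_translate[OF assms(1), symmetric] by (intro ext ordered_integrand_cong) auto
  finally show ?thesis by simp
qed

lemma ordered_integrand_scale: "ordered_integrand I (\<lambda>x. c * \<phi> x) \<gamma> y = c ^ card I * ordered_integrand I \<phi> \<gamma> y"
  by (simp add: ordered_integrand_def prod.distrib)

lemma ordered_integrand_insert_least:
  assumes "finite J" and least: "\<And>j. j \<in> J \<Longrightarrow> a < j"
  shows "ordered_integrand (insert a J) \<phi> \<gamma> y
    = \<phi> (y a) * ordered_integrand J (\<lambda>x. if y a \<le> x then \<phi> x * abs_powr (x - y a) (2 * \<gamma>) else 0) \<gamma> y"
proof -
  have "a \<notin> J" using least by blast
  have mono: "mono_on (insert a J) y \<longleftrightarrow> (\<forall>j\<in>J. y a \<le> y j) \<and> mono_on J y"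
    using least by (auto simp: mono_on_def) (metis less_imp_le leD)+
  show ?thesis
  proof (cases "\<forall>j\<in>J. y a \<le> y j")
    case True
    have "(\<Prod>j\<in>J. if y a \<le> y j then \<phi> (y j) * abs_powr (y j - y a) (2 * \<gamma>) else 0)
        = (\<Prod>j\<in>J. \<phi> (y j) * abs_powr (y j - y a) (2 * \<gamma>))"
      using True by (intro prod.cong) auto
    then show ?thesis
      using True \<open>a \<notin> J\<close> assms(1)
      by (simp add: ordered_integrand_def mono vandermonde_insert prod.distrib abs_powr_minus_commute[of "y a"])
  next
    case False
    then have "(\<Prod>j\<in>J. if y a \<le> y j then \<phi> (y j) * abs_powr (y j - y a) (2 * \<gamma>) else 0) = 0"
      using assms(1) by (intro prod_zero) auto
    then show ?thesis unfolding ordered_integrand_def mono using False by auto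
  qed
qed

section \<open>Laguerre--Selberg integrals\<close>

definition laguerre_density :: "complex \<Rightarrow> real \<Rightarrow> complex" where
  "laguerre_density a x = (if 0 \<le> x then abs_powr x (a - 1) * of_real (exp (- x)) else 0)"

definition laguerre_integral :: "nat \<Rightarrow> complex \<Rightarrow> complex \<Rightarrow> complex" where
  "laguerre_integral n a \<gamma> = (LINT y|lborel_on {1..n}. ordered_integrand {1..n} (laguerre_density a) \<gamma> y)"

lemma measurable_laguerre_density [measurable]: "laguerre_density a \<in> borel_measurable borel"
  unfolding laguerre_density_def[abs_def] by measurable

lemma norm_laguerre_density: "norm (laguerre_density a x) = gamma_majorant (Re a) 0 x"
  by (auto simp: laguerre_density_def gamma_majorant_def norm_mult norm_abs_powr)

lemma norm_vandermonde_le_prod: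
  assumes I: "finite I" and y: "\<And>i. i \<in> I \<Longrightarrow> y i \<ge> 0" and \<gamma>: "Re \<gamma> \<ge> 0"
  shows "norm (vandermonde I \<gamma> y) \<le> (\<Prod>i\<in>I. (1 + y i) powr (2 * Re \<gamma> * real (card I choose 2)))"
proof -
  define P where "P = (\<Prod>i\<in>I. 1 + y i)"
  have P: "P \<ge> 1" unfolding P_def using y by (intro prod_ge_1) auto
  have "1 + y i \<le> P" if "i \<in> I" for i
  proof -
    have "1 \<le> (\<Prod>k\<in>I - {i}. 1 + y k)" using y by (intro prod_ge_1) auto
    then have "(1 + y i) * 1 \<le> (1 + y i) * (\<Prod>k\<in>I - {i}. 1 + y k)" using y[OF that] by (intro mult_left_mono) auto
    then show ?thesis unfolding P_def using I that by (simp add: prod.remove[of I i])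
  qed
  then have "\<bar>y j - y i\<bar> \<le> P" if "i \<in> I" "j \<in> I" for i j
    using that y[of i] y[of j] by (smt (verit))
  then have "norm (vandermonde I \<gamma> y) \<le> (P powr (2 * Re \<gamma>)) ^ (card I choose 2)"
    using I \<gamma> by (intro norm_vandermonde_le) (auto simp: norm_abs_powr intro!: powr_mono2)
  also have "\<dots> = P powr (2 * Re \<gamma> * real (card I choose 2))"
    using P by (simp add: powr_powr flip: powr_realpow)
  also have "\<dots> = (\<Prod>i\<in>I. (1 + y i) powr (2 * Re \<gamma> * real (card I choose 2)))"
    unfolding P_def by (rule prod_powr_distrib)
  finally show ?thesis .
qed

lemma norm_laguerre_integrand_le:
  assumes I: "finite I" and \<gamma>: "Re \<gamma> \<ge> 0"
  shows "norm (ordered_integrand I (laguerre_density a) \<gamma> y)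
    \<le> (\<Prod>i\<in>I. gamma_majorant (Re a) (2 * Re \<gamma> * real (card I choose 2)) (y i))"
proof (cases "\<forall>i\<in>I. y i \<ge> 0")
  case True
  have "norm (ordered_integrand I (laguerre_density a) \<gamma> y)
      \<le> (\<Prod>i\<in>I. gamma_majorant (Re a) 0 (y i)) * norm (vandermonde I \<gamma> y)"
    by (auto simp: ordered_integrand_def norm_mult norm_laguerre_density gamma_majorant_nonneg simp flip: prod_norm
        intro!: mult_nonneg_nonneg prod_nonneg)
  also have "\<dots> \<le> (\<Prod>i\<in>I. gamma_majorant (Re a) 0 (y i))
      * (\<Prod>i\<in>I. (1 + y i) powr (2 * Re \<gamma> * real (card I choose 2)))"
    using I True \<gamma> by (intro mult_left_mono norm_vandermonde_le_prod prod_nonneg)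
      (auto simp: gamma_majorant_nonneg)
  also have "\<dots> = (\<Prod>i\<in>I. gamma_majorant (Re a) (2 * Re \<gamma> * real (card I choose 2)) (y i))"
    unfolding prod.distrib[symmetric] using True by (intro prod.cong) (auto simp: gamma_majorant_mult)
  finally show ?thesis .
next
  case False
  then have "(\<Prod>i\<in>I. laguerre_density a (y i)) = 0"
    using I by (intro prod_zero) (auto simp: laguerre_density_def)
  then show ?thesis
    by (auto simp: ordered_integrand_def gamma_majorant_nonneg intro!: prod_nonneg)
qed

lemma integrable_laguerre_integrand:
  assumes "finite I" "Re a > 0" "Re \<gamma> \<ge> 0"
  shows "integrable (lborel_on I) (ordered_integrand I (laguerre_density a) \<gamma>)"
  using assms norm_laguerre_integrand_le[of I \<gamma> a]
  by (intro integrable_lborel_on_bound[where C=1 and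
    \<phi>="\<lambda>_. gamma_majorant (Re a) (2 * Re \<gamma> * real (card I choose 2))"]
      integrable_gamma_majorant) auto

lemma integral_exp_half_line:
  assumes "c > 0"
  shows "(LINT u|lborel. (if 0 < u then of_real (exp (- c * u)) else 0)) = (of_real (1 / c) :: complex)"
proof -
  have "((\<lambda>u. if u \<in> {0..} then exp (- c * u) else 0) has_integral (exp (- c * 0) / c)) UNIV"
    unfolding has_integral_restrict_UNIV by (rule has_integral_exp_minus_to_infinity[OF assms])
  then have "has_bochner_integral lborel (\<lambda>u. if u \<in> {0..} then exp (- c * u) else 0) (1 / c)"
    by (intro has_bochner_integral_nn_integral nn_integral_has_integral_lborel) (use assms in auto)
  then have "(LINT u|lborel. of_real (if u \<in> {0..} then exp (- c * u) else 0)) = (of_real (1 / c) :: complex)"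
    by (intro has_bochner_integral_integral_eq has_bochner_integral_of_real)
  moreover have "(LINT u|lborel. (if 0 < u then of_real (exp (- c * u)) else 0))
      = (LINT u|lborel. of_real (if u \<in> {0..} then exp (- c * u) else 0) :: complex)"
  proof (rule integral_cong_AE)
    show "AE u in lborel. (if 0 < u then of_real (exp (- c * u)) else 0)
        = (of_real (if u \<in> {0..} then exp (- c * u) else 0) :: complex)"
      using AE_lborel_singleton[of 0] by eventually_elim auto
  qed measurable
  ultimately show ?thesis by simp
qed

text \<open>Translating by the least variable \<open>u\<close> turns the density \<open>exp (- x)\<close> into \<open>exp (- u) * exp (- x)\<close>.\<close>

lemma laguerre_integrand_insert_least:
  assumes u: "u > 0"
  shows "(LINT x|lborel_on {2..Suc n}. ordered_integrand {1..Suc n} (laguerre_density 1) \<gamma> (x(1 := u)))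
    = of_real (exp (- real (Suc n) * u)) * laguerre_integral n (1 + 2 * \<gamma>) \<gamma>"
proof -
  let ?J = "{2..Suc n}"
  define \<psi> where "\<psi> x = (if u \<le> x then laguerre_density 1 x * abs_powr (x - u) (2 * \<gamma>) else 0)" for x
  have [measurable]: "\<psi> \<in> borel_measurable borel"
    unfolding \<psi>_def[abs_def] by measurable
  have "insert 1 ?J = {1..Suc n}" by auto
  moreover have "ordered_integrand (insert 1 ?J) (laguerre_density 1) \<gamma> (x(1 := u))
      = laguerre_density 1 u * ordered_integrand ?J \<psi> \<gamma> (x(1 := u))" for x
    using ordered_integrand_insert_least[of ?J 1 "laguerre_density 1" \<gamma> "x(1 := u)"]
    by (simp add: \<psi>_def[abs_def] del: One_nat_def cong: if_cong)
  moreover have "ordered_integrand ?J \<psi> \<gamma> (x(1 := u)) = ordered_integrand ?J \<psi> \<gamma> x" for x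
    by (rule ordered_integrand_cong) auto
  ultimately have "(LINT x|lborel_on ?J. ordered_integrand {1..Suc n} (laguerre_density 1) \<gamma> (x(1 := u)))
      = laguerre_density 1 u * (LINT x|lborel_on ?J. ordered_integrand ?J \<psi> \<gamma> x)" by simp
  also have "(LINT x|lborel_on ?J. ordered_integrand ?J \<psi> \<gamma> x)
      = (LINT x|lborel_on ?J. ordered_integrand ?J (\<lambda>w. \<psi> (u + w)) \<gamma> x)"
    by (rule integral_ordered_integrand_translate) auto
  also have "(\<lambda>w. \<psi> (u + w)) = (\<lambda>w. of_real (exp (- u)) * laguerre_density (1 + 2 * \<gamma>) w)"
    using u by (auto simp: \<psi>_def laguerre_density_def fun_eq_iff exp_diff exp_minus field_simps)
  also have "(LINT x|lborel_on ?J. ordered_integrand ?J (\<lambda>w. of_real (exp (- u))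
      * laguerre_density (1 + 2 * \<gamma>) w) \<gamma> x)
      = of_real (exp (- u)) ^ n * (LINT x|lborel_on ?J. ordered_integrand ?J (laguerre_density (1 + 2 * \<gamma>)) \<gamma> x)"
    by (simp add: ordered_integrand_scale)
  also have "(LINT x|lborel_on ?J. ordered_integrand ?J (laguerre_density (1 + 2 * \<gamma>)) \<gamma> x)
      = laguerre_integral n (1 + 2 * \<gamma>) \<gamma>"
    using integral_ordered_integrand_reindex[of "{1..n}" Suc "laguerre_density (1 + 2 * \<gamma>)" \<gamma>]
    by (simp add: strict_mono_on_def laguerre_integral_def image_Suc_atLeastAtMost numeral_2_eq_2)
  also have "laguerre_density 1 u * (of_real (exp (- u)) ^ n * laguerre_integral n (1 + 2 * \<gamma>) \<gamma>)
      = of_real (exp (- u) ^ Suc n) * laguerre_integral n (1 + 2 * \<gamma>) \<gamma>"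
    using u by (simp add: laguerre_density_def)
  also have "exp (- u) ^ Suc n = exp (- real (Suc n) * u)"
    using exp_of_nat_mult[of "Suc n" "- u"] by (simp del: of_nat_Suc)
  finally show ?thesis .
qed

lemma laguerre_integral_Suc_1:
  assumes \<gamma>: "Re \<gamma> > 0"
  shows "laguerre_integral (Suc n) 1 \<gamma> = laguerre_integral n (1 + 2 * \<gamma>) \<gamma> / of_nat (Suc n)"
proof -
  let ?J = "{2..Suc n}" and ?f = "ordered_integrand {1..Suc n} (laguerre_density 1) \<gamma>"
  have insert: "insert 1 ?J = {1..Suc n}" by auto
  have "integrable (lborel_on (insert 1 ?J)) ?f"
    unfolding insert using \<gamma> by (intro integrable_laguerre_integrand) auto
  then have "laguerre_integral (Suc n) 1 \<gamma> = (LINT u|lborel. LINT x|lborel_on ?J. ?f (x(1 := u)))"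
    using integral_lborel_on_insert_rev[of ?J 1 ?f] by (simp add: laguerre_integral_def insert del: One_nat_def)
  also have "(\<lambda>u. LINT x|lborel_on ?J. ?f (x(1 := u)))
      = (\<lambda>u. (if 0 < u then of_real (exp (- real (Suc n) * u)) else 0) * laguerre_integral n (1 + 2 * \<gamma>) \<gamma>)"
  proof
    fix u :: real
    show "(LINT x|lborel_on ?J. ?f (x(1 := u)))
        = (if 0 < u then of_real (exp (- real (Suc n) * u)) else 0) * laguerre_integral n (1 + 2 * \<gamma>) \<gamma>"
    proof (cases "u > 0")
      case True
      then show ?thesis using laguerre_integrand_insert_least[OF True, of n \<gamma>] by (simp only: if_True)
    next
      case False
      then have "laguerre_density 1 u = 0" by (simp add: laguerre_density_def)
      then have "(\<Prod>i=1..Suc n. laguerre_density 1 ((x(1 := u)) i)) = 0" for x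
        by (intro prod_zero) auto
      then have "?f (x(1 := u)) = 0" for x
        unfolding ordered_integrand_def by (simp only: mult_zero_left if_cancel)
      then show ?thesis using False by simp
    qed
  qed
  also have "(LINT u|lborel. (if 0 < u then of_real (exp (- real (Suc n) * u)) else 0)
      * laguerre_integral n (1 + 2 * \<gamma>) \<gamma>)
      = of_real (1 / real (Suc n)) * laguerre_integral n (1 + 2 * \<gamma>) \<gamma>"
    unfolding integral_mult_left_zero by (subst integral_exp_half_line) auto
  finally show ?thesis by simp
qed

definition selberg_density :: "complex \<Rightarrow> complex \<Rightarrow> real \<Rightarrow> complex" where
  "selberg_density a b x = (if x \<in> {0..1} then abs_powr x (a - 1) * abs_powr (1 - x) (b - 1) else 0)"

definition selberg_integral :: "nat \<Rightarrow> complex \<Rightarrow> complex \<Rightarrow> complex \<Rightarrow> complex" where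
  "selberg_integral n a b \<gamma> = (LINT y|lborel_on {1..n}. ordered_integrand {1..n} (selberg_density a b) \<gamma> y)"

lemma selberg_integral_commute: "selberg_integral n a b \<gamma> = selberg_integral n b a \<gamma>"
proof -
  have "(\<lambda>x. selberg_density a b (1 - x)) = selberg_density b a"
    by (auto simp: selberg_density_def fun_eq_iff)
  moreover have "selberg_density a b \<in> borel_measurable borel"
    unfolding selberg_density_def[abs_def] by measurable
  ultimately show ?thesis
    unfolding selberg_integral_def using integral_ordered_integrand_reflect[where c=1 and n=n] by metis
qed

section \<open>The weight and its integrability\<close>

lemma integrable_lborel_on_insert_abs_powr:
  fixes f :: "('i \<Rightarrow> real) \<Rightarrow> complex" and G :: "('i \<Rightarrow> real) \<Rightarrow> real"
  assumes I: "finite I" "i \<notin> I" and f: "f \<in> borel_measurable (lborel_on (insert i I))" and a: "a > 0"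
    and G: "integrable (lborel_on I) G" "\<And>x. G x \<ge> 0" "\<And>x. G x \<noteq> 0 \<Longrightarrow> x j \<in> {A..B}"
    and bound: "\<And>x y. norm (f (x(i := y))) \<le> G x * (indicator {A..B} y * \<bar>y - x j\<bar> powr (a - 1))"
  shows "integrable (lborel_on (insert i I)) f"
proof (rule integrable_lborel_on_insert[OF I f])
  define S where "S = 2 * ((B - A) powr a / a)"
  show "integrable (lborel_on I) (\<lambda>x. G x * S)" by (intro integrable_mult_left G(1))
  show "(\<integral>\<^sup>+y. ennreal (norm (f (x(i := y)))) \<partial>lborel) \<le> ennreal (G x * S)" for x
  proof -
    have "(\<integral>\<^sup>+y. ennreal (norm (f (x(i := y)))) \<partial>lborel)
        \<le> (\<integral>\<^sup>+y. ennreal (G x) * ennreal (indicator {A..B} y * \<bar>y - x j\<bar> powr (a - 1)) \<partial>lborel)"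
      using G(2) bound by (intro nn_integral_mono) (auto simp flip: ennreal_mult' intro: ennreal_leI)
    also have "\<dots> = ennreal (G x) * (\<integral>\<^sup>+y. ennreal (indicator {A..B} y * \<bar>y - x j\<bar> powr (a - 1)) \<partial>lborel)"
      by (intro nn_integral_cmult) simp
    also have "\<dots> \<le> ennreal (G x) * ennreal S"
    proof (cases "G x = 0")
      case False
      then show ?thesis unfolding S_def using a G(3)[of x] by (intro mult_left_mono nn_integral_abs_powr) auto
    qed simp
    also have "\<dots> = ennreal (G x * S)" using G(2) a by (intro ennreal_mult'[symmetric]) (simp add: S_def)
    finally show ?thesis .
  qed
qed

text \<open>The condition on \<open>\<alpha> p\<close> is weaker than in the theorem because Selberg's integral is the case \<open>\<alpha> 2 = b - 1\<close>.\<close>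

locale configuration =
  fixes n p :: nat and z :: "nat \<Rightarrow> real" and \<alpha> :: "nat \<Rightarrow> complex" and \<gamma> :: complex
  assumes p_ge_2: "p \<ge> 2"
    and z_Suc_less: "\<And>s. s \<in> {1..<p} \<Longrightarrow> z s < z (s + 1)"
    and Re_\<alpha>_pos: "\<And>s. s \<in> {1..<p} \<Longrightarrow> Re (\<alpha> s) > 0"
    and Re_\<alpha>_p: "Re (\<alpha> p) > - 1"
    and Re_\<gamma>_pos: "Re \<gamma> > 0"
begin

lemma z_less: "1 \<le> r \<Longrightarrow> r < s \<Longrightarrow> s \<le> p \<Longrightarrow> z r < z s"
proof (induction s)
  case (Suc s)
  then show ?case using z_Suc_less[of s] by (cases "r = s") auto
qed simp

lemma z_le: "1 \<le> r \<Longrightarrow> r \<le> s \<Longrightarrow> s \<le> p \<Longrightarrow> z r \<le> z s"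
  using z_less[of r s] by (cases "r = s") auto

lemma inj_on_z: "inj_on z {1..p}"
  by (intro linorder_inj_onI') (use z_less in force)

lemma z_1_less_z_p: "z 1 < z p"
  using z_less[of 1 p] p_ge_2 by auto

abbreviation region :: "(nat \<Rightarrow> nat) \<Rightarrow> (nat \<Rightarrow> real) set" where
  "region \<equiv> Uset n p z"

definition cube :: "(nat \<Rightarrow> real) set" where
  "cube = {t. \<forall>i\<in>{1..n}. t i \<in> {z 1..z p}}"

lemma region_iff:
  assumes l: "l \<in> Zset n (p - 1)"
  shows "t \<in> region l \<longleftrightarrow> (\<forall>i\<in>{1..n}. z (site l i) \<le> t i \<and> t i \<le> z (site l i + 1)) \<and> mono_on {1..n} t"
proof (intro iffI conjI ballI)
  have block: "site l i \<in> {1..p-1}" "i \<in> Gam l (site l i)" if "i \<in> {1..n}" for i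
    using site_in_range[OF l that] Gam_eq_site[OF l site_in_range[OF l that]] that by auto
  assume t: "t \<in> region l"
  show bounds: "z (site l i) \<le> t i" "t i \<le> z (site l i + 1)" if "i \<in> {1..n}" for i
    using t block[OF that] unfolding Uset_def by auto
  have same_site: "t i \<le> t j" if "s \<in> {1..p-1}" "i \<in> Gam l s" "i \<le> j" "j \<in> Gam l s" for s i j
    using that(3,4)
  proof (induction j rule: dec_induct)
    case (step m)
    then have "m \<in> {psum l (s - 1) + 1..<psum l s}" "m \<in> Gam l s" using that(2) by (auto simp: Gam_def)
    moreover from this have "t m \<le> t (m + 1)" using t that(1) unfolding Uset_def by blast
    ultimately show ?case using step.IH by simp
  qed simp
  show "mono_on {1..n} t"
  proof (rule mono_onI)
    fix i j assume ij: "i \<in> {1..n}" "j \<in> {1..n}" "i \<le> j"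
    show "t i \<le> t j"
    proof (cases "site l i = site l j")
      case True
      then show ?thesis using same_site[of "site l i" i j] block[of i] block[of j] ij by simp
    next
      case False
      then have "site l i < site l j" using mono_onD[OF site_mono_on[OF l] ij] by simp
      then have "z (site l i + 1) \<le> z (site l j)" using block(1)[OF ij(2)] by (intro z_le) auto
      then show ?thesis using bounds[OF ij(1)] bounds[OF ij(2)] by linarith
    qed
  qed
next
  assume t: "(\<forall>i\<in>{1..n}. z (site l i) \<le> t i \<and> t i \<le> z (site l i + 1)) \<and> mono_on {1..n} t"
  show "t \<in> region l" unfolding Uset_def
  proof (intro CollectI ballI conjI)
    fix s j assume s: "s \<in> {1..p - 1}" and "j \<in> Gam l s"
    then show "z s \<le> t j" "t j \<le> z (s + 1)" using t Gam_eq_site[OF l s] by auto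
  next
    fix s j assume s: "s \<in> {1..p - 1}" and "j \<in> {psum l (s - 1) + 1..<psum l s}"
    then have "j \<in> Gam l s" "j + 1 \<in> Gam l s" by (auto simp: Gam_def)
    then show "t j \<le> t (j + 1)" using conjunct2[OF t] Gam_eq_site[OF l s] by (auto elim: mono_onD)
  qed
qed

lemma region_subset_cube:
  assumes l: "l \<in> Zset n (p - 1)"
  shows "region l \<subseteq> cube"
proof
  fix t assume t: "t \<in> region l"
  have "t i \<in> {z 1..z p}" if "i \<in> {1..n}" for i
  proof -
    have "z 1 \<le> z (site l i)" "z (site l i + 1) \<le> z p"
      using site_in_range[OF l that] p_ge_2 by (auto intro!: z_le)
    moreover have "z (site l i) \<le> t i" "t i \<le> z (site l i + 1)" using t that by (simp_all add: region_iff[OF l])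
    ultimately show ?thesis by simp
  qed
  then show "t \<in> cube" by (simp add: cube_def)
qed

lemma measurable_indicator_region [measurable]:
  assumes l: "l \<in> Zset n (p - 1)"
  shows "(indicator (region l) :: _ \<Rightarrow> real) \<in> borel_measurable (Rn n)"
proof -
  have "Measurable.pred (Rn n) (\<lambda>t. z (site l i) \<le> t i \<and> t i \<le> z (site l i + 1))" if "i \<in> {1..n}" for i
  proof -
    note [measurable] = measurable_lborel_component[OF that]
    show ?thesis by measurable
  qed
  then have "Measurable.pred (Rn n) (\<lambda>t. t \<in> region l)"
    unfolding region_iff[OF l] by (intro pred_intros_logic pred_intros_finite pred_mono_on) auto
  then have "(\<lambda>t. if t \<in> region l then 1 else 0 :: real) \<in> borel_measurable (Rn n)" by measurable
  then show ?thesis by (simp add: indicator_def[abs_def] of_bool_def)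
qed

definition point_weight :: "real \<Rightarrow> complex" where
  "point_weight x = (\<Prod>s=1..p. abs_powr (x - z s) (\<alpha> s))"

definition weight :: "(nat \<Rightarrow> real) \<Rightarrow> complex" where
  "weight t = (\<Prod>i=1..n. point_weight (t i)) * vandermonde {1..n} \<gamma> t"

definition denominator :: "real \<Rightarrow> complex" where
  "denominator x = (\<Prod>s=1..<p. of_real (x - z s))"

text \<open>The admissible functions have at most simple poles at \<open>z 1, \<dots>, z (p - 1)\<close>; the value of the quotient at a pole
  is 0 and does not matter, because the weight vanishes there.\<close>

definition admissible :: "(real \<Rightarrow> complex) set" where
  "admissible = {f \<in> borel_measurable borel. bounded ((\<lambda>x. f x * denominator x) ` {z 1..z p})}"

definition tame :: "nat set \<Rightarrow> ((nat \<Rightarrow> real) \<Rightarrow> complex) \<Rightarrow> bool" where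
  "tame J H \<longleftrightarrow> J \<subseteq> {1..n} \<and> H \<in> borel_measurable (Rn n) \<and> depends_only_on J H
     \<and> bounded ((\<lambda>t. H t * (\<Prod>j\<in>J. denominator (t j))) ` cube)"

definition majorant :: "real \<Rightarrow> real" where
  "majorant x = indicator {z 1..z p} x * (\<Prod>s=1..p. \<bar>x - z s\<bar> powr (if s < p then Re (\<alpha> s) - 1 else Re (\<alpha> s)))"

lemma measurable_point_weight [measurable]: "point_weight \<in> borel_measurable borel"
  unfolding point_weight_def[abs_def] by measurable

lemma measurable_weight [measurable]: "weight \<in> borel_measurable (Rn n)"
  unfolding weight_def[abs_def]
  by (intro borel_measurable_times borel_measurable_prod measurable_vandermonde
      measurable_compose[OF measurable_lborel_component measurable_point_weight]) auto

lemma prod_last: "(\<Prod>s=1..p. f s) = f p * (\<Prod>s=1..<p. f s)"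
  using p_ge_2 prod.last_plus[of 1 p f] by (simp add: atLeastLessThanSuc_atLeastAtMost)

lemma norm_point_weight:
  assumes "x \<in> {z 1..z p}"
  shows "norm (point_weight x) = majorant x * norm (denominator x)"
proof -
  have "\<bar>x - z s\<bar> powr Re (\<alpha> s) = \<bar>x - z s\<bar> powr (Re (\<alpha> s) - 1) * \<bar>x - z s\<bar>" for s
    by (cases "x = z s") (simp_all add: powr_diff)
  then show ?thesis
    using assms
    unfolding point_weight_def majorant_def denominator_def prod_last
    by (simp add: norm_mult norm_abs_powr prod.distrib del: of_real_diff flip: prod_norm)
qed

lemma majorant_nonneg: "majorant x \<ge> 0"
  unfolding majorant_def by (intro mult_nonneg_nonneg prod_nonneg) auto

lemma integrable_majorant: "integrable lborel majorant"
  unfolding majorant_def using inj_on_z Re_\<alpha>_pos Re_\<alpha>_p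
  by (intro integrable_prod_abs_powr) (force simp: order_le_less)+

lemma bounded_image_continuous:
  fixes g :: "real \<Rightarrow> complex"
  assumes "continuous_on {z 1..z p} g"
  shows "bounded (g ` {z 1..z p})"
  using assms by (intro compact_imp_bounded compact_continuous_image) auto

lemma admissible_continuous:
  fixes g :: "real \<Rightarrow> complex"
  assumes g: "continuous_on UNIV g"
  shows "g \<in> admissible"
proof -
  have "continuous_on {z 1..z p} g" using g continuous_on_subset by blast
  then have "bounded ((\<lambda>x. g x * denominator x) ` {z 1..z p})"
    unfolding denominator_def by (intro bounded_image_continuous continuous_intros)
  then show ?thesis using borel_measurable_continuous_onI[OF g] by (simp add: admissible_def)
qed

lemma admissible_simple_pole:
  fixes g :: "real \<Rightarrow> complex"
  assumes g: "continuous_on UNIV g" and s: "s \<in> {1..<p}"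
  shows "(\<lambda>x. g x / of_real (x - z s)) \<in> admissible"
proof -
  let ?rest = "\<lambda>x. g x * (\<Prod>r\<in>{1..<p} - {s}. of_real (x - z r))"
  have "denominator x = of_real (x - z s) * (\<Prod>r\<in>{1..<p} - {s}. of_real (x - z r))" for x
    unfolding denominator_def using s by (intro prod.remove) auto
  then have "g x / of_real (x - z s) * denominator x \<in> {0, ?rest x}" for x
    by (cases "x = z s") auto
  then have "(\<lambda>x. g x / of_real (x - z s) * denominator x) ` {z 1..z p} \<subseteq> insert 0 (?rest ` {z 1..z p})"
    by blast
  moreover have "continuous_on {z 1..z p} g" using g continuous_on_subset by blast
  then have "bounded (insert 0 (?rest ` {z 1..z p}))"
    unfolding bounded_insert by (intro bounded_image_continuous continuous_intros)
  ultimately have "bounded ((\<lambda>x. g x / of_real (x - z s) * denominator x) ` {z 1..z p})"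
    by (rule bounded_subset[rotated])
  moreover have "(\<lambda>x. g x / of_real (x - z s)) \<in> borel_measurable borel"
    using borel_measurable_continuous_onI[OF g] by measurable
  ultimately show ?thesis unfolding admissible_def by blast
qed

lemma admissible_diff:
  assumes "f \<in> admissible" "g \<in> admissible"
  shows "f - g \<in> admissible"
proof -
  have "bounded ((\<lambda>x. f x * denominator x - g x * denominator x) ` {z 1..z p})"
    using assms by (intro bounded_minus_comp) (auto simp: admissible_def)
  moreover have "(\<lambda>x. f x - g x) \<in> borel_measurable borel"
    using assms by (intro borel_measurable_diff) (auto simp: admissible_def)
  ultimately show ?thesis by (simp add: admissible_def fun_diff_def algebra_simps)
qed

lemma tame_sum:
  assumes "J \<subseteq> {1..n}" "\<And>k. k \<in> K \<Longrightarrow> tame J (H k)"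
  shows "tame J (\<lambda>t. \<Sum>k\<in>K. H k t)"
  using assms(2)
proof (induction K rule: infinite_finite_induct)
  case (insert k K)
  then have "bounded ((\<lambda>t. H k t * (\<Prod>j\<in>J. denominator (t j)) + (\<Sum>k\<in>K. H k t) * (\<Prod>j\<in>J. denominator (t j))) ` cube)"
    by (intro bounded_plus_comp) (auto simp: tame_def)
  moreover have "H k \<in> borel_measurable (Rn n)" "(\<lambda>t. \<Sum>k\<in>K. H k t) \<in> borel_measurable (Rn n)"
    "depends_only_on J (H k)" "depends_only_on J (\<lambda>t. \<Sum>k\<in>K. H k t)"
    using insert by (auto simp: tame_def)
  moreover from this have "depends_only_on J (\<lambda>t. H k t + (\<Sum>k\<in>K. H k t))"
    by (auto simp: depends_only_on_def intro!: arg_cong2[of _ _ _ _ "(+)"])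
  ultimately show ?case
    using insert.hyps assms(1) by (simp add: tame_def distrib_right)
qed (use assms(1) in \<open>simp_all add: tame_def depends_only_on_def image_constant_conv\<close>)

lemma tame_times_admissible:
  assumes H: "tame J H" and f: "f \<in> admissible" and i: "i \<in> {1..n}" "i \<notin> J"
  shows "tame (insert i J) (\<lambda>t. f (t i) * H t)"
proof -
  have J: "finite J" "J \<subseteq> {1..n}" using H finite_subset[of J "{1..n}"] by (auto simp: tame_def)
  obtain B where B: "\<And>x. x \<in> {z 1..z p} \<Longrightarrow> norm (f x * denominator x) \<le> B"
    using f unfolding admissible_def bounded_iff by blast
  obtain C where C: "\<And>t. t \<in> cube \<Longrightarrow> norm (H t * (\<Prod>j\<in>J. denominator (t j))) \<le> C"
    using H by (auto simp: tame_def bounded_iff)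
  have "norm (f (t i) * H t * (\<Prod>j\<in>insert i J. denominator (t j))) \<le> B * C" if t: "t \<in> cube" for t
  proof -
    have "t i \<in> {z 1..z p}" using t i by (auto simp: cube_def)
    then have "norm (f (t i) * denominator (t i)) * norm (H t * (\<Prod>j\<in>J. denominator (t j))) \<le> B * C"
      using B C t by (intro mult_mono) (auto intro: order_trans[OF norm_ge_zero])
    then show ?thesis using J(1) i(2) by (simp add: norm_mult mult_ac)
  qed
  then have "bounded ((\<lambda>t. f (t i) * H t * (\<Prod>j\<in>insert i J. denominator (t j))) ` cube)"
    by (auto simp: bounded_iff)
  moreover have "(\<lambda>t. f (t i)) \<in> borel_measurable (Rn n)"
    using f by (intro measurable_compose[OF measurable_lborel_component[OF i(1)]]) (simp add: admissible_def)
  moreover have "depends_only_on (insert i J) (\<lambda>t. f (t i) * H t)"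
    using H by (auto simp: tame_def depends_only_on_def intro!: arg_cong2[of _ _ _ _ "(*)"])
  ultimately show ?thesis using H i(1) by (auto simp: tame_def)
qed

lemma tame_sym_prod:
  assumes "J \<subseteq> {1..n}" "size M = card J" "set_mset M \<subseteq> admissible"
  shows "tame J (\<lambda>t. sym_prod M t J)"
  using assms
proof (induction M arbitrary: J)
  case empty
  then have "J = {}" using finite_subset[of J "{1..n}"] by auto
  then show ?case by (auto simp: tame_def depends_only_on_def bounded_iff)
next
  case (add f M)
  have "tame J (\<lambda>t. f (t i) * sym_prod M t (J - {i}))" if i: "i \<in> J" for i
  proof -
    have "tame (J - {i}) (\<lambda>t. sym_prod M t (J - {i}))" using add i by (intro add.IH) auto
    then have "tame (insert i (J - {i})) (\<lambda>t. f (t i) * sym_prod M t (J - {i}))"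
      using add.prems i by (intro tame_times_admissible) auto
    then show ?thesis using i by (simp add: insert_absorb)
  qed
  then show ?case unfolding sym_prod_add_mset by (intro tame_sum add.prems(1))
qed

lemma norm_abs_powr_cube_le:
  assumes "x \<in> {z 1..z p}" "y \<in> {z 1..z p}"
  shows "norm (abs_powr (x - y) (2 * \<gamma>)) \<le> (z p - z 1) powr (2 * Re \<gamma>)"
  using assms Re_\<gamma>_pos by (auto simp: norm_abs_powr intro!: powr_mono2)

lemma norm_vandermonde_cube_le:
  assumes "t \<in> cube" "I \<subseteq> {1..n}"
  shows "norm (vandermonde I \<gamma> t) \<le> ((z p - z 1) powr (2 * Re \<gamma>)) ^ (card I choose 2)"
  using assms finite_subset[OF assms(2)]
  by (intro norm_vandermonde_le norm_abs_powr_cube_le) (auto simp: cube_def)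

lemma tame_bound:
  assumes "tame J H"
  obtains C where "C \<ge> 0" "\<And>t. t \<in> cube \<Longrightarrow> norm (H t * (\<Prod>j\<in>J. point_weight (t j))) \<le> C * (\<Prod>j\<in>J. majorant (t j))"
proof -
  obtain C where C: "\<And>t. t \<in> cube \<Longrightarrow> norm (H t * (\<Prod>j\<in>J. denominator (t j))) \<le> C"
    using assms by (auto simp: tame_def bounded_iff)
  have "norm (H t * (\<Prod>j\<in>J. point_weight (t j))) \<le> \<bar>C\<bar> * (\<Prod>j\<in>J. majorant (t j))" if t: "t \<in> cube" for t
  proof -
    have "(\<Prod>j\<in>J. norm (point_weight (t j))) = (\<Prod>j\<in>J. majorant (t j)) * (\<Prod>j\<in>J. norm (denominator (t j)))"
      unfolding prod.distrib[symmetric] using t assms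
      by (intro prod.cong norm_point_weight) (auto simp: cube_def tame_def)
    then have "norm (H t * (\<Prod>j\<in>J. point_weight (t j)))
        = norm (H t * (\<Prod>j\<in>J. denominator (t j))) * (\<Prod>j\<in>J. majorant (t j))"
      by (simp add: norm_mult prod_norm)
    also have "\<dots> \<le> \<bar>C\<bar> * (\<Prod>j\<in>J. majorant (t j))"
      using C[OF t] by (intro mult_right_mono prod_nonneg majorant_nonneg) auto
    finally show ?thesis .
  qed
  then show ?thesis by (rule that[OF abs_ge_zero])
qed

lemma set_integrable_weight_tame:
  assumes l: "l \<in> Zset n (p - 1)" and H: "tame {1..n} H"
  shows "set_integrable (Rn n) (region l) (\<lambda>t. weight t * H t)"
proof -
  obtain C where C: "C \<ge> 0"
    "\<And>t. t \<in> cube \<Longrightarrow> norm (H t * (\<Prod>i=1..n. point_weight (t i))) \<le> C * (\<Prod>i=1..n. majorant (t i))"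
    using tame_bound[OF H] by blast
  have [measurable]: "H \<in> borel_measurable (Rn n)" using H by (simp add: tame_def)
  let ?B = "((z p - z 1) powr (2 * Re \<gamma>)) ^ (card {1..n} choose 2)"
  have bound: "norm (indicator (region l) t *\<^sub>R (weight t * H t)) \<le> (?B * C) * (\<Prod>i=1..n. majorant (t i))" for t
  proof (cases "t \<in> region l")
    case True
    then have t: "t \<in> cube" using region_subset_cube[OF l] by blast
    have "norm (weight t * H t) = norm (vandermonde {1..n} \<gamma> t) * norm (H t * (\<Prod>i=1..n. point_weight (t i)))"
      by (simp add: weight_def norm_mult)
    also have "\<dots> \<le> ?B * (C * (\<Prod>i=1..n. majorant (t i)))"
      using t by (intro mult_mono norm_vandermonde_cube_le C(2)) auto
    finally show ?thesis using True by (simp add: mult.assoc)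
  qed (use C(1) in \<open>auto intro!: mult_nonneg_nonneg prod_nonneg majorant_nonneg\<close>)
  have "(\<lambda>t. indicator (region l) t *\<^sub>R (weight t * H t)) \<in> borel_measurable (Rn n)"
    using measurable_indicator_region[OF l] by measurable
  then show ?thesis
    unfolding set_integrable_def using integrable_majorant
    by (intro integrable_lborel_on_bound[OF _ _ _ bound]) auto
qed

text \<open>Continuous also at \<open>z p\<close>, where \<open>point_weight\<close> need not be.\<close>

definition raised_weight :: "real \<Rightarrow> complex" where
  "raised_weight x = (\<Prod>s=1..p. abs_powr (x - z s) ((\<alpha>(p := \<alpha> p + 1)) s))"

lemma raised_weight_eq: "x \<le> z p \<Longrightarrow> raised_weight x = point_weight x * of_real (z p - x)"
  unfolding raised_weight_def point_weight_def prod_last by (simp add: abs_powr_add_1)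

lemma Re_raised_pos: "s \<in> {1..p} \<Longrightarrow> Re ((\<alpha>(p := \<alpha> p + 1)) s) > 0"
  using Re_\<alpha>_pos[of s] Re_\<alpha>_p by auto

lemma bounded_raised_weight: "bounded (raised_weight ` {z 1..z p})"
  unfolding raised_weight_def[abs_def] using Re_raised_pos
  by (intro bounded_image_continuous continuous_on_prod
    continuous_on_compose2[OF continuous_on_abs_powr[of _ UNIV]] continuous_intros) auto

lemma weight_insert:
  assumes "i \<in> {1..n}"
  defines "I \<equiv> {1..n} - {i}"
  shows "weight t = point_weight (t i) * (\<Prod>k\<in>I. abs_powr (t i - t k) (2 * \<gamma>)) * (\<Prod>k\<in>I. point_weight (t k))
      * vandermonde I \<gamma> t"
proof -
  have I: "{1..n} = insert i I" "i \<notin> I" "finite I" unfolding I_def using assms(1) by auto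
  show ?thesis
    unfolding weight_def I(1) vandermonde_insert[OF I(3,2)] prod.insert[OF I(3,2)] by (simp only: mult_ac)
qed

lemma norm_abs_powr_divide: "norm (abs_powr x a / of_real x) = \<bar>x\<bar> powr (Re a - 1)"
  by (cases "x = 0") (simp_all add: norm_divide norm_abs_powr powr_diff)

lemma weight_quotient_bound:
  assumes ij: "i \<in> {1..n}" "j \<in> {1..n} - {i}" and H: "tame ({1..n} - {i}) H"
  obtains C where "C \<ge> 0" "\<And>t. t \<in> cube \<Longrightarrow> norm (weight t * (H t * (of_real (z p - t i) / of_real (t i - t j))))
      \<le> C * (\<Prod>k\<in>{1..n} - {i}. majorant (t k)) * \<bar>t i - t j\<bar> powr (2 * Re \<gamma> - 1)"
proof -
  let ?I = "{1..n} - {i}"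
  obtain B where B: "\<And>x. x \<in> {z 1..z p} \<Longrightarrow> norm (raised_weight x) \<le> B"
    using bounded_raised_weight unfolding bounded_iff by blast
  have "0 \<le> B" using B[of "z 1"] z_1_less_z_p by (auto intro: order_trans[OF norm_ge_zero])
  obtain C where C: "C \<ge> 0" "\<And>t. t \<in> cube \<Longrightarrow> norm (H t * (\<Prod>k\<in>?I. point_weight (t k))) \<le> C * (\<Prod>k\<in>?I. majorant (t k))"
    using tame_bound[OF H] by blast
  define D where "D = (z p - z 1) powr (2 * Re \<gamma>)"
  have bound: "norm (weight t * (H t * (of_real (z p - t i) / of_real (t i - t j))))
      \<le> (B * C * D ^ card (?I - {j}) * D ^ (card ?I choose 2)) * (\<Prod>k\<in>?I. majorant (t k))
        * \<bar>t i - t j\<bar> powr (2 * Re \<gamma> - 1)"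
    if t: "t \<in> cube" for t
  proof -
    have interval: "t k \<in> {z 1..z p}" if "k \<in> {1..n}" for k using t that by (simp add: cube_def)
    have "(\<Prod>k\<in>?I. abs_powr (t i - t k) (2 * \<gamma>))
        = abs_powr (t i - t j) (2 * \<gamma>) * (\<Prod>k\<in>?I - {j}. abs_powr (t i - t k) (2 * \<gamma>))"
      using ij by (intro prod.remove) auto
    then have "weight t * (H t * (of_real (z p - t i) / of_real (t i - t j)))
        = raised_weight (t i) * (H t * (\<Prod>k\<in>?I. point_weight (t k)))
          * (\<Prod>k\<in>?I - {j}. abs_powr (t i - t k) (2 * \<gamma>)) * vandermonde ?I \<gamma> t
          * (abs_powr (t i - t j) (2 * \<gamma>) / of_real (t i - t j))"
      using raised_weight_eq[of "t i"] interval[OF ij(1)]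
      by (simp add: weight_insert[OF ij(1)] mult_ac del: of_real_diff)
    also have "norm \<dots> = norm (raised_weight (t i)) * norm (H t * (\<Prod>k\<in>?I. point_weight (t k)))
          * norm (\<Prod>k\<in>?I - {j}. abs_powr (t i - t k) (2 * \<gamma>)) * norm (vandermonde ?I \<gamma> t)
            * \<bar>t i - t j\<bar> powr (2 * Re \<gamma> - 1)"
      unfolding norm_mult[of _ "abs_powr _ _ / _"] norm_abs_powr_divide by (simp add: norm_mult)
    also have "\<dots> \<le> B * (C * (\<Prod>k\<in>?I. majorant (t k))) * D ^ card (?I - {j}) * D ^ (card ?I choose 2)
        * \<bar>t i - t j\<bar> powr (2 * Re \<gamma> - 1)"
    proof (intro mult_mono order_refl)
      have "(\<Prod>k\<in>?I - {j}. norm (abs_powr (t i - t k) (2 * \<gamma>))) \<le> (\<Prod>k\<in>?I - {j}. D)"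
        unfolding D_def using interval ij(1) by (intro prod_mono conjI norm_abs_powr_cube_le norm_ge_zero) auto
      then show "norm (\<Prod>k\<in>?I - {j}. abs_powr (t i - t k) (2 * \<gamma>)) \<le> D ^ card (?I - {j})"
        by (simp only: prod_norm prod_constant)
      show "norm (vandermonde ?I \<gamma> t) \<le> D ^ (card ?I choose 2)"
        unfolding D_def using t by (intro norm_vandermonde_cube_le) auto
    qed (use B[OF interval[OF ij(1)]] C t \<open>0 \<le> B\<close> in
      \<open>auto simp: D_def intro!: mult_nonneg_nonneg prod_nonneg majorant_nonneg\<close>)
    finally show ?thesis by (simp only: mult_ac)
  qed
  show ?thesis
    by (rule that[OF _ bound]) (use \<open>0 \<le> B\<close> C(1) in \<open>auto simp: D_def intro!: mult_nonneg_nonneg\<close>)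
qed

lemma set_integrable_weight_quotient:
  assumes l: "l \<in> Zset n (p - 1)" and ij: "i \<in> {1..n}" "j \<in> {1..n} - {i}" and H: "tame ({1..n} - {i}) H"
  shows "set_integrable (Rn n) (region l) (\<lambda>t. weight t * (H t * (of_real (z p - t i) / of_real (t i - t j))))"
proof -
  let ?I = "{1..n} - {i}" and ?f = "\<lambda>t. weight t * (H t * (of_real (z p - t i) / of_real (t i - t j)))"
  obtain C where C: "C \<ge> 0"
    "\<And>t. t \<in> cube \<Longrightarrow> norm (?f t) \<le> C * (\<Prod>k\<in>?I. majorant (t k)) * \<bar>t i - t j\<bar> powr (2 * Re \<gamma> - 1)"
    using weight_quotient_bound[OF ij H] by blast
  let ?g = "\<lambda>t. indicator (region l) t *\<^sub>R ?f t" and ?G = "\<lambda>x. C * (\<Prod>k\<in>?I. majorant (x k))"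
  have I: "insert i ?I = {1..n}" using ij(1) by auto
  have G_nonneg: "?G x \<ge> 0" for x using C(1) by (intro mult_nonneg_nonneg prod_nonneg majorant_nonneg)
  have "integrable (lborel_on (insert i ?I)) ?g"
  proof (rule integrable_lborel_on_insert_abs_powr)
    have [measurable]: "H \<in> borel_measurable (Rn n)" "(\<lambda>t. t i) \<in> borel_measurable (Rn n)"
      "(\<lambda>t. t j) \<in> borel_measurable (Rn n)"
      using H ij by (auto simp: tame_def intro: measurable_lborel_component)
    show "?g \<in> borel_measurable (lborel_on (insert i ?I))"
      unfolding I using measurable_indicator_region[OF l] by measurable
    show "integrable (lborel_on ?I) ?G"
      by (intro integrable_mult_right lborel_product.product_integrable_prod integrable_majorant) auto
    have "majorant y = 0" if "y \<notin> {z 1..z p}" for y using that by (simp add: majorant_def)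
    then show "x j \<in> {z 1..z p}" if "?G x \<noteq> 0" for x using that ij(2) by fastforce
    show "norm (?g (x(i := y))) \<le> ?G x * (indicator {z 1..z p} y * \<bar>y - x j\<bar> powr (2 * Re \<gamma> - 1))" for x y
    proof (cases "x(i := y) \<in> region l")
      case True
      then have cube: "x(i := y) \<in> cube" using region_subset_cube[OF l] by blast
      then have "(x(i := y)) i \<in> {z 1..z p}" using ij(1) unfolding cube_def by blast
      moreover have "(\<Prod>k\<in>?I. majorant ((x(i := y)) k)) = (\<Prod>k\<in>?I. majorant (x k))" by (intro prod.cong) auto
      ultimately show ?thesis using C(2)[OF cube] True ij by simp
    qed (use G_nonneg[of x] in \<open>simp add: indicator_def\<close>)
  qed (use Re_\<gamma>_pos G_nonneg in auto)
  then show ?thesis unfolding I set_integrable_def .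
qed

end

section \<open>Integration by parts\<close>

context configuration
begin

definition h :: "nat \<Rightarrow> real \<Rightarrow> complex" where
  "h s x = of_real (z p - x) / of_real (x - z s)"

definition drift :: "real \<Rightarrow> complex" where
  "drift x = (\<Sum>s=1..<p. \<alpha> s * h s x) - (1 + \<alpha> p)"

lemma h_admissible: "s \<in> {1..<p} \<Longrightarrow> h s \<in> admissible"
  unfolding h_def[abs_def] by (intro admissible_simple_pole continuous_intros)

lemma sum_last: "(\<Sum>s=1..p. f s) = (\<Sum>s=1..<p. f s) + f p"
  using p_ge_2 sum.last_plus[of 1 p f] by (simp add: atLeastLessThanSuc_atLeastAtMost add.commute)

lemma point_weight_z: "s \<in> {1..p} \<Longrightarrow> point_weight (z s) = 0"
  unfolding point_weight_def by (intro prod_zero) auto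

lemma point_weight_times_drift:
  fixes I :: "nat set"
  assumes y: "y \<le> z p"
  shows "point_weight y * (drift y + 2 * \<gamma> * (\<Sum>k\<in>I. of_real (z p - y) / of_real (y - x k)))
    = raised_weight y * ((\<Sum>s=1..p. (\<alpha>(p := \<alpha> p + 1)) s / of_real (y - z s)) + (\<Sum>k\<in>I. 2 * \<gamma> / of_real (y - x k)))"
proof (cases "y = z p")
  case True
  then show ?thesis using point_weight_z[of p] raised_weight_eq[of y] p_ge_2 by simp
next
  case False
  define d :: complex where "d = of_real (z p - y)"
  have "d \<noteq> 0" and minus_d: "of_real (y - z p) = - d" using False by (auto simp: d_def)
  then have "d * ((\<alpha> p + 1) / of_real (y - z p)) = - (1 + \<alpha> p)"
    unfolding minus_d by simp
  then have "d * (\<Sum>s=1..p. (\<alpha>(p := \<alpha> p + 1)) s / of_real (y - z s)) = drift y"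
    unfolding sum_last by (simp add: drift_def h_def d_def distrib_left sum_distrib_left mult_ac del: of_real_diff)
  moreover have "d * (\<Sum>k\<in>I. 2 * \<gamma> / of_real (y - x k)) = 2 * \<gamma> * (\<Sum>k\<in>I. d / of_real (y - x k))"
    by (simp add: sum_distrib_left mult_ac del: of_real_diff)
  ultimately show ?thesis
    unfolding raised_weight_eq[OF y] d_def[symmetric] by (simp add: mult.assoc distrib_left)
qed

lemma region_section:
  assumes l: "l \<in> Zset n (p - 1)" and i: "i \<in> {1..n}" and y0: "x(i := y0) \<in> region l"
  shows "x(i := y) \<in> region l \<longleftrightarrow> (\<forall>s\<in>{1..site l i}. z s \<le> y) \<and> (\<forall>k\<in>{1..<i}. x k \<le> y)
      \<and> (\<forall>s\<in>{site l i + 1..p}. y \<le> z s) \<and> (\<forall>k\<in>{i<..n}. y \<le> x k)"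
proof -
  have s: "site l i \<in> {1..p-1}" by (rule site_in_range[OF l i])
  have "(\<forall>s\<in>{1..site l i}. z s \<le> y) \<longleftrightarrow> z (site l i) \<le> y"
    using s z_le[of _ "site l i"] by (auto intro: order_trans[of _ "z (site l i)"])
  moreover have "(\<forall>s\<in>{site l i + 1..p}. y \<le> z s) \<longleftrightarrow> y \<le> z (site l i + 1)"
    using s z_le[of "site l i + 1"] by (auto intro: order_trans[of _ "z (site l i + 1)"])
  moreover have "(\<forall>k\<in>{1..n}. z (site l k) \<le> (x(i := y)) k \<and> (x(i := y)) k \<le> z (site l k + 1))
      \<longleftrightarrow> z (site l i) \<le> y \<and> y \<le> z (site l i + 1)"
    using y0 i unfolding region_iff[OF l] by auto
  moreover have "mono_on {1..n} (x(i := y)) \<longleftrightarrow> (\<forall>k\<in>{1..<i}. x k \<le> y) \<and> (\<forall>k\<in>{i<..n}. y \<le> x k)"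
  proof
    assume mono: "mono_on {1..n} (x(i := y))"
    have "x k \<le> y" if "k \<in> {1..<i}" for k
      using mono_onD[OF mono, of k i] that i by auto
    moreover have "y \<le> x k" if "k \<in> {i<..n}" for k
      using mono_onD[OF mono, of i k] that i by auto
    ultimately show "(\<forall>k\<in>{1..<i}. x k \<le> y) \<and> (\<forall>k\<in>{i<..n}. y \<le> x k)" by blast
  next
    assume y: "(\<forall>k\<in>{1..<i}. x k \<le> y) \<and> (\<forall>k\<in>{i<..n}. y \<le> x k)"
    have mono: "mono_on {1..n} (x(i := y0))" using y0 by (simp add: region_iff[OF l])
    show "mono_on {1..n} (x(i := y))"
    proof (rule mono_onI)
      fix j k assume "j \<in> {1..n}" "k \<in> {1..n}" "j \<le> k"
      then show "(x(i := y)) j \<le> (x(i := y)) k" using y mono_onD[OF mono, of j k] by (auto split: if_splits)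
    qed
  qed
  ultimately show ?thesis unfolding region_iff[OF l] by blast
qed

lemma integral_raised_weight_section:
  fixes x :: "nat \<Rightarrow> real"
  assumes l: "l \<in> Zset n (p - 1)" and i: "i \<in> {1..n}" and y0: "x(i := y0) \<in> region l"
  defines "I \<equiv> {1..n} - {i}"
  shows "(LINT y:{y. x(i := y) \<in> region l}|lborel. raised_weight y * (\<Prod>k\<in>I. abs_powr (y - x k) (2 * \<gamma>))
      * ((\<Sum>s=1..p. (\<alpha>(p := \<alpha> p + 1)) s / of_real (y - z s)) + (\<Sum>k\<in>I. 2 * \<gamma> / of_real (y - x k)))) = 0"
proof -
  define A where "A = {1..site l i} <+> {1..<i}"
  define B where "B = {site l i + 1..p} <+> {i<..n}"
  define c where "c = case_sum z x"
  define \<beta> where "\<beta> = case_sum (\<alpha>(p := \<alpha> p + 1)) (\<lambda>_ :: nat. 2 * \<gamma>)"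
  have s: "site l i \<in> {1..p-1}" by (rule site_in_range[OF l i])
  have union: "A \<union> B = {1..p} <+> I"
    using s i by (auto simp: A_def B_def I_def)
  have "{y. x(i := y) \<in> region l} = {y. (\<forall>k\<in>A. c k \<le> y) \<and> (\<forall>k\<in>B. y \<le> c k)}"
    unfolding region_section[OF l i y0] A_def B_def Plus_def ball_Un by (auto simp: c_def)
  moreover have "(\<Prod>k\<in>A\<union>B. abs_powr (y - c k) (\<beta> k)) = raised_weight y * (\<Prod>k\<in>I. abs_powr (y - x k) (2 * \<gamma>))" for y
    unfolding union by (simp add: prod.Plus I_def c_def \<beta>_def raised_weight_def)
  moreover have "(\<Sum>k\<in>A\<union>B. \<beta> k / of_real (y - c k))
      = (\<Sum>s=1..p. (\<alpha>(p := \<alpha> p + 1)) s / of_real (y - z s)) + (\<Sum>k\<in>I. 2 * \<gamma> / of_real (y - x k))" for y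
    unfolding union by (simp add: sum.Plus I_def c_def \<beta>_def)
  moreover have "(LINT y:{y. (\<forall>k\<in>A. c k \<le> y) \<and> (\<forall>k\<in>B. y \<le> c k)}|lborel.
      (\<Prod>k\<in>A\<union>B. abs_powr (y - c k) (\<beta> k)) * (\<Sum>k\<in>A\<union>B. \<beta> k / of_real (y - c k))) = 0"
  proof (rule integral_prod_abs_powr_log_derivative)
    show "A \<noteq> {}" "B \<noteq> {}" using s by (auto simp: A_def B_def)
    show "Re (\<beta> k) > 0" if "k \<in> A \<union> B" for k
      using that Re_raised_pos Re_\<gamma>_pos unfolding union \<beta>_def by (auto simp del: fun_upd_apply)
  qed (auto simp: A_def B_def)
  ultimately show ?thesis by (simp only:)
qed

lemma set_integrable_sum:
  fixes f :: "'k \<Rightarrow> 'a \<Rightarrow> 'b :: {banach, second_countable_topology}"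
  assumes "\<And>k. k \<in> K \<Longrightarrow> set_integrable M A (f k)"
  shows "set_integrable M A (\<lambda>x. \<Sum>k\<in>K. f k x)"
  using assms unfolding set_integrable_def scaleR_sum_right by (rule Bochner_Integration.integrable_sum)

text \<open>\<open>z p - t i\<close> times the logarithmic derivative of \<open>(z p - t i) * weight t\<close> with respect to \<open>t i\<close>.\<close>

definition scaled_log_derivative :: "nat \<Rightarrow> (nat \<Rightarrow> real) \<Rightarrow> complex" where
  "scaled_log_derivative i t
    = drift (t i) + 2 * \<gamma> * (\<Sum>k\<in>{1..n} - {i}. of_real (z p - t i) / of_real (t i - t k))"

lemma set_integrable_weight_log_derivative:
  assumes l: "l \<in> Zset n (p - 1)" and i: "i \<in> {1..n}" and H: "tame ({1..n} - {i}) H"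
  shows "set_integrable (Rn n) (region l) (\<lambda>t. weight t * (H t * scaled_log_derivative i t))"
proof -
  have point: "set_integrable (Rn n) (region l) (\<lambda>t. weight t * (f (t i) * H t))" if "f \<in> admissible" for f
    using tame_times_admissible[OF H that i] i
    by (intro set_integrable_weight_tame[OF l]) (simp add: insert_absorb)
  have "set_integrable (Rn n) (region l) (\<lambda>t. (\<Sum>s=1..<p. \<alpha> s * (weight t * (h s (t i) * H t)))
      - weight t * ((1 + \<alpha> p) * H t)
      + (\<Sum>k\<in>{1..n} - {i}. 2 * \<gamma> * (weight t * (H t * (of_real (z p - t i) / of_real (t i - t k))))))"
    using point[OF h_admissible] point[OF admissible_continuous[of "\<lambda>_. 1 + \<alpha> p"]]
      set_integrable_weight_quotient[OF l i _ H]
    by (intro set_integral_add set_integral_diff set_integrable_sum set_integrable_mult_right) auto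
  then show ?thesis
    by (rule set_integrable_cong[THEN iffD1, rotated -1])
       (simp_all add: scaled_log_derivative_def drift_def algebra_simps sum_distrib_left del: of_real_diff)
qed

lemma weight_log_derivative_section:
  assumes i: "i \<in> {1..n}" and y: "y \<le> z p" and H: "depends_only_on ({1..n} - {i}) H"
  defines "I \<equiv> {1..n} - {i}"
  shows "weight (x(i := y)) * (H (x(i := y)) * scaled_log_derivative i (x(i := y)))
    = H x * (\<Prod>k\<in>I. point_weight (x k)) * vandermonde I \<gamma> x
      * (raised_weight y * (\<Prod>k\<in>I. abs_powr (y - x k) (2 * \<gamma>))
        * ((\<Sum>s=1..p. (\<alpha>(p := \<alpha> p + 1)) s / of_real (y - z s)) + (\<Sum>k\<in>I. 2 * \<gamma> / of_real (y - x k))))"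
proof -
  have weight: "weight (x(i := y))
      = point_weight y * (\<Prod>k\<in>I. abs_powr (y - x k) (2 * \<gamma>)) * (\<Prod>k\<in>I. point_weight (x k))
        * vandermonde I \<gamma> x"
    unfolding weight_insert[OF i] I_def
    by (intro arg_cong2[of _ _ _ _ "(*)"] prod.cong vandermonde_cong) auto
  have H_eq: "H (x(i := y)) = H x" by (rule depends_only_onD[OF H]) auto
  have "(\<Sum>k\<in>I. of_real (z p - y) / of_real (y - (x(i := y)) k))
      = (\<Sum>k\<in>I. of_real (z p - y) / (of_real (y - x k) :: complex))"
    by (intro sum.cong) (auto simp: I_def)
  then have "scaled_log_derivative i (x(i := y))
      = drift y + 2 * \<gamma> * (\<Sum>k\<in>I. of_real (z p - y) / of_real (y - x k))"
    unfolding scaled_log_derivative_def I_def fun_upd_same by (simp only:)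
  then have "weight (x(i := y)) * (H (x(i := y)) * scaled_log_derivative i (x(i := y)))
      = H x * (\<Prod>k\<in>I. point_weight (x k)) * vandermonde I \<gamma> x * (\<Prod>k\<in>I. abs_powr (y - x k) (2 * \<gamma>))
        * (point_weight y * (drift y + 2 * \<gamma> * (\<Sum>k\<in>I. of_real (z p - y) / of_real (y - x k))))"
    unfolding weight H_eq by (simp only: mult_ac)
  then show ?thesis
    unfolding point_weight_times_drift[OF y, where I=I and x=x] by (simp only: mult_ac)
qed

lemma integral_weight_log_derivative_section:
  assumes l: "l \<in> Zset n (p - 1)" and i: "i \<in> {1..n}" and H: "tame ({1..n} - {i}) H"
  shows "(LINT y|lborel. indicator (region l) (x(i := y))
      *\<^sub>R (weight (x(i := y)) * (H (x(i := y)) * scaled_log_derivative i (x(i := y))))) = 0"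
    (is "(LINT y|lborel. indicator _ _ *\<^sub>R ?f y) = 0")
proof (cases "\<exists>y. x(i := y) \<in> region l")
  case True
  then obtain y0 where y0: "x(i := y0) \<in> region l" by blast
  let ?I = "{1..n} - {i}"
  let ?c = "H x * (\<Prod>k\<in>?I. point_weight (x k)) * vandermonde ?I \<gamma> x"
  let ?F = "\<lambda>y. raised_weight y * (\<Prod>k\<in>?I. abs_powr (y - x k) (2 * \<gamma>))
    * ((\<Sum>s=1..p. (\<alpha>(p := \<alpha> p + 1)) s / of_real (y - z s)) + (\<Sum>k\<in>?I. 2 * \<gamma> / of_real (y - x k)))"
  have "?f y = ?c * ?F y" if "x(i := y) \<in> region l" for y
  proof (rule weight_log_derivative_section[OF i])
    show "y \<le> z p" using region_subset_cube[OF l] that i unfolding cube_def by force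
    show "depends_only_on ?I H" using H by (simp add: tame_def)
  qed
  then have "indicator (region l) (x(i := y)) *\<^sub>R ?f y
      = ?c * (indicator {y. x(i := y) \<in> region l} y *\<^sub>R ?F y)" for y
    by (cases "x(i := y) \<in> region l") (simp_all only: indicator_simps mem_Collect_eq scaleR_one
      scaleR_zero_left mult_zero_right not_False_eq_True)
  then show ?thesis
    using integral_raised_weight_section[OF l i y0]
    by (simp only: set_lebesgue_integral_def integral_mult_right_zero mult_zero_right)
qed simp

lemma integral_by_parts:
  assumes l: "l \<in> Zset n (p - 1)" and i: "i \<in> {1..n}" and H: "tame ({1..n} - {i}) H"
  shows "(LINT t:region l|Rn n. weight t * (H t * scaled_log_derivative i t)) = 0"
    (is "(LINT t:region l|Rn n. ?f t) = 0")
proof -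
  let ?I = "{1..n} - {i}"
  have I: "insert i ?I = {1..n}" using i by auto
  have "integrable (lborel_on (insert i ?I)) (\<lambda>t. indicator (region l) t *\<^sub>R ?f t)"
    using set_integrable_weight_log_derivative[OF l i H] unfolding I set_integrable_def .
  then have "(LINT t|lborel_on (insert i ?I). indicator (region l) t *\<^sub>R ?f t)
      = (LINT x|lborel_on ?I. LINT y|lborel. indicator (region l) (x(i := y)) *\<^sub>R ?f (x(i := y)))"
    by (intro lborel_product.product_integral_insert) auto
  then show ?thesis
    unfolding I integral_weight_log_derivative_section[OF l i H] set_lebesgue_integral_def by simp
qed

end

section \<open>The contiguity relation for the determinant\<close>

lemma set_integral_sum:
  fixes f :: "'k \<Rightarrow> 'a \<Rightarrow> 'b :: {banach, second_countable_topology}"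
  assumes "\<And>k. k \<in> K \<Longrightarrow> set_integrable M A (f k)"
  shows "(LINT x:A|M. (\<Sum>k\<in>K. f k x)) = (\<Sum>k\<in>K. LINT x:A|M. f k x)"
  using assms unfolding set_integrable_def set_lebesgue_integral_def scaleR_sum_right
  by (rule Bochner_Integration.integral_sum)

lemma set_integral_sum_mset:
  fixes f :: "'k \<Rightarrow> 'a \<Rightarrow> 'b :: {banach, second_countable_topology}"
  assumes "\<And>k. k \<in># K \<Longrightarrow> set_integrable M A (f k)"
  shows "set_integrable M A (\<lambda>x. \<Sum>k\<in>#K. f k x)" "(LINT x:A|M. (\<Sum>k\<in>#K. f k x)) = (\<Sum>k\<in>#K. LINT x:A|M. f k x)"
  using assms by (induction K) (auto simp: set_integrable_def set_lebesgue_integral_def scaleR_add_right)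

lemma sum_mset_negf: "(\<Sum>x\<in>#M. - f x :: 'a :: ab_group_add) = - (\<Sum>x\<in>#M. f x)"
  by (induction M) auto

lemma sym_prod_cong_functions:
  "(\<And>s i. s \<in># M \<Longrightarrow> i \<in> I \<Longrightarrow> f s (t i) = g s (t i)) \<Longrightarrow> sym_prod (image_mset f M) t I = sym_prod (image_mset g M) t I"
proof (induction M arbitrary: I)
  case (add s M)
  have "sym_prod (image_mset f M) t (I - {i}) = sym_prod (image_mset g M) t (I - {i})" for i
    by (rule add.IH) (use add.prems in auto)
  then show ?case using add.prems by (simp add: sym_prod_add_mset)
qed simp

context configuration
begin

definition V :: "(real \<Rightarrow> complex) multiset \<Rightarrow> (nat \<Rightarrow> nat) \<Rightarrow> complex" where
  "V M l = (if l \<in> Zset n (p - 1) then LINT t:region l|Rn n. weight t * sym_prod M t {1..n} else 0)"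

definition kernel :: "(real \<Rightarrow> complex) \<Rightarrow> real \<Rightarrow> real \<Rightarrow> complex" where
  "kernel b u v = (of_real (u - z p) * b v - of_real (v - z p) * b u) / of_real (u - v)"

definition pair_sum :: "(real \<Rightarrow> complex) \<Rightarrow> (real \<Rightarrow> complex) multiset \<Rightarrow> (nat \<Rightarrow> real) \<Rightarrow> complex" where
  "pair_sum b N t = (\<Sum>i=1..n. \<Sum>k\<in>{1..n} - {i}. kernel b (t i) (t k) * sym_prod N t ({1..n} - {i} - {k}))"

definition pair :: "(real \<Rightarrow> complex) \<Rightarrow> (real \<Rightarrow> complex) multiset \<Rightarrow> (nat \<Rightarrow> nat) \<Rightarrow> complex" where
  "pair b N l = (if l \<in> Zset n (p - 1) then LINT t:region l|Rn n. weight t * pair_sum b N t else 0)"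

lemma weight_eq_0:
  assumes "i \<in> {1..n}"
  shows "s \<in> {1..p} \<Longrightarrow> t i = z s \<Longrightarrow> weight t = 0" "k \<in> {1..n} - {i} \<Longrightarrow> t i = t k \<Longrightarrow> weight t = 0"
proof -
  show "weight t = 0" if "s \<in> {1..p}" "t i = z s"
    unfolding weight_insert[OF assms] using point_weight_z[OF that(1)] that(2) by simp
  show "weight t = 0" if "k \<in> {1..n} - {i}" "t i = t k"
  proof -
    have "(\<Prod>k\<in>{1..n} - {i}. abs_powr (t i - t k) (2 * \<gamma>)) = 0" using that by (intro prod_zero) auto
    then show ?thesis unfolding weight_insert[OF assms] by simp
  qed
qed

lemma set_integrable_sym_prod:
  assumes "l \<in> Zset n (p - 1)" "set_mset M \<subseteq> admissible" "size M = n"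
  shows "set_integrable (Rn n) (region l) (\<lambda>t. weight t * sym_prod M t {1..n})"
  using assms by (intro set_integrable_weight_tame tame_sym_prod) auto

lemma kernel_eq:
  "kernel b u v = - (b v * (of_real (z p - u) / of_real (u - v))) - b u * (of_real (z p - v) / of_real (v - u))"
proof -
  have "of_real (v - u) = - (of_real (u - v) :: complex)" "of_real (u - z p) = - (of_real (z p - u) :: complex)"
    "of_real (v - z p) = - (of_real (z p - v) :: complex)" by simp_all
  then show ?thesis unfolding kernel_def by (simp only:) (simp add: diff_divide_distrib mult_ac del: of_real_diff)
qed

context
  fixes N :: "(real \<Rightarrow> complex) multiset"
  assumes N: "set_mset N \<subseteq> admissible" "size N + 2 = n"
begin

lemma set_integrable_kernel:
  assumes l: "l \<in> Zset n (p - 1)" and b: "b \<in> admissible" and i: "i \<in> {1..n}" and k: "k \<in> {1..n} - {i}"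
  shows "set_integrable (Rn n) (region l) (\<lambda>t. weight t
      * (kernel b (t i) (t k) * sym_prod N t ({1..n} - {i} - {k})))"
proof -
  define S where "S t = sym_prod N t ({1..n} - {i} - {k})" for t :: "nat \<Rightarrow> real"
  have "tame ({1..n} - {i} - {k}) S"
    unfolding S_def using N i k by (intro tame_sym_prod) auto
  then have "tame (insert k ({1..n} - {i} - {k})) (\<lambda>t. b (t k) * S t)"
    "tame (insert i ({1..n} - {i} - {k})) (\<lambda>t. b (t i) * S t)"
    by (rule tame_times_admissible[OF _ b]; use i k in simp)+
  moreover have "insert k ({1..n} - {i} - {k}) = {1..n} - {i}" "insert i ({1..n} - {i} - {k}) = {1..n} - {k}"
    using i k by auto
  ultimately have "tame ({1..n} - {i}) (\<lambda>t. b (t k) * S t)" "tame ({1..n} - {k}) (\<lambda>t. b (t i) * S t)"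
    by (simp_all only:)
  then have "set_integrable (Rn n) (region l) (\<lambda>t.
      - 1 * (weight t * (b (t k) * S t * (of_real (z p - t i) / of_real (t i - t k))))
      - weight t * (b (t i) * S t * (of_real (z p - t k) / of_real (t k - t i))))"
    using i k by (intro set_integral_diff set_integrable_mult_right set_integrable_weight_quotient[OF l]) auto
  then show ?thesis
    by (rule set_integrable_cong[THEN iffD1, rotated -1])
      (simp_all add: kernel_eq S_def algebra_simps del: of_real_diff)
qed

lemma set_integrable_pair_sum:
  assumes "l \<in> Zset n (p - 1)" "b \<in> admissible"
  shows "set_integrable (Rn n) (region l) (\<lambda>t. weight t * pair_sum b N t)"
  unfolding pair_sum_def sum_distrib_left using assms by (intro set_integrable_sum set_integrable_kernel)

lemma pair_diff:
  assumes "b \<in> admissible" "c \<in> admissible"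
  shows "pair (b - c) N = pair b N - pair c N"
proof
  fix l
  have "kernel (b - c) u v = kernel b u v - kernel c u v" for u v
    unfolding kernel_def by (simp add: algebra_simps diff_divide_distrib add_divide_distrib)
  then have "pair_sum (b - c) N t = pair_sum b N t - pair_sum c N t" for t
    by (simp add: pair_sum_def left_diff_distrib sum_subtractf)
  then show "pair (b - c) N l = (pair b N - pair c N) l"
    using set_integral_diff[OF set_integrable_pair_sum set_integrable_pair_sum, of l b c] assms
    by (simp add: pair_def right_diff_distrib)
qed

lemma pair_eq_V:
  assumes kernel: "\<And>u v. u \<noteq> v \<Longrightarrow> u \<notin> z ` {1..p} \<Longrightarrow> v \<notin> z ` {1..p} \<Longrightarrow> kernel b u v = e * (b u * b v)"
  shows "pair b N l = e * V (add_mset b (add_mset b N)) l"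
proof -
  have "weight t * pair_sum b N t = e * (weight t * sym_prod (add_mset b (add_mset b N)) t {1..n})" for t
  proof (cases "weight t = 0")
    case False
    have "kernel b (t i) (t k) = e * (b (t i) * b (t k))" if "i \<in> {1..n}" "k \<in> {1..n} - {i}" for i k
    proof (rule kernel)
      show "t i \<noteq> t k" using weight_eq_0(2)[OF that] False by blast
      show "t i \<notin> z ` {1..p}" using weight_eq_0(1)[OF that(1)] False by blast
      show "t k \<notin> z ` {1..p}" using weight_eq_0(1)[of k] that(2) False by blast
    qed
    then show ?thesis
      unfolding pair_sum_def sym_prod_add_mset_2 by (simp add: sum_distrib_left mult_ac)
  qed simp
  then show ?thesis
    by (cases "l \<in> Zset n (p - 1)")
      (simp_all only: pair_def V_def if_True if_False set_integral_mult_right mult_zero_right)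
qed

lemma pair_one: "pair (\<lambda>_. 1) N = V (add_mset (\<lambda>_. 1) (add_mset (\<lambda>_. 1) N))"
proof
  have "kernel (\<lambda>_. 1) u v = 1 * (1 * 1)" if "u \<noteq> v" for u v
    using that by (simp add: kernel_def)
  then show "pair (\<lambda>_. 1) N l = V (add_mset (\<lambda>_. 1) (add_mset (\<lambda>_. 1) N)) l" for l
    using pair_eq_V[of "\<lambda>_. 1" 1] by simp
qed

lemma pair_h:
  assumes s: "s \<in> {1..<p}"
  shows "pair (h s) N = - V (add_mset (h s) (add_mset (h s) N))"
proof
  have "kernel (h s) u v = - 1 * (h s u * h s v)" if "u \<noteq> v" "u \<notin> z ` {1..p}" "v \<notin> z ` {1..p}" for u v
  proof -
    have "u \<noteq> z s" "v \<noteq> z s" using that s by auto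
    then have "of_real (u - v) \<noteq> (0 :: complex)" "of_real (u - z s) \<noteq> (0 :: complex)"
      "of_real (v - z s) \<noteq> (0 :: complex)"
      using that by (simp_all del: of_real_diff)
    then show ?thesis by (simp add: kernel_def h_def divide_simps) (simp add: algebra_simps)
  qed
  then show "pair (h s) N l = (- V (add_mset (h s) (add_mset (h s) N))) l" for l
    using pair_eq_V[of "h s" "- 1"] by simp
qed

end

lemma V_diff:
  assumes "b \<in> admissible" "c \<in> admissible" "set_mset N \<subseteq> admissible" "size N + 1 = n"
  shows "V (add_mset (b - c) N) = V (add_mset b N) - V (add_mset c N)"
proof
  fix l
  have "sym_prod (add_mset (b - c) N) t {1..n}
      = sym_prod (add_mset b N) t {1..n} - sym_prod (add_mset c N) t {1..n}" for t
    by (simp add: sym_prod_add_mset left_diff_distrib sum_subtractf)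
  then show "V (add_mset (b - c) N) l = (V (add_mset b N) - V (add_mset c N)) l"
    using set_integral_diff[OF set_integrable_sym_prod set_integrable_sym_prod, of l "add_mset b N"
      "add_mset c N"] assms
    by (simp add: V_def right_diff_distrib)
qed

lemma sum_drift:
  "(\<Sum>i=1..n. sym_prod N t ({1..n} - {i}) * drift (t i))
    = (\<Sum>s=1..<p. \<alpha> s * sym_prod (add_mset (h s) N) t {1..n}) - (1 + \<alpha> p) * sym_prod (add_mset (\<lambda>_. 1) N) t {1..n}"
  unfolding drift_def sym_prod_add_mset right_diff_distrib sum_subtractf sum_distrib_left sum.swap[of _ "{1..n}"]
  by (simp add: mult_ac)

lemma sum_quotients:
  assumes N: "size N + 1 = n"
  shows "2 * (\<Sum>i=1..n. sym_prod N t ({1..n} - {i}) * (\<Sum>k\<in>{1..n} - {i}. of_real (z p - t i) / of_real (t i - t k)))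
    = - (\<Sum>b\<in>#N. pair_sum b (N - {#b#}) t)"
proof -
  let ?I = "{1..n}"
  define q where "q i k = (of_real (z p - t i) / of_real (t i - t k) :: complex)" for i k
  define S where "S b i k = sym_prod (N - {#b#}) t (?I - {i} - {k})" for b i k
  have S_sym: "S b i k = S b k i" for b i k
    unfolding S_def by (simp only: Diff_insert2[symmetric] insert_commute)
  have symmetrise: "2 * (\<Sum>i\<in>?I. \<Sum>k\<in>?I - {i}. q i k * (b (t k) * S b i k)) = - pair_sum b (N - {#b#}) t" for b
  proof -
    have "2 * (\<Sum>i\<in>?I. \<Sum>k\<in>?I - {i}. q i k * (b (t k) * S b i k))
        = (\<Sum>i\<in>?I. \<Sum>k\<in>?I - {i}. q i k * (b (t k) * S b i k) + q k i * (b (t i) * S b k i))"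
      using sum_off_diagonal_swap[of ?I "\<lambda>i k. q i k * (b (t k) * S b i k)"] by (simp add: sum.distrib)
    also have "\<dots> = (\<Sum>i\<in>?I. \<Sum>k\<in>?I - {i}. - (kernel b (t i) (t k) * S b i k))"
      by (intro sum.cong refl) (simp add: kernel_eq q_def S_sym[of b _ i for i] algebra_simps del: of_real_diff)
    finally show ?thesis by (simp add: pair_sum_def S_def sum_negf)
  qed
  have "(\<Sum>i\<in>?I. sym_prod N t (?I - {i}) * (\<Sum>k\<in>?I - {i}. q i k))
      = (\<Sum>i\<in>?I. \<Sum>k\<in>?I - {i}. \<Sum>b\<in>#N. q i k * (b (t k) * S b i k))"
    unfolding sum_distrib_left
  proof (intro sum.cong refl)
    fix i k assume "i \<in> ?I" "k \<in> ?I - {i}"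
    then have "sym_prod N t (?I - {i}) = (\<Sum>b\<in>#N. b (t k) * S b i k)"
      unfolding S_def using N by (intro sym_prod_expand_column) auto
    then show "sym_prod N t (?I - {i}) * q i k = (\<Sum>b\<in>#N. q i k * (b (t k) * S b i k))"
      by (simp add: sum_mset_distrib_left mult.commute)
  qed
  also have "\<dots> = (\<Sum>b\<in>#N. \<Sum>i\<in>?I. \<Sum>k\<in>?I - {i}. q i k * (b (t k) * S b i k))"
    by (simp only: sum_sum_mset_swap)
  finally show ?thesis
    unfolding q_def[symmetric] by (simp only: sum_mset_distrib_left symmetrise sum_mset_negf)
qed

lemma sum_scaled_log_derivative:
  assumes N: "size N + 1 = n"
  shows "(\<Sum>i=1..n. sym_prod N t ({1..n} - {i}) * scaled_log_derivative i t)
    = (\<Sum>s=1..<p. \<alpha> s * sym_prod (add_mset (h s) N) t {1..n}) - (1 + \<alpha> p) * sym_prod (add_mset (\<lambda>_. 1) N) t {1..n}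
      - \<gamma> * (\<Sum>b\<in>#N. pair_sum b (N - {#b#}) t)"
proof -
  have "(\<Sum>i=1..n. sym_prod N t ({1..n} - {i}) * scaled_log_derivative i t)
    = (\<Sum>i=1..n. sym_prod N t ({1..n} - {i}) * drift (t i))
      + \<gamma> * (2 * (\<Sum>i=1..n. sym_prod N t ({1..n} - {i})
        * (\<Sum>k\<in>{1..n} - {i}. of_real (z p - t i) / of_real (t i - t k))))"
    unfolding scaled_log_derivative_def
    by (simp add: sum_distrib_left sum.distrib distrib_left mult_ac del: of_real_diff)
  then show ?thesis unfolding sum_drift sum_quotients[OF N] by simp
qed

lemma integral_sum_scaled_log_derivative:
  assumes l: "l \<in> Zset n (p - 1)" and N: "set_mset N \<subseteq> admissible" "size N + 1 = n"
  shows "(LINT t:region l|Rn n. (\<Sum>i=1..n. weight t * (sym_prod N t ({1..n} - {i}) * scaled_log_derivative i t)))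
    = (\<Sum>s=1..<p. \<alpha> s * V (add_mset (h s) N) l) - (1 + \<alpha> p) * V (add_mset (\<lambda>_. 1) N) l
      - \<gamma> * (\<Sum>b\<in>#N. pair b (N - {#b#}) l)"
proof -
  have pair_integrable: "set_integrable (Rn n) (region l) (\<lambda>t. weight t * pair_sum b (N - {#b#}) t)"
    if "b \<in># N" for b
    using N that size_Suc_Diff1[OF that] by (intro set_integrable_pair_sum l) (auto dest: in_diffD)
  have V_integrable: "set_integrable (Rn n) (region l) (\<lambda>t. weight t * sym_prod (add_mset f N) t {1..n})"
    if "f \<in> admissible" for f
    using N that by (intro set_integrable_sym_prod l) auto
  let ?h_part = "\<lambda>t. \<Sum>s=1..<p. \<alpha> s * (weight t * sym_prod (add_mset (h s) N) t {1..n})"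
    and ?one_part = "\<lambda>t. (1 + \<alpha> p) * (weight t * sym_prod (add_mset (\<lambda>_. 1) N) t {1..n})"
    and ?pair_part = "\<lambda>t. \<gamma> * (\<Sum>b\<in>#N. weight t * pair_sum b (N - {#b#}) t)"
  have "(\<Sum>i=1..n. weight t * (sym_prod N t ({1..n} - {i}) * scaled_log_derivative i t))
      = ?h_part t - ?one_part t - ?pair_part t" for t
    unfolding sum_distrib_left[symmetric] sum_scaled_log_derivative[OF N(2)]
    by (simp add: sum_distrib_left algebra_simps flip: sum_mset_distrib_left)
  moreover have "set_integrable (Rn n) (region l) ?h_part" "set_integrable (Rn n) (region l) ?one_part"
    "set_integrable (Rn n) (region l) ?pair_part"
    using V_integrable[OF h_admissible] V_integrable[OF admissible_continuous[of "\<lambda>_. 1"]]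
      set_integral_sum_mset(1)[OF pair_integrable]
    by (intro set_integrable_sum set_integrable_mult_right; simp)+
  moreover have "(LINT t:region l|Rn n. ?h_part t) = (\<Sum>s=1..<p. \<alpha> s * V (add_mset (h s) N) l)"
    using l V_integrable[OF h_admissible]
    by (subst set_integral_sum) (auto simp: V_def intro: set_integrable_mult_right)
  moreover have "(LINT t:region l|Rn n. ?pair_part t) = \<gamma> * (\<Sum>b\<in>#N. pair b (N - {#b#}) l)"
    using l set_integral_sum_mset(2)[where f="\<lambda>b t. weight t * pair_sum b (N - {#b#}) t", OF pair_integrable]
    by (simp add: pair_def)
  ultimately show ?thesis
    using l by (simp add: set_integral_diff V_def)
qed

lemma V_ibp:
  assumes N: "set_mset N \<subseteq> admissible" "size N + 1 = n"
  shows "(1 + \<alpha> p) * V (add_mset (\<lambda>_. 1) N) l - (\<Sum>s=1..<p. \<alpha> s * V (add_mset (h s) N) l)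
    + \<gamma> * (\<Sum>b\<in>#N. pair b (N - {#b#}) l) = 0"
proof (cases "l \<in> Zset n (p - 1)")
  case l: True
  have tame: "tame ({1..n} - {i}) (\<lambda>t. sym_prod N t ({1..n} - {i}))" if "i \<in> {1..n}" for i
    using N that by (intro tame_sym_prod) auto
  have "(LINT t:region l|Rn n. (\<Sum>i=1..n. weight t * (sym_prod N t ({1..n} - {i}) * scaled_log_derivative i t)))
      = (\<Sum>i=1..n. LINT t:region l|Rn n. weight t * (sym_prod N t ({1..n} - {i}) * scaled_log_derivative i t))"
    by (intro set_integral_sum set_integrable_weight_log_derivative[OF l _ tame])
  also have "\<dots> = 0" by (intro sum.neutral ballI integral_by_parts[OF l _ tame])
  finally show ?thesis
    unfolding integral_sum_scaled_log_derivative[OF l N] by (simp add: algebra_simps)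
qed (simp add: V_def pair_def)

lemma interval_pred_p: "{1..p - 1} = {1..<p}"
  using p_ge_2 by auto

lemma Re_sum_\<alpha>_nonneg: "Re (\<Sum>s=1..<p. \<alpha> s) \<ge> 0"
  unfolding Re_sum using Re_\<alpha>_pos by (intro sum_nonneg) (auto intro: less_imp_le)

sublocale functional: symmetric_functional V pair admissible "\<lambda>_. 1" h n "p - 1" \<alpha> \<gamma> "1 + \<alpha> p"
proof
  show "p - 1 \<ge> 1" using p_ge_2 by simp
  show "1 + \<alpha> p + (\<Sum>s=1..p-1. \<alpha> s) + of_nat j * \<gamma> \<noteq> 0" for j :: nat
  proof -
    have "Re (1 + \<alpha> p + (\<Sum>s=1..p-1. \<alpha> s) + of_nat j * \<gamma>) > 0"
      using Re_sum_\<alpha>_nonneg Re_\<alpha>_p Re_\<gamma>_pos unfolding interval_pred_p by (simp add: add_pos_nonneg)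
    then show ?thesis by (metis less_irrefl zero_complex.sel(1))
  qed
  show "(\<lambda>_. 1) \<in> admissible" by (intro admissible_continuous continuous_intros)
qed (simp_all add: interval_pred_p[simplified] V_ibp[simplified] V_diff pair_diff pair_one pair_h h_admissible
  admissible_diff)

end

lemma omega_eq_sym_prod:
  assumes m: "m \<in> Zset n p"
  shows "omega n p z m t
      = sym_prod (image_mset (\<lambda>s x. 1 / of_real (x - z s)) (Abs_multiset m)) t {1..n} / (\<Prod>s=1..p. fact (m s))"
proof -
  let ?f = "\<lambda>s x. 1 / of_real (x - z s) :: complex"
  have "omega n p z m t = (\<Sum>\<sigma> | \<sigma> permutes {1..n}. (\<Prod>j=1..n. ?f (site m j) (t (\<sigma> j))) / (\<Prod>s=1..p. fact (m s)))"
  proof -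
    have "(\<Prod>s=1..p. \<Prod>j\<in>Gam m s. ?f s (t (\<sigma> j))) = (\<Prod>j=1..n. ?f (site m j) (t (\<sigma> j)))" for \<sigma>
      by (rule prod_Gam_site[OF m])
    then show ?thesis unfolding omega_def prod.distrib by (simp add: prod_dividef mult.commute)
  qed
  also have "\<dots> = sym_prod (image_mset (\<lambda>j. ?f (site m j)) (mset_set {1..n})) t {1..n} / (\<Prod>s=1..p. fact (m s))"
    by (subst sum_permutations_eq_sym_prod[of "{1..n}" "\<lambda>j. ?f (site m j)" t, symmetric])
      (simp_all only: sum_divide_distrib finite_atLeastAtMost)
  also have "image_mset (\<lambda>j. ?f (site m j)) (mset_set {1..n}) = image_mset ?f (Abs_multiset m)"
    by (simp flip: image_mset_site[OF m] add: image_mset.compositionality o_def)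
  finally show ?thesis .
qed

context configuration
begin

definition entry :: "(nat \<Rightarrow> nat) \<Rightarrow> (nat \<Rightarrow> nat) \<Rightarrow> complex" where
  "entry l m = (LINT t:region l|Rn n. weight t * omega n p z m t)"

abbreviation (input) simple_pole :: "nat \<Rightarrow> real \<Rightarrow> complex" where
  "simple_pole s x \<equiv> 1 / of_real (x - z s)"

abbreviation (input) multiplicity_factor :: "(nat \<Rightarrow> nat) \<Rightarrow> complex" where
  "multiplicity_factor m \<equiv> \<Prod>s=1..p. fact (m s)"

lemma Zset_pred_p_subset: "Zset n (p - 1) \<subseteq> Zset n p"
  by (intro Zset_subset) simp

lemma V_g_eq_entry:
  assumes l: "l \<in> Zset n (p - 1)" and m: "m \<in> Zset n (p - 1)"
  shows "V (image_mset functional.g (Abs_multiset m)) l / multiplicity_factor m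
      = (\<Prod>s=1..p - 1. of_real (z p - z s) ^ m s) * entry l m"
proof -
  let ?M = "Abs_multiset m"
  have integrand: "weight t * sym_prod (image_mset functional.g ?M) t {1..n}
      = (\<Prod>s\<in>#?M. of_real (z p - z s)) * (weight t * sym_prod (image_mset simple_pole ?M) t {1..n})" for t
  proof (cases "weight t = 0")
    case False
    have "functional.g s (t i) = of_real (z p - z s) * simple_pole s (t i)" if "s \<in># ?M" "i \<in> {1..n}" for s i
    proof -
      have "s \<in> {1..p}" using set_Abs_multiset_Zset[OF subsetD[OF Zset_pred_p_subset m]] that(1) by blast
      then have "t i \<noteq> z s" using weight_eq_0(1)[OF that(2)] False by metis
      moreover have "of_real (z p - t i) = of_real (z p - z s) - (of_real (t i - z s) :: complex)" by simp
      ultimately show ?thesis by (simp add: functional.g_def h_def diff_divide_distrib del: of_real_diff)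
    qed
    then have "sym_prod (image_mset functional.g ?M) t {1..n}
        = sym_prod (image_mset (\<lambda>s x. of_real (z p - z s) * simple_pole s x) ?M) t {1..n}"
      by (intro sym_prod_cong_functions) auto
    then show ?thesis unfolding sym_prod_scale by simp
  qed simp
  have "entry l m = (LINT t:region l|Rn n. weight t
      * sym_prod (image_mset simple_pole ?M) t {1..n}) / multiplicity_factor m"
    unfolding entry_def omega_eq_sym_prod[OF subsetD[OF Zset_pred_p_subset m]] times_divide_eq_right
    by (rule set_integral_divide_zero)
  moreover have "V (image_mset functional.g ?M) l
      = (\<Prod>s=1..p - 1. of_real (z p - z s) ^ m s)
        * (LINT t:region l|Rn n. weight t * sym_prod (image_mset simple_pole ?M) t {1..n})"
    unfolding V_def if_P[OF l] integrand set_integral_mult_right prod_mset_Zset[OF m] ..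
  ultimately show ?thesis by simp
qed

lemma configuration_shifted: "configuration p z (\<alpha>(p := \<alpha> p + of_nat K)) \<gamma>"
  by standard (use p_ge_2 z_Suc_less Re_\<alpha>_pos Re_\<alpha>_p Re_\<gamma>_pos in auto)

lemma weight_shifted:
  assumes "t \<in> cube"
  shows "configuration.weight n p z (\<alpha>(p := \<alpha> p + of_nat K)) \<gamma> t = weight t * (\<Prod>i=1..n. of_real ((z p - t i) ^ K))"
proof -
  interpret shifted: configuration n p z "\<alpha>(p := \<alpha> p + of_nat K)" \<gamma> by (rule configuration_shifted)
  have "shifted.point_weight (t i) = point_weight (t i) * of_real ((z p - t i) ^ K)" if "i \<in> {1..n}" for i
  proof -
    have "\<bar>t i - z p\<bar> = z p - t i" using assms that by (auto simp: cube_def)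
    then show ?thesis
      unfolding shifted.point_weight_def point_weight_def prod_last by (simp add: abs_powr_add_of_nat)
  qed
  then show ?thesis
    unfolding shifted.weight_def weight_def by (simp add: prod.distrib)
qed

lemma V_h_eq_entry:
  assumes l: "l \<in> Zset n (p - 1)" and m: "m \<in> Zset n (p - 1)"
  shows "V (image_mset h (Abs_multiset m)) l / multiplicity_factor m
      = configuration.entry n p z (\<alpha>(p := \<alpha> p + 1)) \<gamma> l m"
proof -
  interpret shifted: configuration n p z "\<alpha>(p := \<alpha> p + 1)" \<gamma> using configuration_shifted[of 1] by simp
  let ?M = "Abs_multiset m"
  have "sym_prod (image_mset h ?M) t {1..n}
      = (\<Prod>i=1..n. of_real (z p - t i)) * sym_prod (image_mset simple_pole ?M) t {1..n}" for t
  proof -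
    have "image_mset h ?M = image_mset (\<lambda>f x. of_real (z p - x) * f x) (image_mset simple_pole ?M)"
      by (simp add: image_mset.compositionality o_def h_def[abs_def])
    then show ?thesis
      using sym_prod_mult[of "{1..n}" "image_mset simple_pole ?M"] by (simp add: size_Abs_multiset_Zset[OF m])
  qed
  then have "weight t * sym_prod (image_mset h ?M) t {1..n} / multiplicity_factor m
      = shifted.weight t * omega n p z m t" if "t \<in> region l" for t
    using weight_shifted[of t 1] region_subset_cube[OF l] that subsetD[OF Zset_pred_p_subset m]
    by (auto simp: omega_eq_sym_prod)
  then have "indicator (region l) t *\<^sub>R (weight t * sym_prod (image_mset h ?M) t {1..n} / multiplicity_factor m)
      = indicator (region l) t *\<^sub>R (shifted.weight t * omega n p z m t)" for t
    by (cases "t \<in> region l") (simp_all only: indicator_simps scaleR_zero_left not_False_eq_True)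
  then have "(LINT t:region l|Rn n. weight t * sym_prod (image_mset h ?M) t {1..n} / multiplicity_factor m)
      = shifted.entry l m"
    unfolding shifted.entry_def set_lebesgue_integral_def by (simp only:)
  then show ?thesis using l by (simp add: V_def)
qed

definition contiguity_numerator :: "nat \<Rightarrow> complex" where
  "contiguity_numerator r = 1 + \<alpha> p + of_nat r * \<gamma>"

definition contiguity_denominator :: "nat \<Rightarrow> complex" where
  "contiguity_denominator r = 1 + (\<Sum>s=1..p. \<alpha> s) + of_nat (2 * n - 2 - r) * \<gamma>"

definition distance_product :: complex where
  "distance_product = (\<Prod>m\<in>Zset n (p - 1). \<Prod>s=1..p - 1. of_real (z p - z s) ^ m s)"

lemma det_entry_shift:
  "det_on (Zset n (p - 1)) (configuration.entry n p z (\<alpha>(p := \<alpha> p + 1)) \<gamma>)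
   = (\<Prod>m\<in>Zset n (p - 1). \<Prod>r<m 1. contiguity_numerator r / contiguity_denominator r)
     * distance_product * det_on (Zset n (p - 1)) entry"
proof -
  let ?Z = "Zset n (p - 1)" and ?F = "\<lambda>m. 1 / multiplicity_factor m"
  have A: "functional.A = 1 + (\<Sum>s=1..p. \<alpha> s)"
    unfolding sum_last interval_pred_p by (simp add: add_ac)
  have "det_on ?Z (configuration.entry n p z (\<alpha>(p := \<alpha> p + 1)) \<gamma>)
      = det_on ?Z (\<lambda>l m. ?F m * V (image_mset h (Abs_multiset m)) l)"
    by (intro det_on_cong) (simp flip: V_h_eq_entry)
  also have "\<dots> = (\<Prod>m\<in>?Z. ?F m) * ((\<Prod>m\<in>?Z. \<Prod>r<m 1. contiguity_numerator r / contiguity_denominator r)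
      * det_on ?Z (\<lambda>l m. V (image_mset functional.g (Abs_multiset m)) l))"
    unfolding det_on_scale_columns functional.det_on_h_eq_det_on_g A
    by (simp add: contiguity_numerator_def contiguity_denominator_def)
  also have "\<dots> = (\<Prod>m\<in>?Z. \<Prod>r<m 1. contiguity_numerator r / contiguity_denominator r)
      * det_on ?Z (\<lambda>l m. ?F m * V (image_mset functional.g (Abs_multiset m)) l)"
    unfolding det_on_scale_columns by (simp only: mult_ac)
  also have "det_on ?Z (\<lambda>l m. ?F m * V (image_mset functional.g (Abs_multiset m)) l)
      = det_on ?Z (\<lambda>l m. (\<Prod>s=1..p - 1. of_real (z p - z s) ^ m s) * entry l m)"
    by (intro det_on_cong) (simp only: V_g_eq_entry[symmetric] times_divide_eq_left mult_1)
  also have "\<dots> = distance_product * det_on ?Z entry"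
    unfolding det_on_scale_columns distance_product_def ..
  finally show ?thesis by (simp only: mult_ac)
qed

lemma det_entry_iterate:
  "det_on (Zset n (p - 1)) (configuration.entry n p z (\<alpha>(p := \<alpha> p + of_nat K)) \<gamma>)
    = (\<Prod>m\<in>Zset n (p - 1). \<Prod>r<m 1. pochhammer (contiguity_numerator r) K / pochhammer (contiguity_denominator r) K)
      * distance_product ^ K * det_on (Zset n (p - 1)) entry"
proof (induction K)
  case (Suc K)
  interpret shifted: configuration n p z "\<alpha>(p := \<alpha> p + of_nat K)" \<gamma> by (rule configuration_shifted)
  have "(\<alpha>(p := \<alpha> p + of_nat K))(p := (\<alpha>(p := \<alpha> p + of_nat K)) p + 1) = \<alpha>(p := \<alpha> p + of_nat (Suc K))"
    by (simp add: add_ac)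
  moreover have "shifted.contiguity_numerator r = contiguity_numerator r + of_nat K" for r
    by (simp add: shifted.contiguity_numerator_def contiguity_numerator_def)
  moreover have "shifted.contiguity_denominator r = contiguity_denominator r + of_nat K" for r
    unfolding shifted.contiguity_denominator_def contiguity_denominator_def sum_last by simp
  moreover have "shifted.distance_product = distance_product"
    by (simp add: shifted.distance_product_def distance_product_def)
  ultimately have "det_on (Zset n (p - 1)) (configuration.entry n p z (\<alpha>(p := \<alpha> p + of_nat (Suc K))) \<gamma>)
      = (\<Prod>m\<in>Zset n (p - 1). \<Prod>r<m 1. (contiguity_numerator r + of_nat K) / (contiguity_denominator r + of_nat K))
        * distance_product * det_on (Zset n (p - 1)) shifted.entry"
    using shifted.det_entry_shift by (simp only:)
  then show ?case
    unfolding Suc.IH pochhammer_Suc times_divide_times_eq[symmetric] prod.distrib power_Suc by (simp only: mult_ac)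
qed simp

end

section \<open>Zooming in on the left end points\<close>

context configuration
begin

definition width :: "nat \<Rightarrow> real" where
  "width s = z p - z s"

definition near_ratio :: real where
  "near_ratio = (MIN s\<in>{1..<p}. (z (s + 1) - z s) / (2 * width s))"

lemma width_pos: "s \<in> {1..<p} \<Longrightarrow> width s > 0"
  using z_less[of s p] by (simp add: width_def)

lemma near_ratio_le:
  assumes s: "s \<in> {1..<p}"
  shows "near_ratio * width s \<le> (z (s + 1) - z s) / 2"
proof -
  have "near_ratio \<le> (z (s + 1) - z s) / (2 * width s)"
    unfolding near_ratio_def using s by (intro Min_le) auto
  then show ?thesis using width_pos[OF s] by (simp add: field_simps)
qed

lemma near_ratio_pos: "near_ratio > 0"
  unfolding near_ratio_def using p_ge_2 z_Suc_less width_pos by (subst Min_gr_iff) auto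

lemma near_ratio_le_half: "near_ratio \<le> 1 / 2"
  using near_ratio_le[of "p - 1"] width_pos[of "p - 1"] p_ge_2 by (simp add: width_def)

lemma near_left_end:
  assumes s: "s \<in> {1..<p}" and x: "z s \<le> x" "x \<le> z s + near_ratio * width s"
  shows "x \<le> z (s + 1)" "r \<in> {1..p} - {s} \<Longrightarrow> x - z s \<le> \<bar>x - z r\<bar>" "r \<in> {1..p} - {s} \<Longrightarrow> x \<noteq> z r"
proof -
  have half: "x - z s \<le> z (s + 1) - x" using near_ratio_le[OF s] x(2) by (simp add: field_simps)
  then show "x \<le> z (s + 1)" using x(1) by linarith
  show le: "x - z s \<le> \<bar>x - z r\<bar>" if r: "r \<in> {1..p} - {s}" for r
  proof (cases "r < s")
    case True
    then have "z r < z s" using r s by (intro z_less) auto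
    then show ?thesis using x by linarith
  next
    case False
    then have "z (s + 1) \<le> z r" using r s by (intro z_le) auto
    then show ?thesis using half by linarith
  qed
  show "x \<noteq> z r" if r: "r \<in> {1..p} - {s}" for r
  proof
    assume "x = z r"
    then have "z r = z s" using le[OF r] x(1) by simp
    then show False using inj_onD[OF inj_on_z, of r s] r s by auto
  qed
qed

definition outer_weight :: "nat \<Rightarrow> real \<Rightarrow> complex" where
  "outer_weight s x = (\<Prod>r\<in>{1..p} - {s}. abs_powr (x - z r) (\<alpha> r))"

lemma point_weight_eq_outer_weight:
  assumes "s \<in> {1..p}"
  shows "point_weight x = abs_powr (x - z s) (\<alpha> s) * outer_weight s x"
  unfolding point_weight_def outer_weight_def using assms by (intro prod.remove) auto

lemma isCont_outer_weight:
  assumes "s \<in> {1..<p}" "z s \<le> x" "x \<le> z s + near_ratio * width s"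
  shows "isCont (outer_weight s) x"
proof -
  have "isCont (\<lambda>x. abs_powr (x - z r) (\<alpha> r)) x" if "r \<in> {1..p} - {s}" for r
    using near_left_end(3)[OF assms that] by (intro isCont_o2[OF _ isCont_abs_powr] continuous_intros) simp
  then show ?thesis unfolding outer_weight_def[abs_def] by (intro continuous_prod) auto
qed

lemma outer_weight_bounded:
  obtains B where "\<And>s. s \<in> {1..<p} \<Longrightarrow> B s \<ge> 0"
    "\<And>s x. s \<in> {1..<p} \<Longrightarrow> z s \<le> x \<Longrightarrow> x \<le> z s + near_ratio * width s \<Longrightarrow> norm (outer_weight s x) \<le> B s"
proof -
  have "\<exists>B. \<forall>x\<in>{z s..z s + near_ratio * width s}. norm (outer_weight s x) \<le> B" if s: "s \<in> {1..<p}" for s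
  proof -
    have "continuous_on {z s..z s + near_ratio * width s} (outer_weight s)"
      using isCont_outer_weight[OF s] by (intro continuous_at_imp_continuous_on) auto
    then have "bounded (outer_weight s ` {z s..z s + near_ratio * width s})"
      by (intro compact_imp_bounded compact_continuous_image) auto
    then show ?thesis unfolding bounded_iff by blast
  qed
  then obtain B where "\<And>s x. s \<in> {1..<p} \<Longrightarrow> x \<in> {z s..z s + near_ratio * width s} \<Longrightarrow> norm (outer_weight s x) \<le> B s"
    by metis
  then show ?thesis by (intro that[of "\<lambda>s. max (B s) 0"]) (auto simp: le_max_iff_disj)
qed

definition near :: "(nat \<Rightarrow> nat) \<Rightarrow> (nat \<Rightarrow> real) \<Rightarrow> bool" where
  "near l t \<longleftrightarrow> (\<forall>i\<in>{1..n}. t i \<le> z (site l i) + near_ratio * width (site l i))"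

definition zoom :: "(nat \<Rightarrow> nat) \<Rightarrow> nat \<Rightarrow> (nat \<Rightarrow> real) \<Rightarrow> nat \<Rightarrow> real" where
  "zoom l K y = (\<lambda>i\<in>{1..n}. z (site l i) + width (site l i) / real K * y i)"

definition decay :: "(nat \<Rightarrow> nat) \<Rightarrow> (nat \<Rightarrow> real) \<Rightarrow> real" where
  "decay l t = (\<Prod>i=1..n. (z p - t i) / width (site l i))"

definition zoom_exponent :: "(nat \<Rightarrow> nat) \<Rightarrow> nat \<Rightarrow> complex" where
  "zoom_exponent l s = of_nat (l s) * \<alpha> s + of_nat (l s choose 2) * (2 * \<gamma>)"

definition zoom_factor :: "(nat \<Rightarrow> nat) \<Rightarrow> nat \<Rightarrow> complex" where
  "zoom_factor l K = (\<Prod>s=1..p - 1. abs_powr (real K / width s) (zoom_exponent l s))"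

definition pole_product :: "(nat \<Rightarrow> nat) \<Rightarrow> (nat \<Rightarrow> real) \<Rightarrow> complex" where
  "pole_product \<tau> t = (\<Prod>i=1..n. 1 / of_real (t i - z (\<tau> i)))"

definition interaction :: "(nat \<Rightarrow> nat) \<Rightarrow> (nat \<Rightarrow> real) \<Rightarrow> complex" where
  "interaction l t = (\<Prod>(r, s)\<in>ordered_pairs {1..p - 1}. \<Prod>i\<in>Gam l r. \<Prod>j\<in>Gam l s. abs_powr (t j - t i) (2 * \<gamma>))"

definition laguerre_product :: "(nat \<Rightarrow> nat) \<Rightarrow> (nat \<Rightarrow> real) \<Rightarrow> complex" where
  "laguerre_product l y = (\<Prod>s=1..p - 1. ordered_integrand (Gam l s) (laguerre_density (\<alpha> s)) \<gamma> y)"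

definition point_correction :: "(nat \<Rightarrow> nat) \<Rightarrow> (nat \<Rightarrow> nat) \<Rightarrow> nat \<Rightarrow> (nat \<Rightarrow> real) \<Rightarrow> nat \<Rightarrow> complex" where
  "point_correction l \<tau> K y i
      = of_real (exp (y i) * (1 - y i / real K) ^ K) * outer_weight (site l i) (zoom l K y i)
     * of_real ((zoom l K y i - z (site l i)) / (zoom l K y i - z (\<tau> i)))"

text \<open>What remains of the integrand near the left end points besides the Laguerre densities.\<close>

definition correction :: "(nat \<Rightarrow> nat) \<Rightarrow> (nat \<Rightarrow> nat) \<Rightarrow> nat \<Rightarrow> (nat \<Rightarrow> real) \<Rightarrow> complex" where
  "correction l \<tau> K y = (if \<forall>i\<in>{1..n}. y i \<le> near_ratio * real K
     then (\<Prod>i=1..n. point_correction l \<tau> K y i) * interaction l (zoom l K y)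
     else 0)"

context
  fixes l assumes l: "l \<in> Zset n (p - 1)"
begin

lemma site_less_p: "i \<in> {1..n} \<Longrightarrow> site l i \<in> {1..<p}"
  using site_in_range[OF l] by (simp add: interval_pred_p[simplified])

lemma width_site_pos: "i \<in> {1..n} \<Longrightarrow> width (site l i) > 0"
  by (intro width_pos site_less_p)

lemma zoom_Gam: "s \<in> {1..p - 1} \<Longrightarrow> i \<in> Gam l s \<Longrightarrow> zoom l K y i = z s + width s / real K * y i"
  using Gam_eq_site[OF l, of s] by (auto simp: zoom_def)

lemma mono_on_zoom_Gam:
  assumes "K > 0" and s: "s \<in> {1..p - 1}"
  shows "mono_on (Gam l s) (zoom l K y) \<longleftrightarrow> mono_on (Gam l s) y"
proof -
  have "zoom l K y i \<le> zoom l K y j \<longleftrightarrow> y i \<le> y j" if "i \<in> Gam l s" "j \<in> Gam l s" for i j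
    using zoom_Gam[OF s] that width_pos[of s] s assms(1)
    by (simp add: interval_pred_p[simplified] divide_le_cancel)
  then show ?thesis by (auto simp: mono_on_def)
qed

lemma zoom_near_iff:
  assumes K: "K > 0" and i: "i \<in> {1..n}"
  shows "z (site l i) \<le> zoom l K y i \<longleftrightarrow> 0 \<le> y i"
    "zoom l K y i \<le> z (site l i) + near_ratio * width (site l i) \<longleftrightarrow> y i \<le> near_ratio * real K"
  using width_site_pos[OF i] K i by (auto simp: zoom_def zero_le_mult_iff field_simps)

lemma zoom_in_region_iff:
  assumes K: "K > 0"
  shows "zoom l K y \<in> region l \<and> near l (zoom l K y)
    \<longleftrightarrow> (\<forall>i\<in>{1..n}. 0 \<le> y i \<and> y i \<le> near_ratio * real K) \<and> (\<forall>s\<in>{1..p - 1}. mono_on (Gam l s) y)"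
proof (intro iffI conjI ballI)
  let ?t = "zoom l K y"
  assume t: "?t \<in> region l \<and> near l ?t"
  show "0 \<le> y i" "y i \<le> near_ratio * real K" if i: "i \<in> {1..n}" for i
    using t i zoom_near_iff[OF K i, of y] by (auto simp: region_iff[OF l] near_def)
  show "mono_on (Gam l s) y" if s: "s \<in> {1..p - 1}" for s
  proof -
    have "mono_on {1..n} ?t" using t by (simp add: region_iff[OF l])
    moreover have "Gam l s \<subseteq> {1..n}" unfolding Gam_eq_site[OF l s] by blast
    ultimately show ?thesis using mono_on_subset mono_on_zoom_Gam[OF K s, of y] by blast
  qed
next
  let ?t = "zoom l K y"
  assume y: "(\<forall>i\<in>{1..n}. 0 \<le> y i \<and> y i \<le> near_ratio * real K) \<and> (\<forall>s\<in>{1..p - 1}. mono_on (Gam l s) y)"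
  have near: "z (site l i) \<le> ?t i" "?t i \<le> z (site l i) + near_ratio * width (site l i)" if "i \<in> {1..n}" for i
    using zoom_near_iff[OF K that, of y] y that by auto
  have below_next: "?t i \<le> z (site l i + 1)" if "i \<in> {1..n}" for i
    using near_left_end(1)[OF site_less_p[OF that] near[OF that]] .
  have "mono_on {1..n} ?t"
  proof (rule mono_onI)
    fix i j assume ij: "i \<in> {1..n}" "j \<in> {1..n}" "i \<le> j"
    show "?t i \<le> ?t j"
    proof (cases "site l i = site l j")
      case True
      have s: "site l i \<in> {1..p - 1}" by (rule site_in_range[OF l ij(1)])
      then have "mono_on (Gam l (site l i)) ?t" using y mono_on_zoom_Gam[OF K s, of y] by blast
      moreover have "i \<in> Gam l (site l i)" "j \<in> Gam l (site l i)" unfolding Gam_eq_site[OF l s]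
        using ij True by auto
      ultimately show ?thesis using ij(3) by (rule mono_onD)
    next
      case False
      then have "site l i < site l j" using mono_onD[OF site_mono_on[OF l] ij] by simp
      then have "z (site l i + 1) \<le> z (site l j)" using site_less_p[OF ij(2)] by (intro z_le) auto
      then show ?thesis using below_next[OF ij(1)] near(1)[OF ij(2)] by linarith
    qed
  qed
  then show "?t \<in> region l" using near(1) below_next by (simp add: region_iff[OF l])
  show "near l ?t" using near(2) by (simp add: near_def)
qed

lemma vandermonde_zoom:
  "vandermonde {1..n} \<gamma> (zoom l K y)
    = (\<Prod>s=1..p - 1. abs_powr (width s / real K) (2 * \<gamma>) ^ (l s choose 2))
      * (\<Prod>s=1..p - 1. vandermonde (Gam l s) \<gamma> y) * interaction l (zoom l K y)"
proof -
  have "vandermonde (Gam l s) \<gamma> (zoom l K y)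
      = abs_powr (width s / real K) (2 * \<gamma>) ^ (l s choose 2) * vandermonde (Gam l s) \<gamma> y"
    if s: "s \<in> {1..p - 1}" for s
  proof -
    have "vandermonde (Gam l s) \<gamma> (zoom l K y) = vandermonde (Gam l s) \<gamma> (\<lambda>i. z s + width s / real K * y i)"
      using zoom_Gam[OF s] by (rule vandermonde_cong)
    moreover have "card (Gam l s) = l s" "finite (Gam l s)" using Gam_eq[of s l] s by simp_all
    ultimately show ?thesis using vandermonde_affine[of "Gam l s" \<gamma> "z s" "width s / real K" y] by simp
  qed
  moreover have "vandermonde {1..n} \<gamma> (zoom l K y)
      = (\<Prod>s=1..p - 1. vandermonde (Gam l s) \<gamma> (zoom l K y)) * interaction l (zoom l K y)"
    unfolding vandermonde_def interaction_def by (rule prod_site_blocks[OF l])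
  ultimately show ?thesis by (simp add: prod.distrib)
qed

lemma zoom_factor_cancel:
  assumes K: "K > 0"
  shows "zoom_factor l K * (\<Prod>i=1..n. abs_powr (width (site l i) / real K) (\<alpha> (site l i)))
    * (\<Prod>s=1..p - 1. abs_powr (width s / real K) (2 * \<gamma>) ^ (l s choose 2)) = 1"
proof -
  have "abs_powr (real K / width s) (zoom_exponent l s) * abs_powr (width s / real K) (\<alpha> s) ^ l s
      * abs_powr (width s / real K) (2 * \<gamma>) ^ (l s choose 2) = 1" if s: "s \<in> {1..p - 1}" for s
  proof -
    have w: "width s > 0" using width_pos[of s] s by (simp add: interval_pred_p[simplified])
    then have "abs_powr (width s / real K) (\<alpha> s) ^ l s * abs_powr (width s / real K) (2 * \<gamma>) ^ (l s choose 2)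
        = abs_powr (width s / real K) (zoom_exponent l s)"
      using K by (simp add: abs_powr_power abs_powr_add zoom_exponent_def)
    then show ?thesis
      using K w abs_powr_mult[of "real K / width s" "width s / real K" "zoom_exponent l s"]
      by (simp add: mult.assoc)
  qed
  then show ?thesis
    unfolding zoom_factor_def prod_site[OF l, of "\<lambda>s. abs_powr (width s / real K) (\<alpha> s)"]
      prod.distrib[symmetric] by simp
qed

lemma laguerre_product_eq:
  assumes "\<forall>s\<in>{1..p - 1}. mono_on (Gam l s) y"
  shows "laguerre_product l y
      = (\<Prod>i=1..n. laguerre_density (\<alpha> (site l i)) (y i)) * (\<Prod>s=1..p - 1. vandermonde (Gam l s) \<gamma> y)"
proof -
  have "(\<Prod>s=1..p - 1. \<Prod>i\<in>Gam l s. laguerre_density (\<alpha> s) (y i)) = (\<Prod>i=1..n. laguerre_density (\<alpha> (site l i)) (y i))"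
    by (rule prod_Gam_site[OF l])
  moreover have "laguerre_product l y
      = (\<Prod>s=1..p - 1. (\<Prod>i\<in>Gam l s. laguerre_density (\<alpha> s) (y i)) * vandermonde (Gam l s) \<gamma> y)"
    unfolding laguerre_product_def ordered_integrand_def using assms by (intro prod.cong) auto
  ultimately show ?thesis by (simp add: prod.distrib)
qed

lemma zoom_point_factor:
  assumes K: "K > 0" and i: "i \<in> {1..n}" and y: "0 \<le> y i"
  shows "of_real (width (site l i) / real K)
      * (point_weight (zoom l K y i) * (of_real ((z p - zoom l K y i) / width (site l i)) ^ K
      * (1 / of_real (zoom l K y i - z (\<tau> i)))))
    = abs_powr (width (site l i) / real K) (\<alpha> (site l i)) * point_correction l \<tau> K y i
      * laguerre_density (\<alpha> (site l i)) (y i)"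
proof (cases "y i = 0")
  case True
  then have "zoom l K y i = z (site l i)" using i by (simp add: zoom_def)
  then show ?thesis using True point_weight_z[of "site l i"] site_less_p[OF i] by (simp add: laguerre_density_def)
next
  case False
  let ?s = "site l i" and ?x = "zoom l K y i"
  have w: "width ?s > 0" by (rule width_site_pos[OF i])
  have displacement: "?x - z ?s = width ?s / real K * y i" using i by (simp add: zoom_def)
  have "point_weight ?x = abs_powr (width ?s / real K) (\<alpha> ?s) * abs_powr (y i) (\<alpha> ?s) * outer_weight ?s ?x"
    using site_less_p[OF i] point_weight_eq_outer_weight[of ?s ?x] by (simp only: displacement abs_powr_mult) simp
  moreover have "abs_powr (y i) (\<alpha> ?s) = abs_powr (y i) (\<alpha> ?s - 1) * of_real (y i)"
    using abs_powr_add_1[of "y i" "\<alpha> ?s - 1"] y by simp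
  moreover have "(z p - ?x) / width ?s = 1 - y i / real K"
    using w K i by (simp add: zoom_def width_def field_simps)
  moreover have "laguerre_density (\<alpha> ?s) (y i) * of_real (exp (y i)) = abs_powr (y i) (\<alpha> ?s - 1)"
    using y by (simp add: laguerre_density_def flip: of_real_mult exp_add)
  ultimately show ?thesis
    unfolding point_correction_def displacement by (simp add: mult_ac del: of_real_diff)
qed

lemma laguerre_product_nonzero_mono_on:
  assumes "laguerre_product l y \<noteq> 0"
  shows "\<forall>s\<in>{1..p - 1}. mono_on (Gam l s) y"
proof (rule ccontr)
  assume "\<not> (\<forall>s\<in>{1..p - 1}. mono_on (Gam l s) y)"
  then have "laguerre_product l y = 0"
    unfolding laguerre_product_def by (intro prod_zero) (auto simp: ordered_integrand_def)
  then show False using assms by contradiction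
qed

lemma laguerre_product_nonzero_pos:
  assumes "laguerre_product l y \<noteq> 0" "i \<in> {1..n}"
  shows "y i > 0"
proof (rule ccontr)
  assume nonpos: "\<not> y i > 0"
  note mono = laguerre_product_nonzero_mono_on[OF assms(1)]
  have "laguerre_density (\<alpha> (site l i)) (y i) = 0" using nonpos by (simp add: laguerre_density_def)
  then have "(\<Prod>i=1..n. laguerre_density (\<alpha> (site l i)) (y i)) = 0" using assms(2) by (intro prod_zero) auto
  then show False using assms(1) unfolding laguerre_product_eq[OF mono] by simp
qed

lemma zoom_point_product:
  assumes K: "K > 0" and y: "\<And>i. i \<in> {1..n} \<Longrightarrow> 0 \<le> y i"
  shows "of_real (\<Prod>i=1..n. \<bar>width (site l i) / real K\<bar>)
      * ((\<Prod>i=1..n. point_weight (zoom l K y i))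
        * (of_real (decay l (zoom l K y) ^ K) * pole_product \<tau> (zoom l K y)))
    = (\<Prod>i=1..n. abs_powr (width (site l i) / real K) (\<alpha> (site l i))) * (\<Prod>i=1..n. point_correction l \<tau> K y i)
      * (\<Prod>i=1..n. laguerre_density (\<alpha> (site l i)) (y i))"
proof -
  have "(\<Prod>i=1..n. \<bar>width (site l i) / real K\<bar>) = (\<Prod>i=1..n. width (site l i) / real K)"
  proof (intro prod.cong refl)
    show "\<bar>width (site l i) / real K\<bar> = width (site l i) / real K" if "i \<in> {1..n}" for i
      using width_site_pos[OF that] by simp
  qed
  then have "of_real (\<Prod>i=1..n. \<bar>width (site l i) / real K\<bar>)
      * ((\<Prod>i=1..n. point_weight (zoom l K y i))
        * (of_real (decay l (zoom l K y) ^ K) * pole_product \<tau> (zoom l K y)))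
    = (\<Prod>i=1..n. of_real (width (site l i) / real K) * (point_weight (zoom l K y i)
        * (of_real ((z p - zoom l K y i) / width (site l i)) ^ K * (1 / of_real (zoom l K y i - z (\<tau> i))))))"
    unfolding decay_def pole_product_def prod.distrib by (simp only: of_real_prod of_real_power prod_power_distrib)
  then show ?thesis
    unfolding prod.distrib[symmetric] using y by (simp only: zoom_point_factor[OF K] cong: prod.cong)
qed

lemma zoom_integrand:
  assumes K: "K > 0"
  shows "of_real (\<Prod>i=1..n. \<bar>width (site l i) / real K\<bar>)
      * (if zoom l K y \<in> region l \<and> near l (zoom l K y)
         then zoom_factor l K * of_real (decay l (zoom l K y) ^ K)
             * (weight (zoom l K y) * pole_product \<tau> (zoom l K y)) else 0)
    = correction l \<tau> K y * laguerre_product l y"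
proof (cases "zoom l K y \<in> region l \<and> near l (zoom l K y)")
  case True
  let ?t = "zoom l K y" and ?widths = "of_real (\<Prod>i=1..n. \<bar>width (site l i) / real K\<bar>)"
  have y: "\<forall>i\<in>{1..n}. 0 \<le> y i \<and> y i \<le> near_ratio * real K" "\<forall>s\<in>{1..p - 1}. mono_on (Gam l s) y"
    using True unfolding zoom_in_region_iff[OF K] by auto
  let ?scales = "\<Prod>i=1..n. abs_powr (width (site l i) / real K) (\<alpha> (site l i))"
    and ?regular = "\<Prod>i=1..n. point_correction l \<tau> K y i"
    and ?densities = "\<Prod>i=1..n. laguerre_density (\<alpha> (site l i)) (y i)"
  have "?widths * (zoom_factor l K * of_real (decay l ?t ^ K) * (weight ?t * pole_product \<tau> ?t))
      = zoom_factor l K * (?widths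
        * ((\<Prod>i=1..n. point_weight (?t i)) * (of_real (decay l ?t ^ K) * pole_product \<tau> ?t)))
        * vandermonde {1..n} \<gamma> ?t"
    unfolding weight_def by (simp only: mult_ac)
  also have "\<dots> = zoom_factor l K * (?scales * ?regular * ?densities) * vandermonde {1..n} \<gamma> ?t"
    using y(1) by (subst zoom_point_product[OF K]) auto
  also have "\<dots> = (zoom_factor l K * ?scales * (\<Prod>s=1..p - 1. abs_powr (width s / real K) (2 * \<gamma>) ^ (l s choose 2)))
      * (?regular * interaction l ?t) * (?densities * (\<Prod>s=1..p - 1. vandermonde (Gam l s) \<gamma> y))"
    unfolding vandermonde_zoom by (simp only: mult_ac)
  finally show ?thesis
    unfolding zoom_factor_cancel[OF K] laguerre_product_eq[OF y(2), symmetric] if_P[OF True] correction_def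
    using y(1) by simp
next
  case False
  have "laguerre_product l y = 0" if "\<forall>i\<in>{1..n}. y i \<le> near_ratio * real K"
    using laguerre_product_nonzero_pos[of y] laguerre_product_nonzero_mono_on[of y] that False
    unfolding zoom_in_region_iff[OF K] by (meson less_imp_le)
  then show ?thesis unfolding if_not_P[OF False] correction_def by auto
qed

end

end

section \<open>Letting the last exponent tend to infinity\<close>

lemma powr_times_power_tendsto_0:
  fixes a x :: real
  assumes "0 < x" "x < 1"
  shows "(\<lambda>k. real (Suc k) powr a * x ^ Suc k) \<longlonglongrightarrow> 0"
proof -
  define b where "b = - ln x"
  have b: "b > 0" using assms by (simp add: b_def)
  have "(\<lambda>k. real (Suc k) powr a * exp (- b * real (Suc k))) \<longlonglongrightarrow> 0" using b by real_asymp
  moreover have "exp (- b * real (Suc k)) = x ^ Suc k" for k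
    using assms exp_of_nat_mult[of "Suc k" "ln x"] by (simp add: b_def mult.commute del: of_nat_Suc)
  ultimately show ?thesis by simp
qed

lemma power_one_minus_le_exp:
  assumes "0 \<le> y" "y \<le> real K" "K > 0"
  shows "(1 - y / real K) ^ K \<le> exp (- y)"
proof -
  have "(1 - y / real K) ^ K \<le> exp (- (y / real K)) ^ K"
    using assms exp_ge_add_one_self[of "- (y / real K)"] by (intro power_mono) (auto simp: divide_le_eq_1)
  also have "\<dots> = exp (- y)" using assms exp_of_nat_mult[of K "- (y / real K)"] by simp
  finally show ?thesis .
qed

lemma power_one_minus_tendsto_exp: "(\<lambda>k. (1 - y / real (Suc k)) ^ Suc k) \<longlonglongrightarrow> exp (- y)"
  using LIMSEQ_Suc[OF tendsto_exp_limit_sequentially[of "- y"]] by simp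

lemma integrable_mult_bounded:
  fixes F :: "'a \<Rightarrow> 'b :: {real_normed_field, banach, second_countable_topology}"
  assumes "integrable M F" "c \<in> borel_measurable M" "\<And>x. F x \<noteq> 0 \<Longrightarrow> norm (c x) \<le> C"
  shows "integrable M (\<lambda>x. c x * F x)"
proof (rule Bochner_Integration.integrable_bound)
  show "integrable M (\<lambda>x. C * norm (F x))" using assms(1) by (intro integrable_mult_right integrable_norm)
  have "norm (c x * F x) \<le> C * norm (F x)" for x
    using assms(3)[of x] by (cases "F x = 0") (auto simp: norm_mult intro!: mult_right_mono)
  then show "AE x in M. norm (c x * F x) \<le> norm (C * norm (F x))"
    by (intro AE_I2) (simp add: order_trans[OF _ abs_ge_self])
qed (use assms in simp)

context configuration
begin

definition leading_coefficient :: "(nat \<Rightarrow> nat) \<Rightarrow> complex" where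
  "leading_coefficient l = (\<Prod>i=1..n. outer_weight (site l i) (z (site l i)))
     * (\<Prod>(r, s)\<in>ordered_pairs {1..p - 1}. abs_powr (z s - z r) (2 * \<gamma>) ^ (l r * l s))"

context
  fixes l assumes l: "l \<in> Zset n (p - 1)"
begin

lemma UN_Gam: "(\<Union>s\<in>{1..p - 1}. Gam l s) = {1..n}"
  using site_in_range[OF l] by (auto simp: Gam_eq_site[OF l])

lemma laguerre_product_integral:
  shows "integrable (Rn n) (laguerre_product l)"
    and "(LINT y|Rn n. laguerre_product l y) = (\<Prod>s=1..p - 1. laguerre_integral (l s) (\<alpha> s) \<gamma>)"
proof -
  let ?f = "\<lambda>s. ordered_integrand (Gam l s) (laguerre_density (\<alpha> s)) \<gamma>"
  define \<phi> where "\<phi> i = gamma_majorant (Re (\<alpha> (site l i))) (2 * Re \<gamma> * real (l (site l i) choose 2))" for i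
  have fin: "finite (Gam l s)" for s by (simp add: Gam_def)
  have disjoint: "disjoint_family_on (Gam l) {1..p - 1}"
    by (auto simp: disjoint_family_on_def Gam_eq_site[OF l])
  have bound: "norm (?f s y) \<le> (\<Prod>i\<in>Gam l s. \<phi> i (y i))" if s: "s \<in> {1..p - 1}" for s y
  proof -
    have "norm (?f s y) \<le> (\<Prod>i\<in>Gam l s. gamma_majorant (Re (\<alpha> s)) (2 * Re \<gamma>
        * real (card (Gam l s) choose 2)) (y i))"
      using Re_\<gamma>_pos by (intro norm_laguerre_integrand_le fin) simp
    also have "\<dots> = (\<Prod>i\<in>Gam l s. \<phi> i (y i))"
      using Gam_eq[of s l] s by (intro prod.cong) (auto simp: \<phi>_def Gam_eq_site[OF l s])
    finally show ?thesis .
  qed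
  have \<phi>: "integrable lborel (\<phi> i)" if "i \<in> (\<Union>s\<in>{1..p - 1}. Gam l s)" for i
    using that Re_\<alpha>_pos[OF site_less_p[OF l, of i]] Re_\<gamma>_pos unfolding \<phi>_def UN_Gam
    by (intro integrable_gamma_majorant) auto
  have product: "laguerre_product l = (\<lambda>y. \<Prod>s=1..p - 1. ?f s y)"
    by (simp add: laguerre_product_def fun_eq_iff)
  note blocks = finite_atLeastAtMost disjoint fin measurable_ordered_integrand[OF fin measurable_laguerre_density]
    depends_only_on_ordered_integrand \<phi> bound
  show "integrable (Rn n) (laguerre_product l)"
    unfolding product UN_Gam[symmetric] by (rule integrable_prod_blocks[OF blocks])
  have "(LINT y|Rn n. laguerre_product l y) = (\<Prod>s=1..p - 1. LINT y|lborel_on (Gam l s). ?f s y)"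
    unfolding product UN_Gam[symmetric] by (rule integral_prod_blocks[OF blocks])
  also have "\<dots> = (\<Prod>s=1..p - 1. laguerre_integral (l s) (\<alpha> s) \<gamma>)"
  proof (intro prod.cong refl)
    fix s assume "s \<in> {1..p - 1}"
    then have "Gam l s = (+) (psum l (s - 1)) ` {1..l s}" using Gam_eq[of s l] by simp
    then show "(LINT y|lborel_on (Gam l s). ?f s y) = laguerre_integral (l s) (\<alpha> s) \<gamma>"
      unfolding laguerre_integral_def
      by (simp only:) (rule integral_ordered_integrand_reindex, auto simp: strict_mono_on_def)
  qed
  finally show "(LINT y|Rn n. laguerre_product l y) = (\<Prod>s=1..p - 1. laguerre_integral (l s) (\<alpha> s) \<gamma>)" .
qed

lemma zoom_tendsto: "i \<in> {1..n} \<Longrightarrow> (\<lambda>k. zoom l (Suc k) y i) \<longlonglongrightarrow> z (site l i)"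
proof -
  assume "i \<in> {1..n}"
  moreover have "(\<lambda>k. z (site l i) + width (site l i) * (1 / real (Suc k)) * y i)
      \<longlonglongrightarrow> z (site l i) + width (site l i) * 0 * y i"
    by (intro tendsto_intros LIMSEQ_Suc[OF lim_1_over_n])
  ultimately show ?thesis by (simp add: zoom_def)
qed

lemma interaction_tendsto:
  "(\<lambda>k. interaction l (zoom l (Suc k) y))
      \<longlonglongrightarrow> (\<Prod>(r, s)\<in>ordered_pairs {1..p - 1}. abs_powr (z s - z r) (2 * \<gamma>) ^ (l r * l s))"
proof -
  have "(\<lambda>k. \<Prod>i\<in>Gam l r. \<Prod>j\<in>Gam l s. abs_powr (zoom l (Suc k) y j - zoom l (Suc k) y i) (2 * \<gamma>))
      \<longlonglongrightarrow> abs_powr (z s - z r) (2 * \<gamma>) ^ (l r * l s)" if rs: "(r, s) \<in> ordered_pairs {1..p - 1}" for r s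
  proof -
    have r: "r \<in> {1..p - 1}" and s: "s \<in> {1..p - 1}" and "r < s" using rs by (auto simp: ordered_pairs_def)
    then have "z s - z r \<noteq> 0" using z_less[of r s] by force
    then have "(\<lambda>k. \<Prod>i\<in>Gam l r. \<Prod>j\<in>Gam l s. abs_powr (zoom l (Suc k) y j - zoom l (Suc k) y i) (2 * \<gamma>))
        \<longlonglongrightarrow> (\<Prod>i\<in>Gam l r. \<Prod>j\<in>Gam l s. abs_powr (z s - z r) (2 * \<gamma>))"
      using zoom_tendsto Gam_eq_site[OF l r] Gam_eq_site[OF l s]
      by (intro tendsto_prod tendsto_abs_powr tendsto_diff) auto
    moreover have "card (Gam l r) = l r" "card (Gam l s) = l s" using Gam_eq[of r l] Gam_eq[of s l] r s by auto
    ultimately show ?thesis by (simp add: mult.commute flip: power_mult)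
  qed
  then show ?thesis
    unfolding interaction_def by (intro tendsto_prod) (auto simp: case_prod_beta)
qed

context
  fixes \<tau> assumes \<tau>: "\<And>i. i \<in> {1..n} \<Longrightarrow> \<tau> i \<in> {1..<p}"
begin

lemma pole_ratio_tendsto:
  assumes i: "i \<in> {1..n}" and y: "y i > 0"
  shows "(\<lambda>k. (zoom l (Suc k) y i - z (site l i)) / (zoom l (Suc k) y i - z (\<tau> i)))
      \<longlonglongrightarrow> (if \<tau> i = site l i then 1 else 0)"
proof (cases "\<tau> i = site l i")
  case True
  have "zoom l (Suc k) y i - z (site l i) \<noteq> 0" for k
    using i y width_site_pos[OF l i] by (simp add: zoom_def)
  then show ?thesis using True by simp
next
  case False
  then have "z (site l i) - z (\<tau> i) \<noteq> 0"
    using inj_onD[OF inj_on_z, of "site l i" "\<tau> i"] \<tau>[OF i] site_less_p[OF l i] by auto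
  then have "(\<lambda>k. (zoom l (Suc k) y i - z (site l i)) / (zoom l (Suc k) y i - z (\<tau> i)))
      \<longlonglongrightarrow> (z (site l i) - z (site l i)) / (z (site l i) - z (\<tau> i))"
    by (intro tendsto_intros zoom_tendsto i)
  then show ?thesis using False by simp
qed

lemma correction_tendsto:
  assumes y: "laguerre_product l y \<noteq> 0"
  shows "(\<lambda>k. correction l \<tau> (Suc k) y) \<longlonglongrightarrow> (if \<forall>i\<in>{1..n}. \<tau> i = site l i then leading_coefficient l else 0)"
proof -
  let ?limit = "\<lambda>i. of_real (exp (y i) * exp (- y i)) * outer_weight (site l i) (z (site l i))
      * of_real (if \<tau> i = site l i then 1 else 0)"
  have "(\<lambda>k. point_correction l \<tau> (Suc k) y i) \<longlonglongrightarrow> ?limit i" if i: "i \<in> {1..n}" for i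
  proof -
    have "isCont (outer_weight (site l i)) (z (site l i))"
      using site_less_p[OF l i] near_ratio_pos width_site_pos[OF l i] by (intro isCont_outer_weight) auto
    then show ?thesis
      unfolding point_correction_def using laguerre_product_nonzero_pos[OF l y i]
      by (intro tendsto_mult tendsto_of_real tendsto_const power_one_minus_tendsto_exp pole_ratio_tendsto i
          isCont_tendsto_compose[OF _ zoom_tendsto[OF i]])
  qed
  then have "(\<lambda>k. (\<Prod>i=1..n. point_correction l \<tau> (Suc k) y i) * interaction l (zoom l (Suc k) y))
      \<longlonglongrightarrow> (\<Prod>i=1..n. ?limit i) * (\<Prod>(r, s)\<in>ordered_pairs {1..p - 1}. abs_powr (z s - z r) (2 * \<gamma>) ^ (l r * l s))"
    by (rule tendsto_mult[OF tendsto_prod interaction_tendsto])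
  also have "(\<Prod>i=1..n. ?limit i)
      = (if \<forall>i\<in>{1..n}. \<tau> i = site l i then \<Prod>i=1..n. outer_weight (site l i) (z (site l i)) else 0)"
    by (auto simp: exp_minus simp flip: of_real_mult intro!: prod_zero)
  finally have "(\<lambda>k. (\<Prod>i=1..n. point_correction l \<tau> (Suc k) y i) * interaction l (zoom l (Suc k) y))
      \<longlonglongrightarrow> (if \<forall>i\<in>{1..n}. \<tau> i = site l i then leading_coefficient l else 0)"
    unfolding leading_coefficient_def by (simp only: if_distrib[of "\<lambda>x. x * _"] mult_zero_left)
  moreover have "\<forall>\<^sub>F k in sequentially. \<forall>i\<in>{1..n}. y i \<le> near_ratio * real (Suc k)"
  proof (intro eventually_ball_finite ballI)
    fix i
    have "filterlim (\<lambda>k. near_ratio * real (Suc k)) at_top sequentially"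
      by (rule filterlim_tendsto_pos_mult_at_top[OF tendsto_const near_ratio_pos
          filterlim_compose[OF filterlim_real_sequentially filterlim_Suc]])
    then show "\<forall>\<^sub>F k in sequentially. y i \<le> near_ratio * real (Suc k)" by (simp only: filterlim_at_top)
  qed simp
  then have "\<forall>\<^sub>F k in sequentially. (\<Prod>i=1..n. point_correction l \<tau> (Suc k) y i) * interaction l (zoom l (Suc k) y)
      = correction l \<tau> (Suc k) y"
  proof eventually_elim
    case (elim k)
    then show ?case unfolding correction_def by (rule if_P[symmetric])
  qed
  ultimately show ?thesis by (rule Lim_transform_eventually)
qed

lemma norm_interaction_le:
  assumes "t \<in> cube"
  shows "norm (interaction l t)
      \<le> (\<Prod>(r, s)\<in>ordered_pairs {1..p - 1}. \<Prod>i\<in>Gam l r. \<Prod>j\<in>Gam l s. (z p - z 1) powr (2 * Re \<gamma>))"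
  unfolding interaction_def prod_norm[symmetric] case_prod_beta using assms
  by (intro prod_mono conjI prod_nonneg norm_ge_zero norm_abs_powr_cube_le)
    (auto simp: cube_def ordered_pairs_def Gam_eq_site[OF l])

lemma norm_exp_times_power_le_1:
  assumes "0 \<le> y" "y \<le> real K" "K > 0"
  shows "norm (of_real (exp y * (1 - y / real K) ^ K) :: complex) \<le> 1"
proof -
  have "0 \<le> (1 - y / real K) ^ K" using assms by (intro zero_le_power) (simp add: divide_le_eq_1)
  moreover have "exp y * (1 - y / real K) ^ K \<le> exp y * exp (- y)"
    using power_one_minus_le_exp[OF assms] by (intro mult_left_mono) auto
  ultimately show ?thesis unfolding norm_of_real by (simp flip: exp_add)
qed

lemma norm_pole_ratio_le_1:
  assumes i: "i \<in> {1..n}" and x: "z (site l i) \<le> x" "x \<le> z (site l i) + near_ratio * width (site l i)"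
  shows "norm (of_real ((x - z (site l i)) / (x - z (\<tau> i))) :: complex) \<le> 1"
proof (cases "\<tau> i = site l i")
  case False
  then show ?thesis
    unfolding norm_of_real using near_left_end(2)[OF site_less_p[OF l i] x, of "\<tau> i"] \<tau>[OF i] x(1)
    by (simp add: divide_le_eq_1)
qed (simp del: of_real_divide of_real_diff)

lemma correction_bounded:
  obtains C where "\<And>K y. K > 0 \<Longrightarrow> laguerre_product l y \<noteq> 0 \<Longrightarrow> norm (correction l \<tau> K y) \<le> C"
proof -
  obtain B where B: "\<And>s. s \<in> {1..<p} \<Longrightarrow> B s \<ge> 0"
    "\<And>s x. s \<in> {1..<p} \<Longrightarrow> z s \<le> x \<Longrightarrow> x \<le> z s + near_ratio * width s \<Longrightarrow> norm (outer_weight s x) \<le> B s"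
    using outer_weight_bounded by blast
  let ?I = "\<Prod>(r, s)\<in>ordered_pairs {1..p - 1}. \<Prod>i\<in>Gam l r. \<Prod>j\<in>Gam l s. (z p - z 1) powr (2 * Re \<gamma>)"
  have "norm (correction l \<tau> K y) \<le> (\<Prod>i=1..n. 1 * B (site l i) * 1) * ?I"
    if K: "K > 0" and nonzero: "laguerre_product l y \<noteq> 0" for K y
  proof (cases "\<forall>i\<in>{1..n}. y i \<le> near_ratio * real K")
    case near: True
    have y: "0 \<le> y i" "y i \<le> real K" if "i \<in> {1..n}" for i
    proof -
      show "0 \<le> y i" using laguerre_product_nonzero_pos[OF l nonzero that] by simp
      have "near_ratio * real K \<le> 1 * real K" using near_ratio_le_half by (intro mult_right_mono) auto
      then show "y i \<le> real K" using near that by force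
    qed
    have region: "zoom l K y \<in> region l" "near l (zoom l K y)"
      using zoom_in_region_iff[OF l K, of y] near y(1) laguerre_product_nonzero_mono_on[OF l nonzero] by auto
    have left: "z (site l i) \<le> zoom l K y i" "zoom l K y i \<le> z (site l i) + near_ratio * width (site l i)"
      if "i \<in> {1..n}" for i
      using region that by (auto simp: region_iff[OF l] near_def)
    have "(\<Prod>i=1..n. norm (point_correction l \<tau> K y i)) \<le> (\<Prod>i=1..n. 1 * B (site l i) * 1)"
      unfolding point_correction_def norm_mult[of _ "of_real (_ / _)"] norm_mult[of _ "outer_weight _ _"]
      using B site_less_p[OF l] left y K
      by (intro prod_mono conjI mult_mono norm_exp_times_power_le_1 norm_pole_ratio_le_1 mult_nonneg_nonneg
        norm_ge_zero) auto
    moreover have "norm (interaction l (zoom l K y)) \<le> ?I"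
      using region(1) region_subset_cube[OF l] by (intro norm_interaction_le) auto
    ultimately show ?thesis
      unfolding correction_def if_P[OF near] norm_mult prod_norm[symmetric]
      using B(1) site_less_p[OF l] by (intro mult_mono) (auto intro!: prod_nonneg)
  next
    case False
    then have "correction l \<tau> K y = 0" unfolding correction_def by (rule if_not_P)
    then show ?thesis
      using B(1) site_less_p[OF l] by (auto simp: case_prod_beta intro!: mult_nonneg_nonneg prod_nonneg)
  qed
  then show ?thesis by (rule that)
qed

end

end

lemma measurable_decay [measurable]: "decay l \<in> borel_measurable (Rn n)"
proof -
  have "(\<lambda>t. (z p - t i) / width (site l i)) \<in> borel_measurable (Rn n)" if "i \<in> {1..n}" for i
    using measurable_lborel_component[OF that] by measurable
  then show ?thesis unfolding decay_def[abs_def] by (rule borel_measurable_prod)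
qed

lemma pred_near [measurable]: "Measurable.pred (Rn n) (near l)"
  unfolding near_def[abs_def]
proof (intro pred_intros_finite)
  fix i assume "i \<in> {1..n}"
  then show "Measurable.pred (Rn n) (\<lambda>t. t i \<le> z (site l i) + near_ratio * width (site l i))"
    unfolding pred_def by (intro borel_measurable_le measurable_lborel_component borel_measurable_const)
qed simp

lemma measurable_pole_product [measurable]: "pole_product \<tau> \<in> borel_measurable (Rn n)"
proof -
  have "(\<lambda>t. 1 / of_real (t i - z (\<tau> i)) :: complex) \<in> borel_measurable (Rn n)" if "i \<in> {1..n}" for i
    using measurable_lborel_component[OF that] by measurable
  then show ?thesis unfolding pole_product_def[abs_def] by (rule borel_measurable_prod)
qed

lemma decay_bounds:
  assumes l: "l \<in> Zset n (p - 1)" and t: "t \<in> region l"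
  shows "0 \<le> decay l t" "decay l t \<le> 1" "\<not> near l t \<Longrightarrow> decay l t \<le> 1 - near_ratio"
proof -
  have factor: "0 \<le> (z p - t i) / width (site l i)" "(z p - t i) / width (site l i) \<le> 1" if "i \<in> {1..n}" for i
  proof -
    have "t i \<le> z p" using t region_subset_cube[OF l] that by (auto simp: cube_def)
    then show "0 \<le> (z p - t i) / width (site l i)" using width_site_pos[OF l that] by simp
    show "(z p - t i) / width (site l i) \<le> 1"
      using t that width_site_pos[OF l that] by (simp add: region_iff[OF l] width_def)
  qed
  show "0 \<le> decay l t" "decay l t \<le> 1"
    unfolding decay_def using factor by (auto intro: prod_nonneg prod_le_1)
  assume "\<not> near l t"
  then obtain k where k: "k \<in> {1..n}" "t k > z (site l k) + near_ratio * width (site l k)"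
    by (auto simp: near_def not_le)
  have "decay l t = (z p - t k) / width (site l k) * (\<Prod>i\<in>{1..n} - {k}. (z p - t i) / width (site l i))"
    unfolding decay_def using k(1) by (intro prod.remove) auto
  also have "\<dots> \<le> (1 - near_ratio) * 1"
  proof (intro mult_mono prod_le_1 prod_nonneg)
    show "(z p - t k) / width (site l k) \<le> 1 - near_ratio"
      using k width_site_pos[OF l k(1)] by (simp add: width_def field_simps)
  qed (use factor near_ratio_le_half in auto)
  finally show "decay l t \<le> 1 - near_ratio" by simp
qed

context
  fixes l \<tau> assumes l: "l \<in> Zset n (p - 1)" and \<tau>: "\<And>i. i \<in> {1..n} \<Longrightarrow> \<tau> i \<in> {1..<p}"
begin

lemma integrable_weight_pole_product:
  "integrable (Rn n) (\<lambda>t. indicator (region l) t *\<^sub>R (weight t * pole_product \<tau> t))"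
proof -
  have "tame J (\<lambda>t. \<Prod>i\<in>J. 1 / of_real (t i - z (\<tau> i)))" if "J \<subseteq> {1..n}" for J
    using finite_subset[OF that finite_atLeastAtMost] that
  proof (induction J rule: finite_induct)
    case empty
    then show ?case by (auto simp: tame_def depends_only_on_def bounded_iff)
  next
    case (insert i J)
    have "(\<lambda>x. 1 / of_real (x - z (\<tau> i))) \<in> admissible"
      using insert.prems \<tau> by (intro admissible_simple_pole continuous_intros) auto
    then have "tame (insert i J) (\<lambda>t. 1 / of_real (t i - z (\<tau> i)) * (\<Prod>i\<in>J. 1 / of_real (t i - z (\<tau> i))))"
      using insert by (intro tame_times_admissible) auto
    then show ?case by (simp only: prod.insert[OF insert.hyps])
  qed
  then show ?thesis
    using set_integrable_weight_tame[OF l, of "pole_product \<tau>"]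
    unfolding set_integrable_def pole_product_def[abs_def] by blast
qed

lemma norm_zoom_factor_tendsto_0: "(\<lambda>k. norm (zoom_factor l (Suc k)) * (1 - near_ratio) ^ Suc k) \<longlonglongrightarrow> 0"
proof -
  let ?e = "\<lambda>s. Re (zoom_exponent l s)"
  have "norm (zoom_factor l (Suc k))
      = (\<Prod>s=1..p - 1. (1 / width s) powr ?e s) * real (Suc k) powr (\<Sum>s=1..p - 1. ?e s)" for k
  proof -
    have "norm (abs_powr (real (Suc k) / width s) (zoom_exponent l s))
        = (1 / width s) powr ?e s * real (Suc k) powr ?e s"
      if "s \<in> {1..p - 1}" for s
      using width_pos[of s] that
      by (simp add: interval_pred_p[simplified] norm_abs_powr powr_divide del: of_nat_Suc)
    then show ?thesis
      by (simp add: zoom_factor_def powr_sum prod.distrib del: of_nat_Suc flip: prod_norm)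
  qed
  moreover have "(\<lambda>k. (\<Prod>s=1..p - 1. (1 / width s) powr ?e s)
      * (real (Suc k) powr (\<Sum>s=1..p - 1. ?e s) * (1 - near_ratio) ^ Suc k)) \<longlonglongrightarrow> 0"
    using near_ratio_pos near_ratio_le_half by (intro tendsto_mult_right_zero powr_times_power_tendsto_0) auto
  ultimately show ?thesis by (simp only: mult.assoc)
qed

lemma far_part_tendsto_0:
  "(\<lambda>k. LINT t|Rn n. (if near l t then 0 else zoom_factor l (Suc k) * of_real (decay l t ^ Suc k))
      * (indicator (region l) t *\<^sub>R (weight t * pole_product \<tau> t))) \<longlonglongrightarrow> 0"
proof -
  define b where "b k = norm (zoom_factor l (Suc k)) * (1 - near_ratio) ^ Suc k" for k
  have b: "b \<longlonglongrightarrow> 0" unfolding b_def by (rule norm_zoom_factor_tendsto_0)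
  then obtain C where C: "\<And>k. norm (b k) \<le> C"
    using convergent_imp_Bseq[of b] unfolding Bseq_def convergent_def by blast
  have le_b: "norm (if near l t then 0 else zoom_factor l (Suc k) * of_real (decay l t ^ Suc k)) \<le> b k"
    if "t \<in> region l" for t k
  proof (cases "near l t")
    case True
    then show ?thesis using near_ratio_le_half by (simp add: b_def)
  next
    case False
    have "decay l t ^ Suc k \<le> (1 - near_ratio) ^ Suc k"
      using decay_bounds(1)[OF l that] decay_bounds(3)[OF l that False] by (intro power_mono)
    moreover have "0 \<le> decay l t ^ Suc k" using decay_bounds(1)[OF l that] by simp
    ultimately show ?thesis
      using False by (simp add: b_def norm_mult norm_power mult_left_mono del: power_Suc flip: of_real_power)
  qed
  have "(\<lambda>k. LINT t|Rn n. (if near l t then 0 else zoom_factor l (Suc k) * of_real (decay l t ^ Suc k))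
      * (indicator (region l) t *\<^sub>R (weight t * pole_product \<tau> t)))
        \<longlonglongrightarrow> 0 * (LINT t|Rn n. indicator (region l) t *\<^sub>R (weight t * pole_product \<tau> t))"
  proof (rule tendsto_integral_mult_bounded[OF integrable_weight_pole_product])
    fix t assume "indicator (region l) t *\<^sub>R (weight t * pole_product \<tau> t) \<noteq> 0"
    then have t: "t \<in> region l" by (auto simp: indicator_def)
    show "norm (if near l t then 0 else zoom_factor l (Suc k) * of_real (decay l t ^ Suc k)) \<le> C" for k
      using le_b[OF t, of k] C[of k] by simp
    show "(\<lambda>k. if near l t then 0 else zoom_factor l (Suc k) * of_real (decay l t ^ Suc k)) \<longlonglongrightarrow> 0"
      by (rule Lim_null_comparison[OF always_eventually b]) (use le_b[OF t] in blast)
  qed measurable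
  then show ?thesis by simp
qed

lemma near_part_eq:
  assumes K: "K > 0"
  shows "(LINT t|Rn n. (if near l t then zoom_factor l K * of_real (decay l t ^ K) else 0)
      * (indicator (region l) t *\<^sub>R (weight t * pole_product \<tau> t)))
        = (LINT y|Rn n. correction l \<tau> K y * laguerre_product l y)"
    and "(\<lambda>y. correction l \<tau> K y * laguerre_product l y) \<in> borel_measurable (Rn n)"
proof -
  let ?G = "\<lambda>t. if t \<in> region l \<and> near l t
      then zoom_factor l K * of_real (decay l t ^ K) * (weight t * pole_product \<tau> t) else 0"
  have G_eq: "?G = (\<lambda>t. (if near l t then zoom_factor l K * of_real (decay l t ^ K) else 0)
      * (indicator (region l) t *\<^sub>R (weight t * pole_product \<tau> t)))"
    by (auto simp: indicator_def)
  have G: "?G \<in> borel_measurable (Rn n)"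
    unfolding G_eq using measurable_indicator_region[OF l] by measurable
  have "(LINT t|Rn n. ?G t) = of_real (\<Prod>i=1..n. \<bar>width (site l i) / real K\<bar>) * (LINT y|Rn n. ?G (zoom l K y))"
    unfolding zoom_def
  proof (rule integral_lborel_on_affine[OF _ _ _ G])
    show "width (site l i) / real K \<noteq> 0" if "i \<in> {1..n}" for i
      using width_site_pos[OF l that] K by simp
  qed (auto simp: bij_betw_def)
  also have "\<dots> = (LINT y|Rn n. of_real (\<Prod>i=1..n. \<bar>width (site l i) / real K\<bar>) * ?G (zoom l K y))"
    by (rule integral_mult_right_zero[symmetric])
  finally show "(LINT t|Rn n. (if near l t then zoom_factor l K * of_real (decay l t ^ K) else 0)
      * (indicator (region l) t *\<^sub>R (weight t * pole_product \<tau> t)))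
        = (LINT y|Rn n. correction l \<tau> K y * laguerre_product l y)"
    unfolding zoom_integrand[OF l K] G_eq .
  have "zoom l K \<in> measurable (Rn n) (Rn n)"
    unfolding zoom_def[abs_def] by (rule measurable_affine_reindex) auto
  from measurable_compose[OF this G]
  show "(\<lambda>y. correction l \<tau> K y * laguerre_product l y) \<in> borel_measurable (Rn n)"
    unfolding zoom_integrand[OF l K, symmetric] by measurable
qed

lemma near_part_tendsto:
  "(\<lambda>k. LINT y|Rn n. correction l \<tau> (Suc k) y * laguerre_product l y)
    \<longlonglongrightarrow> (if \<forall>i\<in>{1..n}. \<tau> i = site l i then leading_coefficient l else 0)
      * (\<Prod>s=1..p - 1. laguerre_integral (l s) (\<alpha> s) \<gamma>)"
proof -
  obtain C where C: "\<And>K y. K > 0 \<Longrightarrow> laguerre_product l y \<noteq> 0 \<Longrightarrow> norm (correction l \<tau> K y) \<le> C"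
    using correction_bounded[OF l, of \<tau>] \<tau> by blast
  let ?c = "\<lambda>k y. correction l \<tau> (Suc k) y * laguerre_product l y / laguerre_product l y"
  have [measurable]: "laguerre_product l \<in> borel_measurable (Rn n)"
    using laguerre_product_integral(1)[OF l] by (rule borel_measurable_integrable)
  have "(\<lambda>k. LINT y|Rn n. ?c k y * laguerre_product l y)
      \<longlonglongrightarrow> (if \<forall>i\<in>{1..n}. \<tau> i = site l i then leading_coefficient l else 0) * (LINT y|Rn n. laguerre_product l y)"
  proof (rule tendsto_integral_mult_bounded[OF laguerre_product_integral(1)[OF l]])
    show "?c k \<in> borel_measurable (Rn n)" for k
      using near_part_eq(2)[of "Suc k"] by measurable
    fix y assume y: "laguerre_product l y \<noteq> 0"
    then show "norm (?c k y) \<le> C" for k using C[of "Suc k" y] by simp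
    show "(\<lambda>k. ?c k y) \<longlonglongrightarrow> (if \<forall>i\<in>{1..n}. \<tau> i = site l i then leading_coefficient l else 0)"
      using correction_tendsto[OF l \<tau> y] y by simp
  qed
  moreover have "?c k y * laguerre_product l y = correction l \<tau> (Suc k) y * laguerre_product l y" for k y
    by (cases "laguerre_product l y = 0") auto
  ultimately show ?thesis by (simp only: laguerre_product_integral(2)[OF l])
qed

lemma integral_pole_product_tendsto:
  "(\<lambda>k. LINT t:region l|Rn n. zoom_factor l (Suc k) * of_real (decay l t ^ Suc k) * (weight t * pole_product \<tau> t))
    \<longlonglongrightarrow> (if \<forall>i\<in>{1..n}. \<tau> i = site l i then leading_coefficient l else 0)
      * (\<Prod>s=1..p - 1. laguerre_integral (l s) (\<alpha> s) \<gamma>)"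
proof -
  let ?base = "\<lambda>t. indicator (region l) t *\<^sub>R (weight t * pole_product \<tau> t)"
  let ?near = "\<lambda>K t. if near l t then zoom_factor l K * of_real (decay l t ^ K) else 0"
  let ?far = "\<lambda>K t. if near l t then 0 else zoom_factor l K * of_real (decay l t ^ K)"
  have bounded: "norm (?near K t) \<le> norm (zoom_factor l K)" "norm (?far K t) \<le> norm (zoom_factor l K)"
    if "?base t \<noteq> 0" for K t
  proof -
    have "t \<in> region l" using that by (auto simp: indicator_def)
    then have "norm (zoom_factor l K * of_real (decay l t ^ K)) \<le> norm (zoom_factor l K)"
      using decay_bounds(1,2)[OF l, of t] by (simp add: norm_mult norm_power power_le_one mult_left_le)
    then show "norm (?near K t) \<le> norm (zoom_factor l K)" "norm (?far K t) \<le> norm (zoom_factor l K)" by auto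
  qed
  have "(LINT t:region l|Rn n. zoom_factor l K * of_real (decay l t ^ K) * (weight t * pole_product \<tau> t))
      = (LINT t|Rn n. ?near K t * ?base t) + (LINT t|Rn n. ?far K t * ?base t)" for K
  proof -
    have "(LINT t:region l|Rn n. zoom_factor l K * of_real (decay l t ^ K) * (weight t * pole_product \<tau> t))
        = (LINT t|Rn n. ?near K t * ?base t + ?far K t * ?base t)"
      unfolding set_lebesgue_integral_def by (intro Bochner_Integration.integral_cong refl) auto
    also have "\<dots> = (LINT t|Rn n. ?near K t * ?base t) + (LINT t|Rn n. ?far K t * ?base t)"
      by (intro Bochner_Integration.integral_add
        integrable_mult_bounded[OF integrable_weight_pole_product _ bounded(1)]
          integrable_mult_bounded[OF integrable_weight_pole_product _ bounded(2)]) measurable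
    finally show ?thesis .
  qed
  then show ?thesis
    using tendsto_add[OF near_part_tendsto far_part_tendsto_0]
    by (simp only: near_part_eq(1)[OF zero_less_Suc] add_0_right)
qed

end

definition row_factor :: "nat \<Rightarrow> (nat \<Rightarrow> nat) \<Rightarrow> complex" where
  "row_factor K l = zoom_factor l K / of_real ((\<Prod>s=1..p - 1. width s ^ l s) ^ K)"

lemma omega_eq_sum_rearrangements:
  assumes m: "m \<in> Zset n (p - 1)"
  shows "omega n p z m t = (\<Sum>\<tau>\<in>rearrangements (Abs_multiset m) {1..n}. pole_product \<tau> t)"
proof -
  have m': "m \<in> Zset n p" using m Zset_pred_p_subset by blast
  have "sym_prod (image_mset (\<lambda>s x. 1 / of_real (x - z s)) (Abs_multiset m)) t {1..n}
      = (\<Prod>s=1..p. fact (m s)) * (\<Sum>\<tau>\<in>rearrangements (Abs_multiset m) {1..n}. pole_product \<tau> t)"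
    using sym_prod_eq_sum_rearrangements[of "{1..p}" "{1..n}" "Abs_multiset m" "\<lambda>s x. 1 / of_real (x - z s)" t]
      set_Abs_multiset_Zset[OF m'] size_Abs_multiset_Zset[OF m'] count_Abs_multiset_Zset[OF m']
    by (simp add: pole_product_def)
  then show ?thesis unfolding omega_eq_sym_prod[OF m'] by simp
qed

lemma rearrangements_range:
  assumes "m \<in> Zset n (p - 1)" "\<tau> \<in> rearrangements (Abs_multiset m) {1..n}" "i \<in> {1..n}"
  shows "\<tau> i \<in> {1..<p}"
  using rearrangements_mem[OF finite_atLeastAtMost assms(2,3)] set_Abs_multiset_Zset[OF assms(1)]
    interval_pred_p by blast

lemma set_integrable_decay_pole_product:
  assumes l: "l \<in> Zset n (p - 1)" and m: "m \<in> Zset n (p - 1)" and \<tau>: "\<tau> \<in> rearrangements (Abs_multiset m) {1..n}"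
  shows "set_integrable (Rn n) (region l) (\<lambda>t. zoom_factor l K * of_real (decay l t ^ K) * (weight t * pole_product \<tau> t))"
proof -
  have "integrable (Rn n) (\<lambda>t. (zoom_factor l K * of_real (decay l t ^ K))
      * (indicator (region l) t *\<^sub>R (weight t * pole_product \<tau> t)))"
  proof (rule integrable_mult_bounded[OF integrable_weight_pole_product[OF l rearrangements_range[OF m \<tau>]]])
    show "norm (zoom_factor l K * of_real (decay l t ^ K)) \<le> norm (zoom_factor l K)"
      if "indicator (region l) t *\<^sub>R (weight t * pole_product \<tau> t) \<noteq> 0" for t
      using decay_bounds(1,2)[OF l, of t] that
      by (auto simp: indicator_def norm_mult norm_power power_le_one mult_left_le split: if_splits)
  qed (use measurable_decay in measurable)
  then show ?thesis by (simp add: set_integrable_def)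
qed

lemma row_factor_times_entry:
  assumes l: "l \<in> Zset n (p - 1)" and m: "m \<in> Zset n (p - 1)"
  shows "row_factor K l * configuration.entry n p z (\<alpha>(p := \<alpha> p + of_nat K)) \<gamma> l m
    = (\<Sum>\<tau>\<in>rearrangements (Abs_multiset m) {1..n}.
        (LINT t:region l|Rn n. zoom_factor l K * of_real (decay l t ^ K) * (weight t * pole_product \<tau> t)))"
proof -
  interpret shifted: configuration n p z "\<alpha>(p := \<alpha> p + of_nat K)" \<gamma> by (rule configuration_shifted)
  let ?R = "rearrangements (Abs_multiset m) {1..n}"
  have widths: "(\<Prod>s=1..p - 1. width s ^ l s) = (\<Prod>i=1..n. width (site l i))" by (rule prod_site[OF l, symmetric])
  have integrand: "row_factor K l * (shifted.weight t * omega n p z m t)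
      = (\<Sum>\<tau>\<in>?R. zoom_factor l K * of_real (decay l t ^ K) * (weight t * pole_product \<tau> t))" if "t \<in> region l" for t
  proof -
    have cube: "t \<in> cube" using region_subset_cube[OF l] that by blast
    have "row_factor K l * shifted.weight t = zoom_factor l K * of_real (decay l t ^ K) * weight t"
      unfolding weight_shifted[OF cube] row_factor_def widths decay_def
      by (simp add: prod_dividef prod_power_distrib power_divide)
    then show ?thesis
      unfolding omega_eq_sum_rearrangements[OF m] by (simp add: sum_distrib_left flip: mult.assoc)
  qed
  have "(\<Sum>\<tau>\<in>?R. (LINT t:region l|Rn n. zoom_factor l K * of_real (decay l t ^ K)
      * (weight t * pole_product \<tau> t)))
      = (LINT t:region l|Rn n. (\<Sum>\<tau>\<in>?R. zoom_factor l K * of_real (decay l t ^ K) * (weight t * pole_product \<tau> t)))"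
    by (intro set_integral_sum[symmetric] set_integrable_decay_pole_product[OF l m])
  also have "\<dots> = (LINT t:region l|Rn n. row_factor K l * (shifted.weight t * omega n p z m t))"
  proof -
    have "indicator (region l) t *\<^sub>R (\<Sum>\<tau>\<in>?R. zoom_factor l K * of_real (decay l t ^ K)
        * (weight t * pole_product \<tau> t))
        = indicator (region l) t *\<^sub>R (row_factor K l * (shifted.weight t * omega n p z m t))" for t
      using integrand[of t] by (cases "t \<in> region l") simp_all
    then show ?thesis unfolding set_lebesgue_integral_def by (simp only:)
  qed
  finally show ?thesis by (simp only: shifted.entry_def set_integral_mult_right)
qed

lemma restrict_site_mem_rearrangements_iff:
  assumes l: "l \<in> Zset n (p - 1)" and m: "m \<in> Zset n (p - 1)"
  shows "restrict (site l) {1..n} \<in> rearrangements (Abs_multiset m) {1..n} \<longleftrightarrow> m = l"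
proof -
  have "image_mset (restrict (site l) {1..n}) (mset_set {1..n}) = Abs_multiset l"
    unfolding image_mset_site[OF l, symmetric] by (intro image_mset_cong) simp
  then have "restrict (site l) {1..n} \<in> rearrangements (Abs_multiset m) {1..n} \<longleftrightarrow> Abs_multiset l = Abs_multiset m"
    by (simp only: rearrangements_def mem_Collect_eq restrict_extensional simp_thms)
  then show ?thesis
    using count_Abs_multiset_Zset[OF l] count_Abs_multiset_Zset[OF m] by metis
qed

lemma row_factor_times_entry_tendsto:
  assumes l: "l \<in> Zset n (p - 1)" and m: "m \<in> Zset n (p - 1)"
  shows "(\<lambda>k. row_factor (Suc k) l * configuration.entry n p z (\<alpha>(p := \<alpha> p + of_nat (Suc k))) \<gamma> l m)
    \<longlonglongrightarrow> (if m = l then leading_coefficient l * (\<Prod>s=1..p - 1. laguerre_integral (l s) (\<alpha> s) \<gamma>) else 0)"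
proof -
  let ?R = "rearrangements (Abs_multiset m) {1..n}" and ?\<sigma> = "restrict (site l) {1..n}"
  let ?limit = "leading_coefficient l * (\<Prod>s=1..p - 1. laguerre_integral (l s) (\<alpha> s) \<gamma>)"
  have "(\<lambda>k. row_factor (Suc k) l * configuration.entry n p z (\<alpha>(p := \<alpha> p + of_nat (Suc k))) \<gamma> l m)
      \<longlonglongrightarrow> (\<Sum>\<tau>\<in>?R. (if \<forall>i\<in>{1..n}. \<tau> i = site l i then leading_coefficient l else 0)
        * (\<Prod>s=1..p - 1. laguerre_integral (l s) (\<alpha> s) \<gamma>))"
    unfolding row_factor_times_entry[OF l m]
    by (intro tendsto_sum integral_pole_product_tendsto l) (rule rearrangements_range[OF m])
  also have "(\<Sum>\<tau>\<in>?R. (if \<forall>i\<in>{1..n}. \<tau> i = site l i then leading_coefficient l else 0)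
      * (\<Prod>s=1..p - 1. laguerre_integral (l s) (\<alpha> s) \<gamma>))
      = (\<Sum>\<tau>\<in>?R. if \<tau> = ?\<sigma> then ?limit else 0)"
  proof (intro sum.cong refl)
    fix \<tau> assume "\<tau> \<in> ?R"
    then have "\<tau> \<in> extensional {1..n}" by (simp add: rearrangements_def)
    then have "(\<forall>i\<in>{1..n}. \<tau> i = site l i) \<longleftrightarrow> \<tau> = ?\<sigma>" by (auto simp: extensional_def fun_eq_iff)
    then show "(if \<forall>i\<in>{1..n}. \<tau> i = site l i then leading_coefficient l else 0)
        * (\<Prod>s=1..p - 1. laguerre_integral (l s) (\<alpha> s) \<gamma>)
        = (if \<tau> = ?\<sigma> then ?limit else 0)" by simp
  qed
  also have "(\<Sum>\<tau>\<in>?R. if \<tau> = ?\<sigma> then ?limit else 0) = (if m = l then ?limit else 0)"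
    using restrict_site_mem_rearrangements_iff[OF l m] by (simp add: finite_rearrangements)
  finally show ?thesis .
qed

end

section \<open>The determinant in terms of Laguerre integrals\<close>

lemma Gamma_nonzero_Re_pos: "Re x > 0 \<Longrightarrow> Gamma x \<noteq> 0"
  by (auto simp: Gamma_eq_zero_iff elim!: nonpos_Ints_cases)

lemma pochhammer_ratio_tendsto:
  assumes "Re x > 0" "Re y > 0"
  shows "(\<lambda>k. pochhammer x (Suc k) / pochhammer y (Suc k) * abs_powr (real (Suc k)) (y - x)) \<longlonglongrightarrow> Gamma y / Gamma x"
proof -
  have no_pole: "x \<notin> \<int>\<^sub>\<le>\<^sub>0" "y \<notin> \<int>\<^sub>\<le>\<^sub>0" using assms by (auto elim!: nonpos_Ints_cases)
  then have "(\<lambda>k. Gamma_series' y (Suc k) / Gamma_series' x (Suc k)) \<longlonglongrightarrow> Gamma y / Gamma x"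
    by (intro tendsto_divide LIMSEQ_Suc[OF Gamma_series'_LIMSEQ]) (auto simp: Gamma_eq_zero_iff)
  moreover have "Gamma_series' y (Suc k) / Gamma_series' x (Suc k)
      = pochhammer x (Suc k) / pochhammer y (Suc k) * abs_powr (real (Suc k)) (y - x)" for k
  proof -
    have "pochhammer x (Suc k) \<noteq> 0" "pochhammer y (Suc k) \<noteq> 0" using no_pole by (auto simp: pochhammer_eq_0_iff)
    moreover have "exp (y * of_real (ln (real (Suc k)))) / exp (x * of_real (ln (real (Suc k))))
        = abs_powr (real (Suc k)) (y - x)"
      by (simp add: abs_powr_eq_exp exp_diff left_diff_distrib del: of_nat_Suc)
    ultimately show ?thesis
      unfolding Gamma_series'_def by (simp add: divide_simps mult_ac del: of_nat_Suc pochhammer_Suc)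
  qed
  ultimately show ?thesis by simp
qed

context configuration
begin

abbreviation coord_count :: nat where
  "coord_count \<equiv> (p + n - 2) choose (p - 1)"

abbreviation pair_count :: nat where
  "pair_count \<equiv> (p + n - 2) choose p"

lemma
  fixes f :: "nat \<Rightarrow> 'a :: comm_semiring_1"
  shows prod_coord_power: "(\<Prod>l\<in>Zset n (p - 1). \<Prod>s=1..p - 1. f s ^ l s) = (\<Prod>s=1..p - 1. f s) ^ coord_count"
    and prod_coord_choose_2_power:
      "(\<Prod>l\<in>Zset n (p - 1). \<Prod>s=1..p - 1. f s ^ (l s choose 2)) = (\<Prod>s=1..p - 1. f s) ^ pair_count"
    and prod_coord_mult_power: "(\<Prod>l\<in>Zset n (p - 1). \<Prod>(r, s)\<in>ordered_pairs {1..p - 1}. F r s ^ (l r * l s))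
      = (\<Prod>(r, s)\<in>ordered_pairs {1..p - 1}. F r s :: 'a) ^ pair_count"
proof -
  have "n + (p - 1) - 1 = p + n - 2" "Suc (p - 1) = p" using p_ge_2 by auto
  then show "(\<Prod>l\<in>Zset n (p - 1). \<Prod>s=1..p - 1. f s ^ l s) = (\<Prod>s=1..p - 1. f s) ^ coord_count"
    "(\<Prod>l\<in>Zset n (p - 1). \<Prod>s=1..p - 1. f s ^ (l s choose 2)) = (\<Prod>s=1..p - 1. f s) ^ pair_count"
    "(\<Prod>l\<in>Zset n (p - 1). \<Prod>(r, s)\<in>ordered_pairs {1..p - 1}. F r s ^ (l r * l s))
      = (\<Prod>(r, s)\<in>ordered_pairs {1..p - 1}. F r s :: 'a) ^ pair_count"
    unfolding prod_Zset_coord_power prod_Zset_coord_choose_2_power prod_Zset_coord_mult_power by (simp_all only:)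
qed

lemma Re_contiguity_numerator_pos: "Re (contiguity_numerator r) > 0"
  using Re_\<alpha>_p Re_\<gamma>_pos by (simp add: contiguity_numerator_def add_pos_nonneg)

lemma Re_contiguity_denominator_pos: "Re (contiguity_denominator r) > 0"
  using Re_sum_\<alpha>_nonneg Re_\<alpha>_p Re_\<gamma>_pos unfolding contiguity_denominator_def sum_last by (simp add: add_pos_nonneg)

lemma sum_contiguity_exponents:
  "(\<Sum>m\<in>Zset n (p - 1). \<Sum>r<m 1. contiguity_denominator r - contiguity_numerator r)
    = of_nat coord_count * (\<Sum>s=1..p - 1. \<alpha> s) + of_nat (pair_count * (p - 1)) * (2 * \<gamma>)"
proof -
  let ?c = "\<lambda>r. card (Zset (n - 1 - r) (p - 1))"
  have p: "p - 1 = Suc (p - 2)" "p = Suc (Suc (p - 2))" "p + n - 2 = n + (p - 2)" using p_ge_2 by auto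
  have "1 \<in> {1..p - 1}" using p_ge_2 by simp
  then have "(\<Sum>m\<in>Zset n (p - 1). \<Sum>r<m 1. contiguity_denominator r - contiguity_numerator r)
      = (\<Sum>r<n. of_nat (?c r) * (contiguity_denominator r - contiguity_numerator r))"
    by (simp only: sum_Zset_lessThan sum_constant)
  also have "\<dots> = (\<Sum>r<n. of_nat (?c r) * (\<Sum>s=1..p - 1. \<alpha> s) + of_nat (?c r * (n - 1 - r)) * (2 * \<gamma>))"
  proof (intro sum.cong refl)
    fix r assume "r \<in> {..<n}"
    then have "2 * n - 2 - r = 2 * (n - 1 - r) + r" by auto
    then have "contiguity_denominator r - contiguity_numerator r
        = (\<Sum>s=1..p - 1. \<alpha> s) + of_nat (n - 1 - r) * (2 * \<gamma>)"
      unfolding contiguity_denominator_def contiguity_numerator_def sum_last interval_pred_p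
      by (simp only: of_nat_add of_nat_mult) (simp add: algebra_simps)
    then show "of_nat (?c r) * (contiguity_denominator r - contiguity_numerator r)
        = of_nat (?c r) * (\<Sum>s=1..p - 1. \<alpha> s) + of_nat (?c r * (n - 1 - r)) * (2 * \<gamma>)"
      by (simp only: of_nat_mult distrib_left mult.assoc)
  qed
  also have "\<dots> = of_nat (\<Sum>r<n. ?c r) * (\<Sum>s=1..p - 1. \<alpha> s) + of_nat (\<Sum>r<n. ?c r * (n - 1 - r)) * (2 * \<gamma>)"
    by (simp only: sum.distrib sum_distrib_right of_nat_sum)
  also have "(\<Sum>r<n. ?c r) = coord_count" by (simp only: p(1,3) sum_card_Zset)
  also have "(\<Sum>r<n. ?c r * (n - 1 - r)) = pair_count * (p - 1)"
    using sum_card_Zset_weighted[of n "p - 2"] p by (metis mult.commute)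
  finally show ?thesis .
qed

definition width_factor :: complex where
  "width_factor = (\<Prod>s=1..p - 1. abs_powr (width s) (\<alpha> s)) ^ coord_count
      * (\<Prod>s=1..p - 1. abs_powr (width s) (2 * \<gamma>)) ^ pair_count"

lemma prod_row_factor:
  assumes K: "K > 0"
  shows "width_factor * (\<Prod>l\<in>Zset n (p - 1). row_factor K l)
    = abs_powr (real K) (\<Sum>m\<in>Zset n (p - 1). \<Sum>r<m 1. contiguity_denominator r - contiguity_numerator r)
      / distance_product ^ K"
proof -
  let ?Z = "Zset n (p - 1)"
  have nonzero: "real K / width s \<noteq> 0" "width s \<noteq> 0" if "s \<in> {1..p - 1}" for s
    using K width_pos[of s] that by (auto simp: interval_pred_p[simplified])
  let ?scaled = "\<lambda>x. (\<Prod>s=1..p - 1. abs_powr (x s) (\<alpha> s)) ^ coord_count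
      * (\<Prod>s=1..p - 1. abs_powr (x s) (2 * \<gamma>)) ^ pair_count"
  have "(\<Prod>l\<in>?Z. zoom_factor l K)
      = (\<Prod>l\<in>?Z. (\<Prod>s=1..p - 1. abs_powr (real K / width s) (\<alpha> s) ^ l s)
        * (\<Prod>s=1..p - 1. abs_powr (real K / width s) (2 * \<gamma>) ^ (l s choose 2)))"
    unfolding zoom_factor_def zoom_exponent_def abs_powr_add prod.distrib[symmetric]
    by (intro prod.cong refl) (simp only: abs_powr_power[OF nonzero(1)])
  also have "\<dots> = ?scaled (\<lambda>s. real K / width s)"
    by (simp only: prod.distrib prod_coord_power prod_coord_choose_2_power)
  finally have "(\<Prod>l\<in>?Z. zoom_factor l K) * ?scaled width = ?scaled (\<lambda>s. real K / width s) * ?scaled width"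
    by (simp only:)
  also have "\<dots> = ?scaled (\<lambda>_. real K)"
  proof -
    have "(\<Prod>s=1..p - 1. abs_powr (real K / width s) (a s)) * (\<Prod>s=1..p - 1. abs_powr (width s) (a s))
        = (\<Prod>s=1..p - 1. abs_powr (real K) (a s))" for a
      unfolding prod.distrib[symmetric] abs_powr_mult[symmetric] using nonzero(2) by (intro prod.cong refl) simp
    from this[symmetric] show ?thesis by (simp only: power_mult_distrib mult_ac)
  qed
  also have "\<dots> = abs_powr (real K) (\<Sum>m\<in>?Z. \<Sum>r<m 1. contiguity_denominator r - contiguity_numerator r)"
    using K unfolding sum_contiguity_exponents abs_powr_add
    by (simp add: abs_powr_sum[symmetric] abs_powr_power mult_ac flip: power_mult)
  finally have zoom: "(\<Prod>l\<in>?Z. zoom_factor l K) * ?scaled width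
    = abs_powr (real K) (\<Sum>m\<in>?Z. \<Sum>r<m 1. contiguity_denominator r - contiguity_numerator r)" .
  have "(\<Prod>l\<in>?Z. of_real ((\<Prod>s=1..p - 1. width s ^ l s) ^ K)) = distance_product ^ K"
    by (simp add: distance_product_def width_def prod_power_distrib)
  then show ?thesis
    unfolding zoom[symmetric] by (simp add: width_factor_def row_factor_def prod_dividef)
qed

lemma prod_leading_coefficient:
  "width_factor * (\<Prod>l\<in>Zset n (p - 1). leading_coefficient l)
    = (\<Prod>(a, b)\<in>ordered_pairs {1..p}. abs_powr (z b - z a) (\<alpha> a + \<alpha> b)) ^ coord_count
      * (\<Prod>(a, b)\<in>ordered_pairs {1..p}. abs_powr (z b - z a) (2 * \<gamma>)) ^ pair_count"
proof -
  have interval_p: "{1..p} - {p} = {1..<p}" using p_ge_2 by auto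
  have leading: "(\<Prod>l\<in>Zset n (p - 1). leading_coefficient l)
      = (\<Prod>s=1..p - 1. outer_weight s (z s)) ^ coord_count
        * (\<Prod>(r, s)\<in>ordered_pairs {1..p - 1}. abs_powr (z s - z r) (2 * \<gamma>)) ^ pair_count"
  proof -
    have "(\<Prod>i=1..n. outer_weight (site l i) (z (site l i))) = (\<Prod>s=1..p - 1. outer_weight s (z s) ^ l s)"
      if "l \<in> Zset n (p - 1)" for l
      by (rule prod_site[OF that])
    then show ?thesis
      unfolding leading_coefficient_def
      by (simp only: prod.distrib prod_coord_power prod_coord_mult_power cong: prod.cong)
  qed
  have point_distances: "(\<Prod>s=1..p - 1. abs_powr (width s) (\<alpha> s)) * (\<Prod>s=1..p - 1. outer_weight s (z s))
      = (\<Prod>(a, b)\<in>ordered_pairs {1..p}. abs_powr (z b - z a) (\<alpha> a + \<alpha> b))"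
  proof -
    have "(\<Prod>s=1..p - 1. abs_powr (width s) (\<alpha> s)) * (\<Prod>s=1..p - 1. outer_weight s (z s))
        = (\<Prod>s=1..p. \<Prod>r\<in>{1..p} - {s}. abs_powr (z s - z r) (\<alpha> r))"
      unfolding prod_last outer_weight_def width_def interval_p interval_pred_p ..
    also have "\<dots> = (\<Prod>(a, b)\<in>ordered_pairs {1..p}. abs_powr (z a - z b) (\<alpha> b) * abs_powr (z b - z a) (\<alpha> a))"
      by (rule prod_off_diagonal) simp
    also have "\<dots> = (\<Prod>(a, b)\<in>ordered_pairs {1..p}. abs_powr (z b - z a) (\<alpha> a + \<alpha> b))"
      by (intro prod.cong refl) (auto simp: abs_powr_add abs_powr_minus_commute[of "z _" "z _" "\<alpha> _"])
    finally show ?thesis .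
  qed
  have pair_distances: "(\<Prod>s=1..p - 1. abs_powr (width s) (2 * \<gamma>))
      * (\<Prod>(r, s)\<in>ordered_pairs {1..p - 1}. abs_powr (z s - z r) (2 * \<gamma>))
      = (\<Prod>(a, b)\<in>ordered_pairs {1..p}. abs_powr (z b - z a) (2 * \<gamma>))"
    unfolding prod_ordered_pairs_lower[symmetric] unfolding prod_last width_def interval_pred_p ..
  show ?thesis
    unfolding width_factor_def leading point_distances[symmetric] pair_distances[symmetric]
    by (simp only: power_mult_distrib mult_ac)
qed

lemma scaled_det_entry_tendsto:
  "(\<lambda>k. (\<Prod>l\<in>Zset n (p - 1). row_factor (Suc k) l)
      * det_on (Zset n (p - 1)) (configuration.entry n p z (\<alpha>(p := \<alpha> p + of_nat (Suc k))) \<gamma>))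
    \<longlonglongrightarrow> (\<Prod>l\<in>Zset n (p - 1). leading_coefficient l)
      * (\<Prod>l\<in>Zset n (p - 1). \<Prod>s=1..p - 1. laguerre_integral (l s) (\<alpha> s) \<gamma>)"
proof -
  let ?Z = "Zset n (p - 1)"
  have "(\<lambda>k. det_on ?Z (\<lambda>l m. row_factor (Suc k) l
      * configuration.entry n p z (\<alpha>(p := \<alpha> p + of_nat (Suc k))) \<gamma> l m))
      \<longlonglongrightarrow> det_on ?Z (\<lambda>l m. if m = l
        then leading_coefficient l * (\<Prod>s=1..p - 1. laguerre_integral (l s) (\<alpha> s) \<gamma>) else 0)"
    by (intro tendsto_det_on row_factor_times_entry_tendsto)
  then show ?thesis
    by (simp only: det_on_scale_rows det_on_diagonal finite_Zset prod.distrib)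
qed

lemma distance_product_nonzero: "distance_product \<noteq> 0"
proof -
  have "z p - z s \<noteq> 0" if "s \<in> {1..p - 1}" for s
    using width_pos[OF that[unfolded interval_pred_p]] by (simp add: width_def)
  then have "of_real (z p - z s) ^ k \<noteq> (0 :: complex)" if "s \<in> {1..p - 1}" for s k
    using that by (simp only: power_not_zero of_real_eq_0_iff not_False_eq_True)
  then show ?thesis
    unfolding distance_product_def prod_zero_iff[OF finite_Zset] prod_zero_iff[OF finite_atLeastAtMost] by blast
qed

lemma det_entry:
  "det_on (Zset n (p - 1)) entry
    = (\<Prod>r<n. (Gamma (contiguity_numerator r) / Gamma (contiguity_denominator r)) ^ card (Zset (n - 1 - r) (p - 1)))
      * (\<Prod>l\<in>Zset n (p - 1). \<Prod>s=1..p - 1. laguerre_integral (l s) (\<alpha> s) \<gamma>)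
      * ((\<Prod>(a, b)\<in>ordered_pairs {1..p}. abs_powr (z b - z a) (\<alpha> a + \<alpha> b)) ^ coord_count
        * (\<Prod>(a, b)\<in>ordered_pairs {1..p}. abs_powr (z b - z a) (2 * \<gamma>)) ^ pair_count)"
    (is "?D = ?G * ?L * ?distances")
proof -
  let ?Z = "Zset n (p - 1)" and ?num = contiguity_numerator and ?den = contiguity_denominator
  let ?G' = "\<Prod>r<n. (Gamma (?den r) / Gamma (?num r)) ^ card (Zset (n - 1 - r) (p - 1))"
  let ?lead = "\<Prod>l\<in>?Z. leading_coefficient l"
  let ?det = "\<lambda>K. det_on ?Z (configuration.entry n p z (\<alpha>(p := \<alpha> p + of_nat K)) \<gamma>)"
  let ?ratios = "\<lambda>k. \<Prod>m\<in>?Z. \<Prod>r<m 1. pochhammer (?num r) (Suc k) / pochhammer (?den r) (Suc k)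
      * abs_powr (real (Suc k)) (?den r - ?num r)"
  have "(\<lambda>k. width_factor * ((\<Prod>l\<in>?Z. row_factor (Suc k) l) * ?det (Suc k))) \<longlonglongrightarrow> width_factor * (?lead * ?L)"
    by (intro tendsto_mult_left scaled_det_entry_tendsto)
  moreover have "width_factor * ((\<Prod>l\<in>?Z. row_factor (Suc k) l) * ?det (Suc k)) = ?ratios k * ?D" for k
  proof -
    have "?ratios k = (\<Prod>m\<in>?Z. \<Prod>r<m 1. pochhammer (?num r) (Suc k) / pochhammer (?den r) (Suc k))
        * abs_powr (real (Suc k)) (\<Sum>m\<in>?Z. \<Sum>r<m 1. ?den r - ?num r)"
      by (simp only: prod.distrib abs_powr_sum of_nat_eq_0_iff nat.distinct not_False_eq_True)
    then show ?thesis
      using prod_row_factor[OF zero_less_Suc, of k] distance_product_nonzero unfolding det_entry_iterate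
      by (simp add: field_simps del: of_nat_Suc pochhammer_Suc power_Suc)
  qed
  moreover have "(\<lambda>k. ?ratios k * ?D) \<longlonglongrightarrow> (\<Prod>m\<in>?Z. \<Prod>r<m 1. Gamma (?den r) / Gamma (?num r)) * ?D"
    by (intro tendsto_mult_right tendsto_prod pochhammer_ratio_tendsto Re_contiguity_numerator_pos
      Re_contiguity_denominator_pos)
  ultimately have "(\<Prod>m\<in>?Z. \<Prod>r<m 1. Gamma (?den r) / Gamma (?num r)) * ?D = width_factor * ?lead * ?L"
    using LIMSEQ_unique by (simp only: mult.assoc)
  moreover have "1 \<in> {1..p - 1}" using p_ge_2 by simp
  ultimately have limits: "?G' * ?D = ?distances * ?L"
    unfolding prod_leading_coefficient by (simp only: prod_Zset_lessThan)
  have "Gamma (?den r) \<noteq> 0" "Gamma (?num r) \<noteq> 0" for r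
    by (intro Gamma_nonzero_Re_pos Re_contiguity_numerator_pos Re_contiguity_denominator_pos)+
  then have inverse: "?G * ?G' = 1"
    by (simp add: prod.distrib[symmetric] power_mult_distrib[symmetric])
  have "?D = ?G * (?G' * ?D)"
    unfolding mult.assoc[symmetric] inverse by simp
  then show ?thesis
    unfolding limits by (simp only: mult_ac)
qed

end

section \<open>The Selberg and Laguerre integrals\<close>

locale selberg =
  fixes n :: nat and a b \<gamma> :: complex
  assumes Re_a_pos: "Re a > 0" and Re_b_pos: "Re b > 0" and Re_exponent_pos: "Re \<gamma> > 0"
begin

sublocale configuration n 2 "\<lambda>s. real (s - 1)" "\<lambda>s. if s = 1 then a else b - 1" \<gamma>
  by standard (use Re_a_pos Re_b_pos Re_exponent_pos in auto)

definition single :: "nat \<Rightarrow> nat" where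
  "single s = (if s = 1 then n else 0)"

lemma Zset_eq_single: "Zset n (2 - 1) = {single}"
  using Zset_1[of n] by (simp add: single_def[abs_def])

lemma single_in_Zset: "single \<in> Zset n (2 - 1)"
  using Zset_eq_single by simp

lemma site_single: "i \<in> {1..n} \<Longrightarrow> site single i = 1"
  using site_in_range[OF single_in_Zset] by simp

lemma region_single: "t \<in> region single \<longleftrightarrow> (\<forall>i\<in>{1..n}. t i \<in> {0..1}) \<and> mono_on {1..n} t"
  using region_iff[OF single_in_Zset, of t] site_single by (simp del: One_nat_def)

lemma rearrangements_single: "rearrangements (Abs_multiset single) {1..n} = {restrict (site single) {1..n}}"
proof -
  have "\<tau> = restrict (site single) {1..n}" if "\<tau> \<in> rearrangements (Abs_multiset single) {1..n}" for \<tau>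
  proof -
    have "\<tau> i = 1" if "i \<in> {1..n}" for i
      using rearrangements_range[OF single_in_Zset \<open>\<tau> \<in> _\<close> that] by auto
    moreover have "\<tau> \<in> extensional {1..n}" using that by (simp add: rearrangements_def)
    ultimately show ?thesis by (auto simp: fun_eq_iff extensional_def site_single)
  qed
  then show ?thesis using restrict_site_mem_rearrangements_iff[OF single_in_Zset single_in_Zset] by blast
qed

lemma entry_single: "entry single single = selberg_integral n a b \<gamma>"
proof -
  have "indicator (region single) t *\<^sub>R (weight t * omega n 2 (\<lambda>s. real (s - 1)) single t)
      = ordered_integrand {1..n} (selberg_density a b) \<gamma> t" for t
  proof (cases "t \<in> region single")
    case True
    then have t: "\<forall>i\<in>{1..n}. t i \<in> {0..1}" "mono_on {1..n} t" unfolding region_single by blast+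
    have "point_weight (t i) * (1 / of_real (t i)) = selberg_density a b (t i)" if "i \<in> {1..n}" for i
    proof -
      have "t i \<in> {0..1}" using t(1) that by blast
      then show ?thesis
        using abs_powr_add_1[of "t i" "a - 1"] abs_powr_minus_commute[of "t i" 1]
        unfolding point_weight_def selberg_density_def by (cases "t i = 0") (simp_all add: numeral_2_eq_2)
    qed
    then have points: "(\<Prod>i=1..n. point_weight (t i)) * (\<Prod>i=1..n. 1 / of_real (t i))
        = (\<Prod>i=1..n. selberg_density a b (t i))"
      unfolding prod.distrib[symmetric] by (intro prod.cong refl)
    have poles: "omega n 2 (\<lambda>s. real (s - 1)) single t = (\<Prod>i=1..n. 1 / of_real (t i))"
      using omega_eq_sum_rearrangements[OF single_in_Zset, of t] site_single
      by (simp add: rearrangements_single pole_product_def del: One_nat_def)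
    have "weight t * omega n 2 (\<lambda>s. real (s - 1)) single t
        = (\<Prod>i=1..n. selberg_density a b (t i)) * vandermonde {1..n} \<gamma> t"
      unfolding weight_def poles points[symmetric] by (simp only: mult_ac)
    then show ?thesis
      using True t(2) by (simp only: ordered_integrand_def if_True indicator_simps(1) scaleR_one)
  next
    case False
    then consider "\<not> mono_on {1..n} t" | i where "i \<in> {1..n}" "t i \<notin> {0..1}" unfolding region_single by blast
    then have "ordered_integrand {1..n} (selberg_density a b) \<gamma> t = 0"
    proof cases
      case 2
      then have "(\<Prod>i=1..n. selberg_density a b (t i)) = 0"
        by (intro prod_zero) (auto simp: selberg_density_def)
      then show ?thesis by (simp add: ordered_integrand_def)
    qed (simp add: ordered_integrand_def)
    then show ?thesis using False by (simp only: indicator_simps(2) not_False_eq_True scaleR_zero_left)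
  qed
  then show ?thesis
    unfolding entry_def selberg_integral_def set_lebesgue_integral_def by (simp only:)
qed

lemma selberg_integral_eq_laguerre_integral:
  "selberg_integral n a b \<gamma>
      = laguerre_integral n a \<gamma> * (\<Prod>r<n. Gamma (b + of_nat r * \<gamma>) / Gamma (a + b + of_nat (2 * n - 2 - r) * \<gamma>))"
proof -
  have "selberg_integral n a b \<gamma> = det_on {single} (\<lambda>l m. if m = l then entry l l else 0)"
    by (simp add: det_on_diagonal entry_single del: One_nat_def)
  also have "\<dots> = det_on (Zset n (2 - 1)) entry"
    unfolding Zset_eq_single by (intro det_on_cong) simp
  also have "\<dots> = (\<Prod>r<n. Gamma (b + of_nat r * \<gamma>) / Gamma (a + b + of_nat (2 * n - 2 - r) * \<gamma>))
      * laguerre_integral n a \<gamma>"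
  proof -
    have "card (Zset (n - 1 - r) (2 - 1)) = 1" for r using Zset_1[of "n - 1 - r"] by simp
    moreover have "contiguity_numerator r = b + of_nat r * \<gamma>" for r unfolding contiguity_numerator_def by simp
    moreover have "contiguity_denominator r = a + b + of_nat (2 * n - 2 - r) * \<gamma>" for r
      unfolding contiguity_denominator_def by (simp add: numeral_2_eq_2)
    moreover have "(\<Prod>(r, s)\<in>ordered_pairs {1..2}. abs_powr (real (s - 1) - real (r - 1)) (c r s)) = 1"
      for c :: "nat \<Rightarrow> nat \<Rightarrow> complex"
      unfolding prod_ordered_pairs_lower[symmetric] by (simp add: numeral_2_eq_2)
    ultimately show ?thesis
      unfolding det_entry by (simp add: Zset_eq_single[simplified] single_def[of "Suc 0"])
  qed
  finally show ?thesis by (simp only: mult.commute)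
qed

end

lemma laguerre_integral_exchange:
  assumes pos: "Re a > 0" "Re b > 0" "Re \<gamma> > 0"
  shows "laguerre_integral n a \<gamma> * (\<Prod>r<n. Gamma (b + of_nat r * \<gamma>))
      = laguerre_integral n b \<gamma> * (\<Prod>r<n. Gamma (a + of_nat r * \<gamma>))"
proof -
  interpret ab: selberg n a b \<gamma> by standard (fact pos)+
  interpret ba: selberg n b a \<gamma> by standard (fact pos)+
  have "Gamma (a + b + of_nat r * \<gamma>) \<noteq> 0" for r
    using pos by (intro Gamma_nonzero_Re_pos) (simp add: add_pos_nonneg)
  then have "(\<Prod>r<n. Gamma (a + b + of_nat (2 * n - 2 - r) * \<gamma>)) \<noteq> 0"
    unfolding prod_zero_iff[OF finite_lessThan] by blast
  then show ?thesis
    using ab.selberg_integral_eq_laguerre_integral ba.selberg_integral_eq_laguerre_integral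
      selberg_integral_commute[of n a b]
    by (simp add: prod_dividef add.commute[of b a])
qed

lemma prod_Gamma_shift_2:
  assumes \<gamma>: "Re \<gamma> > 0"
  shows "(\<Prod>r<n. Gamma (1 + 2 * \<gamma> + of_nat r * \<gamma>)) / of_nat (Suc n)
    = (\<Prod>r<Suc n. Gamma (1 + of_nat r * \<gamma>)) * (Gamma (of_nat (Suc n) * \<gamma>) / Gamma \<gamma>)"
proof -
  have plus1: "Gamma (1 + of_nat (Suc k) * \<gamma>) = of_nat (Suc k) * \<gamma> * Gamma (of_nat (Suc k) * \<gamma>)" for k
  proof -
    have "Re (of_nat (Suc k) * \<gamma>) > 0" using \<gamma> by (simp del: of_nat_Suc)
    then have "Gamma (of_nat (Suc k) * \<gamma>) \<noteq> 0" by (rule Gamma_nonzero_Re_pos)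
    then show ?thesis unfolding Gamma_eq_zero_iff using Gamma_plus1[of "of_nat (Suc k) * \<gamma>"]
      by (simp only: add.commute[of 1] not_False_eq_True)
  qed
  have "Gamma (1 + \<gamma>) * (\<Prod>r<n. Gamma (1 + 2 * \<gamma> + of_nat r * \<gamma>)) = (\<Prod>r<Suc (Suc n). Gamma (1 + of_nat r * \<gamma>))"
    unfolding prod.lessThan_Suc_shift by (simp add: algebra_simps)
  also have "\<dots> = (\<Prod>r<Suc n. Gamma (1 + of_nat r * \<gamma>)) * (of_nat (Suc n) * \<gamma> * Gamma (of_nat (Suc n) * \<gamma>))"
    by (simp only: prod.lessThan_Suc[of _ "Suc n"] plus1)
  finally have "\<gamma> * Gamma \<gamma> * (\<Prod>r<n. Gamma (1 + 2 * \<gamma> + of_nat r * \<gamma>))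
      = (\<Prod>r<Suc n. Gamma (1 + of_nat r * \<gamma>)) * (of_nat (Suc n) * \<gamma> * Gamma (of_nat (Suc n) * \<gamma>))"
    using plus1[of 0] by simp
  moreover have "\<gamma> \<noteq> 0" "Gamma \<gamma> \<noteq> 0" using Gamma_nonzero_Re_pos[OF \<gamma>] \<gamma> by auto
  moreover have "x / k = y * (h / g)"
    if "c * g * x = y * (k * c * h)" "c \<noteq> 0" "g \<noteq> 0" "k \<noteq> 0" for c g x y k h :: complex
    using that by (simp add: field_simps)
  ultimately show ?thesis using of_nat_neq_0 by blast
qed

theorem laguerre_integral_eq:
  assumes "Re a > 0" and \<gamma>: "Re \<gamma> > 0"
  shows "laguerre_integral n a \<gamma> = (\<Prod>r<n. Gamma (a + of_nat r * \<gamma>) * (Gamma (of_nat (Suc r) * \<gamma>) / Gamma \<gamma>))"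
  using assms(1)
proof (induction n arbitrary: a)
  case 0
  show ?case
    by (simp add: laguerre_integral_def ordered_integrand_def mono_on_def PiM_empty)
next
  case (Suc n)
  let ?\<Gamma> = "\<lambda>x. \<Prod>r<Suc n. Gamma (x + of_nat r * \<gamma>)" and ?ratios = "\<lambda>n. \<Prod>r<n. Gamma (of_nat (Suc r) * \<gamma>) / Gamma \<gamma>"
  have "Gamma (1 + of_nat r * \<gamma>) \<noteq> 0" for r
    using \<gamma> by (intro Gamma_nonzero_Re_pos) (simp add: add_pos_nonneg)
  then have nonzero: "?\<Gamma> 1 \<noteq> 0" by simp
  have "?\<Gamma> 1 * laguerre_integral (Suc n) a \<gamma> = laguerre_integral (Suc n) 1 \<gamma> * ?\<Gamma> a"
    using laguerre_integral_exchange[of a 1 \<gamma> "Suc n"] Suc.prems \<gamma>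
    by (simp only: mult.commute one_complex.sel zero_less_one)
  also have "laguerre_integral (Suc n) 1 \<gamma> = (\<Prod>r<n. Gamma (1 + 2 * \<gamma> + of_nat r * \<gamma>)) / of_nat (Suc n) * ?ratios n"
  proof -
    have "Re (1 + 2 * \<gamma>) > 0" using \<gamma> by simp
    from Suc.IH[OF this] show ?thesis
      by (simp only: laguerre_integral_Suc_1[OF \<gamma>] prod.distrib times_divide_eq_left)
  qed
  also have "\<dots> = ?\<Gamma> 1 * ?ratios (Suc n)"
    unfolding prod_Gamma_shift_2[OF \<gamma>] prod.lessThan_Suc[of _ n] by (simp only: mult_ac)
  finally have "?\<Gamma> 1 * laguerre_integral (Suc n) a \<gamma> = ?\<Gamma> 1 * (?\<Gamma> a * ?ratios (Suc n))"
    by (simp only: mult_ac)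
  then show ?case
    using nonzero by (simp only: prod.distrib mult_cancel_left) simp
qed

section \<open>Phases and conclusion\<close>

lemma br_pow_of_real: "br_pow (of_real x) a = (if x < 0 then exp (\<i> * pi * a) else 1) * abs_powr x a"
proof -
  consider "x = 0" | "x > 0" | "x < 0" by linarith
  then show ?thesis
  proof cases
    case 1
    then show ?thesis by (simp add: br_pow_def)
  next
    case 2
    then have "br_log (of_real x) = of_real (ln x)"
      using pi_gt_zero by (simp add: br_log_def Ln_of_real not_le)
    then show ?thesis using 2 by (simp add: br_pow_def abs_powr_eq_exp)
  next
    case 3
    then have "Ln (of_real x) = of_real (ln (- x)) + \<i> * pi"
      using Ln_minus[of "of_real (- x)"] Ln_of_real[of "- x"] by simp
    moreover have "- (pi / 2) < pi" using pi_gt_zero by linarith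
    ultimately have "br_log (of_real x) = of_real (ln (- x)) + \<i> * pi" by (simp add: br_log_def)
    then show ?thesis using 3 by (simp add: br_pow_def abs_powr_eq_exp distrib_left exp_add mult_ac)
  qed
qed

context configuration
begin

definition phase :: "nat \<Rightarrow> complex" where
  "phase r = (\<Prod>s=1..p. if r < s then exp (\<i> * pi * \<alpha> s) else 1)"

lemma less_z_iff_site_less:
  assumes l: "l \<in> Zset n (p - 1)" and t: "t \<in> region l" and i: "i \<in> {1..n}" and s: "s \<in> {1..p}" and "t i \<noteq> z s"
  shows "t i < z s \<longleftrightarrow> site l i < s"
proof -
  have bounds: "z (site l i) \<le> t i" "t i \<le> z (site l i + 1)" using t i by (auto simp: region_iff[OF l])
  have "z s \<le> z (site l i)" if "\<not> site l i < s" using that site_in_range[OF l i] s by (intro z_le) auto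
  moreover have "z (site l i + 1) \<le> z s" if "site l i < s" using that s by (intro z_le) auto
  ultimately show ?thesis using bounds \<open>t i \<noteq> z s\<close> by fastforce
qed

lemma Phi_eq_phase_times_weight:
  assumes l: "l \<in> Zset n (p - 1)" and t: "t \<in> region l"
  shows "Phi n p z \<alpha> \<gamma> t = (\<Prod>i=1..n. phase (site l i)) * weight t"
proof -
  have "br_pow (of_real (t i - z s)) (\<alpha> s)
      = (if site l i < s then exp (\<i> * pi * \<alpha> s) else 1) * abs_powr (t i - z s) (\<alpha> s)"
    if "i \<in> {1..n}" "s \<in> {1..p}" for i s
    unfolding br_pow_of_real using less_z_iff_site_less[OF l t that] by (cases "t i = z s") simp_all
  then have "(\<Prod>i=1..n. \<Prod>s=1..p. br_pow (of_real (t i - z s)) (\<alpha> s))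
      = (\<Prod>i=1..n. phase (site l i) * point_weight (t i))"
    unfolding phase_def point_weight_def prod.distrib[symmetric] by (intro prod.cong refl)
  moreover have "br_pow (of_real (t j - t i)) (2 * \<gamma>) = abs_powr (t j - t i) (2 * \<gamma>)"
    if "(i, j) \<in> ordered_pairs {1..n}" for i j
  proof -
    have "t i \<le> t j" using t that by (auto simp: region_iff[OF l] ordered_pairs_def intro: mono_onD)
    then show ?thesis by (simp add: br_pow_of_real del: of_real_diff)
  qed
  then have "(\<Prod>i=1..n. \<Prod>j\<in>{i<..n}. br_pow (of_real (t j - t i)) (2 * \<gamma>)) = vandermonde {1..n} \<gamma> t"
    unfolding prod_ordered_pairs_upper vandermonde_def by (intro prod.cong refl) auto
  ultimately show ?thesis
    unfolding Phi_def weight_def by (subst prod.swap) (simp only: prod.distrib mult.assoc)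
qed

lemma integral_Phi_omega:
  assumes l: "l \<in> Zset n (p - 1)"
  shows "(LINT t:region l|Rn n. Phi n p z \<alpha> \<gamma> t * omega n p z m t) = (\<Prod>i=1..n. phase (site l i)) * entry l m"
proof -
  have "indicator (region l) t *\<^sub>R (Phi n p z \<alpha> \<gamma> t * omega n p z m t)
      = indicator (region l) t *\<^sub>R ((\<Prod>i=1..n. phase (site l i)) * (weight t * omega n p z m t))" for t
    using Phi_eq_phase_times_weight[OF l, of t] by (cases "t \<in> region l") simp_all
  then have "(LINT t:region l|Rn n. Phi n p z \<alpha> \<gamma> t * omega n p z m t)
      = (LINT t:region l|Rn n. (\<Prod>i=1..n. phase (site l i)) * (weight t * omega n p z m t))"
    unfolding set_lebesgue_integral_def by (simp only:)
  then show ?thesis by (simp only: entry_def set_integral_mult_right)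
qed

lemma prod_phase: "(\<Prod>r=1..p - 1. phase r) ^ coord_count
    = exp (\<i> * pi * of_nat coord_count * (\<Sum>s=1..p. of_nat (s - 1) * \<alpha> s))"
proof -
  have "(\<Prod>r=1..p - 1. phase r) = (\<Prod>s=1..p. \<Prod>r=1..p - 1. if r < s then exp (\<i> * pi * \<alpha> s) else 1)"
    unfolding phase_def by (rule prod.swap)
  also have "\<dots> = (\<Prod>s=1..p. exp (of_nat (s - 1) * (\<i> * pi * \<alpha> s)))"
  proof (intro prod.cong refl)
    fix s assume "s \<in> {1..p}"
    then have "{r \<in> {1..p - 1}. r < s} = {1..<s}" by auto
    then show "(\<Prod>r=1..p - 1. if r < s then exp (\<i> * pi * \<alpha> s) else 1) = exp (of_nat (s - 1) * (\<i> * pi * \<alpha> s))"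
      unfolding prod.inter_filter[OF finite_atLeastAtMost, symmetric] exp_of_nat_mult by simp
  qed
  also have "\<dots> = exp (\<i> * pi * (\<Sum>s=1..p. of_nat (s - 1) * \<alpha> s))"
    by (simp only: exp_sum[OF finite_atLeastAtMost] sum_distrib_left mult_ac)
  finally show ?thesis by (simp only: exp_of_nat_mult[symmetric] mult_ac)
qed

lemma det_integral_Phi_omega:
  "det_on (Zset n (p - 1)) (\<lambda>l m. LINT t:region l|Rn n. Phi n p z \<alpha> \<gamma> t * omega n p z m t)
    = exp (\<i> * pi * of_nat coord_count * (\<Sum>s=1..p. of_nat (s - 1) * \<alpha> s)) * det_on (Zset n (p - 1)) entry"
proof -
  have "(\<Prod>l\<in>Zset n (p - 1). \<Prod>i=1..n. phase (site l i)) = (\<Prod>r=1..p - 1. phase r) ^ coord_count"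
    unfolding prod_coord_power[symmetric] by (intro prod.cong refl prod_site)
  moreover have "det_on (Zset n (p - 1)) (\<lambda>l m. LINT t:region l|Rn n. Phi n p z \<alpha> \<gamma> t * omega n p z m t)
      = det_on (Zset n (p - 1)) (\<lambda>l m. (\<Prod>i=1..n. phase (site l i)) * entry l m)"
    by (intro det_on_cong integral_Phi_omega)
  ultimately show ?thesis by (simp only: det_on_scale_rows prod_phase)
qed

lemma prod_distances:
  "(\<Prod>(a, b)\<in>ordered_pairs {1..p}. abs_powr (z b - z a) (\<alpha> a + \<alpha> b)) ^ coord_count
      * (\<Prod>(a, b)\<in>ordered_pairs {1..p}. abs_powr (z b - z a) (2 * \<gamma>)) ^ pair_count
    = (\<Prod>b=1..p. \<Prod>a=1..<b. br_pow (complex_of_real (z b - z a)) ((\<alpha> a + \<alpha> b) * of_nat coord_count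
      + 2 * \<gamma> * of_nat pair_count))"
proof -
  have "abs_powr (z b - z a) (\<alpha> a + \<alpha> b) ^ coord_count * abs_powr (z b - z a) (2 * \<gamma>) ^ pair_count
      = br_pow (complex_of_real (z b - z a)) ((\<alpha> a + \<alpha> b) * of_nat coord_count + 2 * \<gamma> * of_nat pair_count)"
    if "b \<in> {1..p}" "a \<in> {1..<b}" for a b
  proof -
    have "z a < z b" using z_less[of a b] that by simp
    then have nonneg: "\<not> z b - z a < 0" and nonzero: "z b - z a \<noteq> 0" by auto
    show ?thesis
      unfolding br_pow_of_real abs_powr_power[OF nonzero] abs_powr_add[symmetric] if_not_P[OF nonneg] mult_1
      by (simp only: mult.commute)
  qed
  then show ?thesis
    unfolding prod_ordered_pairs_lower[symmetric] prod_power_distrib prod.distrib[symmetric]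
    by (intro prod.cong refl)
qed

lemma prod_laguerre_integral:
  "(\<Prod>l\<in>Zset n (p - 1). \<Prod>s=1..p - 1. laguerre_integral (l s) (\<alpha> s) \<gamma>)
    = (\<Prod>r<n. ((\<Prod>s=1..p - 1. Gamma (\<alpha> s + of_nat r * \<gamma>))
      * (Gamma (of_nat (Suc r) * \<gamma>) ^ (p - 1) / Gamma \<gamma> ^ (p - 1)))
        ^ card (Zset (n - 1 - r) (p - 1)))"
proof -
  let ?factor = "\<lambda>s r. Gamma (\<alpha> s + of_nat r * \<gamma>) * (Gamma (of_nat (Suc r) * \<gamma>) / Gamma \<gamma>)"
  have "(\<Prod>l\<in>Zset n (p - 1). \<Prod>s=1..p - 1. laguerre_integral (l s) (\<alpha> s) \<gamma>)
      = (\<Prod>l\<in>Zset n (p - 1). \<Prod>s=1..p - 1. \<Prod>r<l s. ?factor s r)"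
    using Re_\<alpha>_pos Re_\<gamma>_pos unfolding interval_pred_p by (intro prod.cong refl laguerre_integral_eq) auto
  also have "\<dots> = (\<Prod>s=1..p - 1. \<Prod>l\<in>Zset n (p - 1). \<Prod>r<l s. ?factor s r)" by (rule prod.swap)
  also have "\<dots> = (\<Prod>s=1..p - 1. \<Prod>r<n. ?factor s r ^ card (Zset (n - 1 - r) (p - 1)))"
    by (intro prod.cong refl prod_Zset_lessThan)
  also have "\<dots> = (\<Prod>r<n. \<Prod>s=1..p - 1. ?factor s r ^ card (Zset (n - 1 - r) (p - 1)))" by (rule prod.swap)
  also have "\<dots> = (\<Prod>r<n. (\<Prod>s=1..p - 1. ?factor s r) ^ card (Zset (n - 1 - r) (p - 1)))"
    by (simp only: prod_power_distrib)
  finally show ?thesis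
    by (simp only: prod.distrib prod_constant card_atLeastAtMost add_diff_cancel_right' Suc_eq_plus1 power_divide)
qed

lemma prod_Gamma:
  "(\<Prod>r<n. (Gamma (contiguity_numerator r) / Gamma (contiguity_denominator r)) ^ card (Zset (n - 1 - r) (p - 1)))
      * (\<Prod>l\<in>Zset n (p - 1). \<Prod>s=1..p - 1. laguerre_integral (l s) (\<alpha> s) \<gamma>)
    = (\<Prod>s=0..<n.
         ((Gamma (of_nat (s + 1) * \<gamma>) ^ (p - 1) / Gamma \<gamma> ^ (p - 1)) *
          (Gamma (1 + \<alpha> p + of_nat s * \<gamma>) * (\<Prod>j=1..p-1. Gamma (\<alpha> j + of_nat s * \<gamma>)) /
           Gamma (1 + (\<Sum>j=1..p. \<alpha> j) + (2 * of_nat n - 2 - of_nat s) * \<gamma>)))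
         ^ ((p + n - s - 3) choose (p - 2)))"
  unfolding prod_laguerre_integral prod.distrib[symmetric] power_mult_distrib[symmetric] atLeast0LessThan
proof (intro prod.cong refl arg_cong2[of _ _ _ _ "(^)"])
  fix s assume s: "s \<in> {..<n}"
  have "n - 1 - s + (p - 2) = p + n - s - 3" "p - 1 = Suc (p - 2)" using s p_ge_2 by auto
  then show "card (Zset (n - 1 - s) (p - 1)) = (p + n - s - 3) choose (p - 2)" by (simp only: card_Zset)
  have "2 * n - 2 - s + s + 2 = 2 * n" using s by auto
  then have "of_nat (2 * n - 2 - s) + of_nat s + 2 = (2 * of_nat n :: complex)"
    by (metis of_nat_add of_nat_mult of_nat_numeral)
  then have "of_nat (2 * n - 2 - s) = (2 * of_nat n - 2 - of_nat s :: complex)" by (simp only: eq_diff_eq)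
  then show "Gamma (contiguity_numerator s) / Gamma (contiguity_denominator s)
      * ((\<Prod>j=1..p - 1. Gamma (\<alpha> j + of_nat s * \<gamma>)) * (Gamma (of_nat (Suc s) * \<gamma>) ^ (p - 1) / Gamma \<gamma> ^ (p - 1)))
    = (Gamma (of_nat (s + 1) * \<gamma>) ^ (p - 1) / Gamma \<gamma> ^ (p - 1)) *
      (Gamma (1 + \<alpha> p + of_nat s * \<gamma>) * (\<Prod>j=1..p-1. Gamma (\<alpha> j + of_nat s * \<gamma>)) /
       Gamma (1 + (\<Sum>j=1..p. \<alpha> j) + (2 * of_nat n - 2 - of_nat s) * \<gamma>))"
    unfolding contiguity_numerator_def contiguity_denominator_def
    by (simp only: Suc_eq_plus1 divide_inverse mult_ac)
qed

end

theorem theorem4: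
  fixes n p :: nat and z :: "nat \<Rightarrow> real" and \<alpha> :: "nat \<Rightarrow> complex" and \<gamma> :: complex
  assumes "p \<ge> 2"
    and "\<And>s. s \<in> {1..<p} \<Longrightarrow> z s < z (s + 1)"
    and "\<And>s. s \<in> {1..p} \<Longrightarrow> Re (\<alpha> s) > 0"
    and "Re \<gamma> > 0"
  shows "det_on (Zset n (p - 1))
           (\<lambda>l m. set_lebesgue_integral (Rn n) (Uset n p z l)
                    (\<lambda>t. Phi n p z \<alpha> \<gamma> t * omega n p z m t))
    = (\<Prod>s=0..<n.
         ((Gamma (of_nat (s + 1) * \<gamma>) ^ (p - 1) / Gamma \<gamma> ^ (p - 1)) *
          (Gamma (1 + \<alpha> p + of_nat s * \<gamma>) * (\<Prod>j=1..p-1. Gamma (\<alpha> j + of_nat s * \<gamma>)) /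
           Gamma (1 + (\<Sum>j=1..p. \<alpha> j) + (2 * of_nat n - 2 - of_nat s) * \<gamma>)))
         ^ ((p + n - s - 3) choose (p - 2)))
      * exp (\<i> * pi * of_nat ((p + n - 2) choose (p - 1)) * (\<Sum>s=1..p. of_nat (s - 1) * \<alpha> s))
      * (\<Prod>b=1..p. \<Prod>a=1..<b.
           br_pow (complex_of_real (z b - z a))
             ((\<alpha> a + \<alpha> b) * of_nat ((p + n - 2) choose (p - 1))
              + 2 * \<gamma> * of_nat ((p + n - 2) choose p)))"
proof -
  have "Re (\<alpha> p) > 0" by (rule assms(3)) (use assms(1) in simp)
  then interpret configuration n p z \<alpha> \<gamma>
    by unfold_locales (use assms in \<open>auto intro: less_trans[of "- 1" 0]\<close>)
  show ?thesis
    unfolding det_integral_Phi_omega det_entry prod_Gamma prod_distances by (simp only: mult_ac)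
qed

end
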